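(* Let $r > 2$ be a prime and let $A_r$ be the quaternion algebra over $\mathbb{Q}$ ramified exactly at $r$ and $\infty$. Let $m$ be a positive integer coprime to $r$, and set $C(r) = r^2/16$. If $m > C(r)$, then $m$ is not an outlier for $A_r$.
   Context: An element of $A_r$ is an integer if its monic minimal polynomial over $\mathbb{Q}$ has coefficients in $\mathbb{Z}$. A positive integer $m$ is an outlier for $A_r$ if it is not the reduced norm of any integer of $A_r$ (every positive integer is a reduced norm of some element of $A_r$). *)

theory Defs
  imports
    Complex_Main
    "HOL-Computational_Algebra.Computational_Algebra"
    "HOL-Algebra.QuotRing"
    "HOL-Algebra.Algebraic_Closure_Type"
begin

section \<open>Quaternion algebras\<close>

text \<open>
  \<open>Quat x0 x1 x2 x3\<close> stands for \<open>x0 + x1 i + x2 j + x3 ij\<close>. Over a field \<open>R\<close> of characteristic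
  different from 2, with \<open>a\<close> and \<open>b\<close> nonzero, \<open>quat_algebra R a b\<close> is the quaternion algebra
  \<open>(a, b | R)\<close>, with \<open>i\<^sup>2 = a\<close>, \<open>j\<^sup>2 = b\<close> and \<open>ji = -ij\<close>. Every quaternion algebra over such a field
  is of this form up to isomorphism.
\<close>

datatype 'a quat = Quat (q_re: 'a) (q_i: 'a) (q_j: 'a) (q_k: 'a)

definition quat_mult :: "('a, 'm) ring_scheme \<Rightarrow> 'a \<Rightarrow> 'a \<Rightarrow> 'a quat \<Rightarrow> 'a quat \<Rightarrow> 'a quat" where
  "quat_mult R a b x y =
    Quat
      (q_re x \<otimes>\<^bsub>R\<^esub> q_re y \<oplus>\<^bsub>R\<^esub> a \<otimes>\<^bsub>R\<^esub> (q_i x \<otimes>\<^bsub>R\<^esub> q_i y) \<oplus>\<^bsub>R\<^esub> b \<otimes>\<^bsub>R\<^esub> (q_j x \<otimes>\<^bsub>R\<^esub> q_j y)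
         \<ominus>\<^bsub>R\<^esub> (a \<otimes>\<^bsub>R\<^esub> b) \<otimes>\<^bsub>R\<^esub> (q_k x \<otimes>\<^bsub>R\<^esub> q_k y))
      (q_re x \<otimes>\<^bsub>R\<^esub> q_i y \<oplus>\<^bsub>R\<^esub> q_i x \<otimes>\<^bsub>R\<^esub> q_re y \<oplus>\<^bsub>R\<^esub> b \<otimes>\<^bsub>R\<^esub> (q_k x \<otimes>\<^bsub>R\<^esub> q_j y)
         \<ominus>\<^bsub>R\<^esub> b \<otimes>\<^bsub>R\<^esub> (q_j x \<otimes>\<^bsub>R\<^esub> q_k y))
      (q_re x \<otimes>\<^bsub>R\<^esub> q_j y \<oplus>\<^bsub>R\<^esub> q_j x \<otimes>\<^bsub>R\<^esub> q_re y \<oplus>\<^bsub>R\<^esub> a \<otimes>\<^bsub>R\<^esub> (q_i x \<otimes>\<^bsub>R\<^esub> q_k y)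
         \<ominus>\<^bsub>R\<^esub> a \<otimes>\<^bsub>R\<^esub> (q_k x \<otimes>\<^bsub>R\<^esub> q_i y))
      (q_re x \<otimes>\<^bsub>R\<^esub> q_k y \<oplus>\<^bsub>R\<^esub> q_k x \<otimes>\<^bsub>R\<^esub> q_re y \<oplus>\<^bsub>R\<^esub> q_i x \<otimes>\<^bsub>R\<^esub> q_j y
         \<ominus>\<^bsub>R\<^esub> q_j x \<otimes>\<^bsub>R\<^esub> q_i y)"

definition quat_add :: "('a, 'm) ring_scheme \<Rightarrow> 'a quat \<Rightarrow> 'a quat \<Rightarrow> 'a quat" where
  "quat_add R x y =
    Quat (q_re x \<oplus>\<^bsub>R\<^esub> q_re y) (q_i x \<oplus>\<^bsub>R\<^esub> q_i y) (q_j x \<oplus>\<^bsub>R\<^esub> q_j y) (q_k x \<oplus>\<^bsub>R\<^esub> q_k y)"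

definition quat_scalar :: "('a, 'm) ring_scheme \<Rightarrow> 'a \<Rightarrow> 'a quat" where
  "quat_scalar R c = Quat c \<zero>\<^bsub>R\<^esub> \<zero>\<^bsub>R\<^esub> \<zero>\<^bsub>R\<^esub>"

definition quat_algebra :: "('a, 'm) ring_scheme \<Rightarrow> 'a \<Rightarrow> 'a \<Rightarrow> 'a quat ring" where
  "quat_algebra R a b =
    \<lparr>carrier = {x. set_quat x \<subseteq> carrier R},
     monoid.mult = quat_mult R a b,
     one = quat_scalar R \<one>\<^bsub>R\<^esub>,
     zero = quat_scalar R \<zero>\<^bsub>R\<^esub>,
     add = quat_add R\<rparr>"

definition is_division_algebra :: "('a, 'm) ring_scheme \<Rightarrow> bool" where
  "is_division_algebra A \<longleftrightarrow> ring A \<and> Units A = carrier A - {\<zero>\<^bsub>A\<^esub>}"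


section \<open>The field of p-adic numbers\<close>

definition padic_val :: "nat \<Rightarrow> rat \<Rightarrow> int" where
  "padic_val p x =
    int (multiplicity (int p) (fst (quotient_of x))) - int (multiplicity (int p) (snd (quotient_of x)))"

definition padic_abs :: "nat \<Rightarrow> rat \<Rightarrow> real" where
  "padic_abs p x = (if x = 0 then 0 else real p powi (- padic_val p x))"

definition padic_Cauchy :: "nat \<Rightarrow> (nat \<Rightarrow> rat) \<Rightarrow> bool" where
  "padic_Cauchy p f \<longleftrightarrow> (\<forall>e>0. \<exists>N. \<forall>m\<ge>N. \<forall>n\<ge>N. padic_abs p (f m - f n) < e)"

definition padic_Cauchy_ring :: "nat \<Rightarrow> (nat \<Rightarrow> rat) ring" where
  "padic_Cauchy_ring p =
    \<lparr>carrier = {f. padic_Cauchy p f},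
     monoid.mult = (\<lambda>f g n. f n * g n),
     one = (\<lambda>n. 1),
     zero = (\<lambda>n. 0),
     add = (\<lambda>f g n. f n + g n)\<rparr>"

definition padic_null :: "nat \<Rightarrow> (nat \<Rightarrow> rat) set" where
  "padic_null p = {f. (\<lambda>n. padic_abs p (f n)) \<longlonglongrightarrow> 0}"

text \<open>The completion of the rationals with respect to the p-adic absolute value.\<close>

definition padic_field :: "nat \<Rightarrow> (nat \<Rightarrow> rat) set ring" where
  "padic_field p = padic_Cauchy_ring p Quot padic_null p"

definition padic_of_rat :: "nat \<Rightarrow> rat \<Rightarrow> (nat \<Rightarrow> rat) set" where
  "padic_of_rat p x = padic_null p +>\<^bsub>padic_Cauchy_ring p\<^esub> (\<lambda>n. x)"


section \<open>Quaternion algebras over the rationals\<close>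

abbreviation rat_quat_algebra :: "rat \<Rightarrow> rat \<Rightarrow> rat quat ring" where
  "rat_quat_algebra a b \<equiv> quat_algebra (ring_of_type_algebra :: rat ring) a b"

text \<open>
  \<open>A\<close> is ramified at a place \<open>v\<close> if its base change to the completion at \<open>v\<close> is a division algebra;
  the base change of \<open>(a, b | \<rat>)\<close> is the algebra with the same symbol over the completion.
\<close>

datatype place = Finite_place nat | Infinite_place

definition places :: "place set" where
  "places = insert Infinite_place (Finite_place ` {p. prime p})"

fun ramified_at :: "rat \<Rightarrow> rat \<Rightarrow> place \<Rightarrow> bool" where
  "ramified_at a b (Finite_place p) \<longleftrightarrow>
     is_division_algebra (quat_algebra (padic_field p) (padic_of_rat p a) (padic_of_rat p b))"
| "ramified_at a b Infinite_place \<longleftrightarrow>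
     is_division_algebra
       (quat_algebra (ring_of_type_algebra :: real ring) (of_rat a) (of_rat b))"

definition ramified_places :: "rat \<Rightarrow> rat \<Rightarrow> place set" where
  "ramified_places a b = {v \<in> places. ramified_at a b v}"

definition quat_conj :: "rat quat \<Rightarrow> rat quat" where
  "quat_conj x = Quat (q_re x) (- q_i x) (- q_j x) (- q_k x)"

text \<open>The product of \<open>x\<close> and its conjugate is a scalar, so taking \<open>q_re\<close> loses nothing.\<close>

definition reduced_norm :: "rat \<Rightarrow> rat \<Rightarrow> rat quat \<Rightarrow> rat" where
  "reduced_norm a b x = q_re (x \<otimes>\<^bsub>rat_quat_algebra a b\<^esub> quat_conj x)"

lemma mult_quat_conj:
  "x \<otimes>\<^bsub>rat_quat_algebra a b\<^esub> quat_conj x = quat_scalar ring_of_type_algebra (reduced_norm a b x)"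
proof -
  interpret R: ring "ring_of_type_algebra :: rat ring"
    by (rule ring_from_type_algebra)
  have "\<ominus>\<^bsub>ring_of_type_algebra\<^esub> v = - v" for v :: rat
    by (rule R.minus_equality) (simp_all add: ring_of_type_algebra_def)
  then have "u \<ominus>\<^bsub>ring_of_type_algebra\<^esub> v = u - v" for u v :: rat
    by (simp add: a_minus_def) (simp add: ring_of_type_algebra_def)
  then show ?thesis
    unfolding reduced_norm_def quat_algebra_def
    by (simp add: quat_mult_def quat_conj_def quat_scalar_def)
       (simp add: ring_of_type_algebra_def algebra_simps)
qed

definition quat_poly_eval :: "rat \<Rightarrow> rat \<Rightarrow> rat poly \<Rightarrow> rat quat \<Rightarrow> rat quat" where
  "quat_poly_eval a b f x =
    (\<Oplus>\<^bsub>rat_quat_algebra a b\<^esub> n \<in> {..Polynomial.degree f}.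
       quat_scalar ring_of_type_algebra (Polynomial.coeff f n)
         \<otimes>\<^bsub>rat_quat_algebra a b\<^esub> x [^]\<^bsub>rat_quat_algebra a b\<^esub> n)"

definition is_minimal_poly :: "rat \<Rightarrow> rat \<Rightarrow> rat quat \<Rightarrow> rat poly \<Rightarrow> bool" where
  "is_minimal_poly a b x f \<longleftrightarrow>
    Polynomial.lead_coeff f = 1 \<and>
    quat_poly_eval a b f x = \<zero>\<^bsub>rat_quat_algebra a b\<^esub> \<and>
    (\<forall>g. g \<noteq> 0 \<and> quat_poly_eval a b g x = \<zero>\<^bsub>rat_quat_algebra a b\<^esub> \<longrightarrow>
         Polynomial.degree f \<le> Polynomial.degree g)"

definition is_integer :: "rat \<Rightarrow> rat \<Rightarrow> rat quat \<Rightarrow> bool" where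
  "is_integer a b x \<longleftrightarrow> (\<exists>f. is_minimal_poly a b x f \<and> (\<forall>n. Polynomial.coeff f n \<in> \<int>))"

definition outlier :: "rat \<Rightarrow> rat \<Rightarrow> nat \<Rightarrow> bool" where
  "outlier a b m \<longleftrightarrow>
    m > 0 \<and>
    \<not> (\<exists>x \<in> carrier (rat_quat_algebra a b). is_integer a b x \<and> reduced_norm a b x = of_nat m)"

definition C :: "nat \<Rightarrow> real" where
  "C r = (real r)\<^sup>2 / 16"

end

theory Submission
  imports Defs "HOL-Number_Theory.Number_Theory" "HOL-Analysis.Analysis"
begin

text \<open>
  An element \<open>t / 2 + y\<close> with \<open>y\<close> a pure quaternion has trace \<open>t\<close> and norm \<open>t\<^sup>2 / 4 - y\<^sup>2\<close>, so it is enough to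
  find an integer \<open>t\<close> such that \<open>D = t\<^sup>2 - 4 * m\<close> is nonzero and the square of a pure quaternion. As
  \<open>m > r\<^sup>2 / 16\<close>, every \<open>t\<close> with \<open>\<bar>t\<bar> \<le> (r - 1) / 2\<close> makes \<open>D\<close> negative; these \<open>t\<close> cover all residues modulo
  \<open>r\<close>, so one of them makes \<open>D\<close> a nonresidue.

  For such a \<open>D\<close> one may assume that the algebra is \<open>(A, B)\<close> with negative squarefree integers and \<open>r\<close> not
  dividing \<open>A\<close>. Choose a prime \<open>q\<close> for which \<open>c = - r * q\<close> is a square at \<open>2\<close> and at every odd prime dividing
  \<open>A * D\<close>; real characters suffice for this case of Dirichlet's theorem. Reciprocity makes \<open>A\<close> and \<open>D\<close> squares
  modulo \<open>q\<close>, and then Legendre's theorem on ternary forms gives \<open>(A, B) = (A, c) = (D, c)\<close>, which exhibits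
  \<open>D\<close> as a square in the algebra. The prime \<open>q\<close> replaces the Hasse principle for quaternary forms.
\<close>

section \<open>Quaternion algebras over commutative rings\<close>

text \<open>At \<open>r\<close> and at infinity the algebra stays a division algebra, so a pure
  quaternion cannot have a nonzero local square as its square there. The choice of \<open>t\<close>
  removes this obstruction by making \<open>D\<close> negative and a nonresidue; at the other primes
  the algebra splits and there is none. That local conditions suffice is a statement about the
  isotropy of a form in four variables, out of reach of a lattice argument like that for Legendre's
  theorem. The prime \<open>q\<close> cuts it into two ternary equations. Everything asked of
  \<open>q\<close> is a Legendre symbol or a class modulo 8, hence the value of a real character. So
  \<open>q\<close> need not lie in a prescribed residue class: it only has to agree with
  \<open>- 1 / r\<close> under all real characters, and nonvanishing of L-series at 1 is needed for
  these alone. The local theory stays small. Splitting at a prime is used only through zeros of the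
  norm form modulo its square or cube, and ramification at \<open>r\<close> only by contraposition,
  with Hensel lifting supplying the forbidden zero. Legendre's theorem needs no condition at 2, and
  its sign condition takes care of infinity.\<close>

lemma quat_algebra_simps:
  "carrier (quat_algebra R a b) = {x. set_quat x \<subseteq> carrier R}"
  "x \<otimes>\<^bsub>quat_algebra R a b\<^esub> y = quat_mult R a b x y"
  "x \<oplus>\<^bsub>quat_algebra R a b\<^esub> y = quat_add R x y"
  "\<one>\<^bsub>quat_algebra R a b\<^esub> = quat_scalar R \<one>\<^bsub>R\<^esub>"
  "\<zero>\<^bsub>quat_algebra R a b\<^esub> = quat_scalar R \<zero>\<^bsub>R\<^esub>"
  by (simp_all add: quat_algebra_def)

lemma Quat_in_carrier [simp]:
  "Quat x y z w \<in> carrier (quat_algebra R a b) \<longleftrightarrow>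
     x \<in> carrier R \<and> y \<in> carrier R \<and> z \<in> carrier R \<and> w \<in> carrier R"
  by (auto simp: quat_algebra_def)

lemma quat_cases_carrier:
  assumes "x \<in> carrier (quat_algebra R a b)"
  obtains x0 x1 x2 x3 where "x = Quat x0 x1 x2 x3" "x0 \<in> carrier R" "x1 \<in> carrier R"
    "x2 \<in> carrier R" "x3 \<in> carrier R"
  using assms by (cases x) (auto simp: quat_algebra_def)

context cring begin

lemma quat_mult_assoc:
  assumes "a \<in> carrier R" "b \<in> carrier R"
    "set_quat x \<subseteq> carrier R" "set_quat y \<subseteq> carrier R" "set_quat z \<subseteq> carrier R"
  shows "quat_mult R a b (quat_mult R a b x y) z = quat_mult R a b x (quat_mult R a b y z)"
  using assms
  by (cases x; cases y; cases z)
     (simp add: quat_mult_def a_minus_def l_distr r_distr l_minus r_minus minus_add a_ac m_ac)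

lemma quat_ring:
  assumes "a \<in> carrier R" "b \<in> carrier R"
  shows "ring (quat_algebra R a b)"
proof (intro ringI abelian_groupI monoidI)
  fix x assume "x \<in> carrier (quat_algebra R a b)"
  then obtain x0 x1 x2 x3 where x: "x = Quat x0 x1 x2 x3" "x0 \<in> carrier R" "x1 \<in> carrier R"
    "x2 \<in> carrier R" "x3 \<in> carrier R" by (rule quat_cases_carrier)
  show "\<exists>y\<in>carrier (quat_algebra R a b). y \<oplus>\<^bsub>quat_algebra R a b\<^esub> x = \<zero>\<^bsub>quat_algebra R a b\<^esub>"
    by (rule bexI[of _ "Quat (\<ominus> x0) (\<ominus> x1) (\<ominus> x2) (\<ominus> x3)"])
       (use x assms in \<open>simp_all add: quat_algebra_simps(2-) quat_add_def quat_scalar_def ring_simprules\<close>)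
qed (use assms in \<open>auto elim!: quat_cases_carrier simp: quat_algebra_simps(2-) quat_mult_assoc
      quat_add_def quat_scalar_def\<close>,
     (use assms in \<open>simp_all add: quat_mult_def ring_simprules minus_add\<close>)?)

end

context cring begin

lemma quat_conj_mult:
  assumes "a \<in> carrier R" "b \<in> carrier R" "x0 \<in> carrier R" "x1 \<in> carrier R" "x2 \<in> carrier R" "x3 \<in> carrier R"
  shows "Quat x0 x1 x2 x3 \<otimes>\<^bsub>quat_algebra R a b\<^esub> Quat x0 (\<ominus> x1) (\<ominus> x2) (\<ominus> x3) =
      quat_scalar R (x0 \<otimes> x0 \<ominus> a \<otimes> (x1 \<otimes> x1) \<ominus> b \<otimes> (x2 \<otimes> x2) \<oplus> a \<otimes> b \<otimes> (x3 \<otimes> x3))" (is ?thesis1)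
    and "Quat x0 (\<ominus> x1) (\<ominus> x2) (\<ominus> x3) \<otimes>\<^bsub>quat_algebra R a b\<^esub> Quat x0 x1 x2 x3 =
      quat_scalar R (x0 \<otimes> x0 \<ominus> a \<otimes> (x1 \<otimes> x1) \<ominus> b \<otimes> (x2 \<otimes> x2) \<oplus> a \<otimes> b \<otimes> (x3 \<otimes> x3))" (is ?thesis2)
proof -
  have c: "u \<oplus> (\<ominus> u \<oplus> v) = v" "\<ominus> u \<oplus> (u \<oplus> v) = v" "u \<oplus> \<ominus> u = \<zero>" "\<ominus> u \<oplus> u = \<zero>"
    if "u \<in> carrier R" "v \<in> carrier R" for u v
    using that by (simp_all add: r_neg r_neg1 r_neg2 l_neg)
  show ?thesis1 ?thesis2
    using assms
    by (simp_all add: quat_algebra_simps quat_scalar_def quat_mult_def a_minus_def l_distr r_distr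
      l_minus r_minus minus_add a_ac m_ac c)
qed

lemma quat_scalar_mult:
  assumes "a \<in> carrier R" "b \<in> carrier R" "c \<in> carrier R" "x0 \<in> carrier R" "x1 \<in> carrier R" "x2 \<in> carrier R" "x3 \<in> carrier R"
  shows "quat_scalar R c \<otimes>\<^bsub>quat_algebra R a b\<^esub> Quat x0 x1 x2 x3 = Quat (c \<otimes> x0) (c \<otimes> x1) (c \<otimes> x2) (c \<otimes> x3)"
    and "Quat x0 x1 x2 x3 \<otimes>\<^bsub>quat_algebra R a b\<^esub> quat_scalar R c = Quat (c \<otimes> x0) (c \<otimes> x1) (c \<otimes> x2) (c \<otimes> x3)"
  using assms by (simp_all add: quat_algebra_simps quat_scalar_def quat_mult_def a_minus_def a_ac m_ac)

text \<open>A solution gives the quaternion \<open>x + y i + z j\<close> norm 0, so it and its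
  conjugate multiply to 0 and one of them vanishes. Leaving out the \<open>ij\<close> coordinate is
  enough for the applications, over the reals and over the p-adic field.\<close>

lemma division_quat_anisotropic:
  assumes div: "is_division_algebra (quat_algebra R a b)"
    and ab: "a \<in> carrier R" "b \<in> carrier R"
    and xyz: "x \<in> carrier R" "y \<in> carrier R" "z \<in> carrier R"
    and eq: "x \<otimes> x = a \<otimes> (y \<otimes> y) \<oplus> b \<otimes> (z \<otimes> z)"
  shows "x = \<zero>" "y = \<zero>" "z = \<zero>"
proof -
  let ?A = "quat_algebra R a b"
  interpret A: ring ?A using div by (simp add: is_division_algebra_def)
  let ?u = "Quat x y z \<zero>" and ?v = "Quat x (\<ominus> y) (\<ominus> z) (\<ominus> \<zero>)"
  have car: "?u \<in> carrier ?A" "?v \<in> carrier ?A" using xyz by simp_all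
  have n0: "x \<otimes> x \<ominus> a \<otimes> (y \<otimes> y) \<ominus> b \<otimes> (z \<otimes> z) \<oplus> a \<otimes> b \<otimes> (\<zero> \<otimes> \<zero>) = \<zero>"
  proof -
    let ?e = "a \<otimes> (y \<otimes> y) \<oplus> b \<otimes> (z \<otimes> z)"
    have "x \<otimes> x \<ominus> a \<otimes> (y \<otimes> y) \<ominus> b \<otimes> (z \<otimes> z) \<oplus> a \<otimes> b \<otimes> (\<zero> \<otimes> \<zero>) = ?e \<oplus> \<ominus> ?e"
      using ab xyz by (simp add: eq a_minus_def a_ac minus_add)
    also have "\<dots> = \<zero>" using ab xyz by (simp add: r_neg)
    finally show ?thesis .
  qed
  have uv: "?u \<otimes>\<^bsub>?A\<^esub> ?v = \<zero>\<^bsub>?A\<^esub>"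
    by (simp only: quat_conj_mult(1)[OF ab xyz zero_closed] n0 quat_algebra_simps(5))
  have "?u = \<zero>\<^bsub>?A\<^esub> \<or> ?v = \<zero>\<^bsub>?A\<^esub>"
  proof (rule ccontr)
    assume "\<not> ?thesis"
    then have u: "?u \<in> Units ?A" and v: "?v \<noteq> \<zero>\<^bsub>?A\<^esub>" using div car by (auto simp: is_division_algebra_def)
    have "?v = inv\<^bsub>?A\<^esub> ?u \<otimes>\<^bsub>?A\<^esub> (?u \<otimes>\<^bsub>?A\<^esub> ?v)"
      using u car by (simp add: A.m_assoc[symmetric])
    also have "\<dots> = \<zero>\<^bsub>?A\<^esub>" using u uv by simp
    finally show False using v by simp
  qed
  then show "x = \<zero>" "y = \<zero>" "z = \<zero>"
    using xyz by (auto simp: quat_algebra_simps quat_scalar_def)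
qed

end

text \<open>A nonzero non-unit has norm 0, since otherwise its conjugate divided by the norm would
  be a two-sided inverse.\<close>

lemma (in field) not_division_quat_isotropic:
  assumes ab: "a \<in> carrier R" "b \<in> carrier R"
    and nd: "\<not> is_division_algebra (quat_algebra R a b)"
  obtains x0 x1 x2 x3 where "x0 \<in> carrier R" "x1 \<in> carrier R" "x2 \<in> carrier R" "x3 \<in> carrier R"
    "\<not> (x0 = \<zero> \<and> x1 = \<zero> \<and> x2 = \<zero> \<and> x3 = \<zero>)"
    "x0 \<otimes> x0 \<ominus> a \<otimes> (x1 \<otimes> x1) \<ominus> b \<otimes> (x2 \<otimes> x2) \<oplus> a \<otimes> b \<otimes> (x3 \<otimes> x3) = \<zero>"
proof -
  let ?A = "quat_algebra R a b"
  interpret A: ring ?A using ab by (rule quat_ring)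
  \<comment> \<open>\<open>Units\<close> could differ from the set of nonzero elements in two ways;
    once 0 is excluded from it, a nonzero non-unit must exist.\<close>
  have "\<zero>\<^bsub>?A\<^esub> \<notin> Units ?A"
  proof
    assume "\<zero>\<^bsub>?A\<^esub> \<in> Units ?A"
    then have "\<one>\<^bsub>?A\<^esub> = \<zero>\<^bsub>?A\<^esub>" using A.Units_closed A.Units_l_inv A.r_null A.Units_inv_closed by metis
    then show False by (simp add: quat_algebra_simps quat_scalar_def)
  qed
  moreover have "ring ?A" by (rule A.ring_axioms)
  ultimately obtain x where x: "x \<in> carrier ?A" "x \<noteq> \<zero>\<^bsub>?A\<^esub>" "x \<notin> Units ?A"
    using nd unfolding is_division_algebra_def by (auto simp: Units_def)
  obtain x0 x1 x2 x3 where xs: "x = Quat x0 x1 x2 x3" "x0 \<in> carrier R" "x1 \<in> carrier R"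
    "x2 \<in> carrier R" "x3 \<in> carrier R" using x(1) by (rule quat_cases_carrier)
  let ?c = "Quat x0 (\<ominus> x1) (\<ominus> x2) (\<ominus> x3)"
  define n where "n = x0 \<otimes> x0 \<ominus> a \<otimes> (x1 \<otimes> x1) \<ominus> b \<otimes> (x2 \<otimes> x2) \<oplus> a \<otimes> b \<otimes> (x3 \<otimes> x3)"
  have n: "n \<in> carrier R" using xs ab by (simp add: n_def)
  have xc: "x \<otimes>\<^bsub>?A\<^esub> ?c = quat_scalar R n" "?c \<otimes>\<^bsub>?A\<^esub> x = quat_scalar R n"
    using quat_conj_mult ab xs by (simp_all add: n_def)
  have "n = \<zero>"
  proof (rule ccontr)
    assume "n \<noteq> \<zero>"
    then have u: "n \<in> Units R" using n by (simp add: field_Units)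
    define v where "v = quat_scalar R (inv n)"
    have v: "v \<in> carrier ?A" and c: "?c \<in> carrier ?A" using u xs by (simp_all add: v_def quat_scalar_def)
    have vn: "quat_scalar R n \<otimes>\<^bsub>?A\<^esub> v = \<one>\<^bsub>?A\<^esub>" "v \<otimes>\<^bsub>?A\<^esub> quat_scalar R n = \<one>\<^bsub>?A\<^esub>"
      using u n ab quat_scalar_mult[of a b n "inv n" \<zero> \<zero> \<zero>] quat_scalar_mult[of a b "inv n" n \<zero> \<zero> \<zero>]
      by (simp_all add: v_def quat_scalar_def quat_algebra_simps)
    have "x \<otimes>\<^bsub>?A\<^esub> (?c \<otimes>\<^bsub>?A\<^esub> v) = \<one>\<^bsub>?A\<^esub>" using x c v xc vn by (simp add: A.m_assoc[symmetric])
    moreover have "(v \<otimes>\<^bsub>?A\<^esub> ?c) \<otimes>\<^bsub>?A\<^esub> x = \<one>\<^bsub>?A\<^esub>" using x c v xc vn by (simp add: A.m_assoc)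
    ultimately have "x \<in> Units ?A"
      using x c v A.inv_unique[of "v \<otimes>\<^bsub>?A\<^esub> ?c" x "?c \<otimes>\<^bsub>?A\<^esub> v"] unfolding Units_def by auto
    then show False using x by simp
  qed
  then show thesis using that xs x(2) by (auto simp: n_def quat_algebra_simps quat_scalar_def)
qed

section \<open>The field of p-adic numbers\<close>

lemma rat_int_fraction:
  fixes x :: rat
  obtains a b :: int where "x = of_int a / of_int b" "b > 0"
  using quotient_of_div[of x] quotient_of_denom_pos[of x] by (metis surj_pair)

section \<open>The p-adic absolute value on the rationals\<close>

context
  fixes p :: nat
  assumes p: "prime p"
begin

text \<open>\<open>padic_val\<close> reads the reduced fraction; by cross multiplication every other
  fraction for the same number gives the same difference, so nothing has to be reduced
  afterwards.\<close>

lemma padic_val_divide: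
  fixes a b :: int
  assumes "a \<noteq> 0" "b \<noteq> 0"
  shows "padic_val p (of_int a / of_int b) = int (multiplicity (int p) a) - int (multiplicity (int p) b)"
proof -
  obtain c d where cd: "quotient_of (of_int a / of_int b) = (c, d)" by force
  have d: "d > 0" using quotient_of_denom_pos[OF cd] .
  have eq: "(of_int a / of_int b :: rat) = of_int c / of_int d" using quotient_of_div[OF cd] .
  then have "c \<noteq> 0" using assms by auto
  have "(of_int (a * d) :: rat) = of_int (c * b)" using eq assms d by (simp add: field_simps)
  then have "a * d = c * b" by (simp only: of_int_eq_iff)
  then have "multiplicity (int p) (a * d) = multiplicity (int p) (c * b)" by simp
  moreover have "prime_elem (int p)" using p by simp
  ultimately have "multiplicity (int p) a + multiplicity (int p) d = multiplicity (int p) c + multiplicity (int p) b"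
    using assms d \<open>c \<noteq> 0\<close> by (simp add: prime_elem_multiplicity_mult_distrib)
  then show ?thesis by (simp add: padic_val_def cd)
qed

lemma padic_val_mult:
  assumes "x \<noteq> 0" "y \<noteq> 0"
  shows "padic_val p (x * y) = padic_val p x + padic_val p y"
proof -
  obtain a b where x: "x = of_int a / of_int b" "b > 0" by (rule rat_int_fraction)
  obtain c d where y: "y = of_int c / of_int d" "d > 0" by (rule rat_int_fraction)
  have nz: "a \<noteq> 0" "c \<noteq> 0" using assms x y by auto
  have "x * y = of_int (a * c) / of_int (b * d)" using x y by simp
  moreover have "prime_elem (int p)" using p by simp
  ultimately show ?thesis using x y nz padic_val_divide[of "a * c" "b * d"]
      padic_val_divide[of a b] padic_val_divide[of c d]
    by (simp add: prime_elem_multiplicity_mult_distrib)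
qed

lemma padic_abs_zero_iff [simp]: "padic_abs p x = 0 \<longleftrightarrow> x = 0"
  using prime_gt_0_nat[OF p] by (auto simp: padic_abs_def)

lemma padic_abs_nonneg [simp]: "padic_abs p x \<ge> 0"
  by (auto simp: padic_abs_def)

lemma padic_abs_mult: "padic_abs p (x * y) = padic_abs p x * padic_abs p y"
  using prime_gt_0_nat[OF p] power_int_add[of "real p" "- padic_val p x" "- padic_val p y"]
  by (auto simp: padic_abs_def padic_val_mult)

lemma padic_abs_one [simp]: "padic_abs p 1 = 1"
  by (simp add: padic_abs_def padic_val_def)

lemma padic_abs_minus [simp]: "padic_abs p (- x) = padic_abs p x"
proof -
  have "padic_abs p (-1) = 1" by (simp add: padic_abs_def padic_val_def)
  then show ?thesis using padic_abs_mult[of "-1" x] by simp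
qed

lemma padic_abs_diff_commute: "padic_abs p (x - y) = padic_abs p (y - x)"
  using padic_abs_minus[of "x - y"] by simp

lemma padic_abs_inverse: "padic_abs p (inverse x) = inverse (padic_abs p x)"
proof (cases "x = 0")
  case False
  then have "padic_abs p (inverse x) * padic_abs p x = 1" by (simp add: padic_abs_mult[symmetric])
  then show ?thesis by (metis inverse_unique mult.commute)
qed (simp add: padic_abs_def)

text \<open>The bridge between analysis and congruences: null sequences yield divisibility by powers
  of \<open>p\<close>, and Hensel lifting yields Cauchy sequences.\<close>

lemma padic_abs_of_int_le_iff:
  "padic_abs p (of_int n) \<le> 1 / real p ^ k \<longleftrightarrow> int p ^ k dvd n"
proof (cases "n = 0")
  case False
  have p1: "real p > 1" using prime_gt_1_nat[OF p] by simp
  have "padic_val p (of_int n) = int (multiplicity (int p) n)"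
    using padic_val_divide[of n 1] False by simp
  then have "padic_abs p (of_int n) = real p powi (- int (multiplicity (int p) n))"
    using False by (simp add: padic_abs_def)
  moreover have "1 / real p ^ k = real p powi (- int k)" by (simp add: power_int_minus divide_inverse)
  ultimately have "padic_abs p (of_int n) \<le> 1 / real p ^ k \<longleftrightarrow>
      - int (multiplicity (int p) n) \<le> - int k"
    using power_int_strict_increasing[of "- int k" "- int (multiplicity (int p) n)" "real p"]
      power_int_increasing[of "- int (multiplicity (int p) n)" "- int k" "real p"] p1
    by (metis linorder_not_le order_less_imp_le)
  also have "\<dots> \<longleftrightarrow> int p ^ k dvd n"
    using False p by (subst power_dvd_iff_le_multiplicity) auto
  finally show ?thesis .
qed (simp add: padic_abs_def)

lemma padic_abs_of_int_le_1 [simp]: "padic_abs p (of_int n) \<le> 1"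
  using padic_abs_of_int_le_iff[of n 0] by simp

text \<open>Dividing by the larger summand reduces the claim to \<open>1 + z\<close> with
  \<open>z = a / b\<close> of absolute value at most 1; the power of \<open>p\<close> in
  \<open>b\<close> then divides \<open>a\<close>, hence \<open>a + b\<close>.\<close>

lemma padic_abs_add: "padic_abs p (x + y) \<le> max (padic_abs p x) (padic_abs p y)"
proof -
  have le1: "padic_abs p (1 + z) \<le> 1" if "padic_abs p z \<le> 1" for z
  proof (cases "z = 0")
    case False
    obtain a b where z: "z = of_int a / of_int b" "b > 0" by (rule rat_int_fraction)
    then have a: "a \<noteq> 0" using False by auto
    have p1: "real p > 1" using prime_gt_1_nat[OF p] by simp
    have ab: "multiplicity (int p) b \<le> multiplicity (int p) a"
    proof (rule ccontr)
      assume "\<not> ?thesis"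
      then have "- padic_val p z > 0" using padic_val_divide[of a b] z a by simp
      then have "real p powi (- padic_val p z) > 1"
        using power_int_strict_increasing[of 0 "- padic_val p z" "real p"] p1 by simp
      then show False using that False by (simp add: padic_abs_def)
    qed
    define k where "k = multiplicity (int p) b"
    have "int p ^ k dvd a" "int p ^ k dvd b" using ab by (auto simp: k_def multiplicity_dvd multiplicity_dvd')
    then have dvd: "int p ^ k dvd a + b" by simp
    have "1 + z = of_int (a + b) * inverse (of_int b)" using z by (simp add: field_simps)
    then have "padic_abs p (1 + z) = padic_abs p (of_int (a + b)) * inverse (padic_abs p (of_int b))"
      by (simp only: padic_abs_mult padic_abs_inverse)
    moreover have "padic_abs p (of_int (a + b)) \<le> 1 / real p ^ k"
      using dvd by (simp only: padic_abs_of_int_le_iff)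
    moreover have "padic_abs p (of_int b) = 1 / real p ^ k"
      using z padic_val_divide[of b 1] by (simp add: padic_abs_def k_def power_int_minus divide_inverse)
    ultimately show ?thesis using p1 by (simp add: field_simps)
  qed simp
  have main: "padic_abs p (x + y) \<le> padic_abs p x" if "padic_abs p y \<le> padic_abs p x" for x y
  proof (cases "x = 0")
    case False
    have "padic_abs p (y * inverse x) \<le> 1"
    proof -
      have "padic_abs p x > 0" using False padic_abs_nonneg[of x] padic_abs_zero_iff[of x] by linarith
      then show ?thesis unfolding padic_abs_mult padic_abs_inverse using that by (simp add: field_simps)
    qed
    then have "padic_abs p (1 + y * inverse x) \<le> 1" by (rule le1)
    then have "padic_abs p x * padic_abs p (1 + y * inverse x) \<le> padic_abs p x * 1"
      by (intro mult_left_mono) auto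
    then show ?thesis using False by (simp add: padic_abs_mult[symmetric] field_simps)
  next
    case True
    then have "padic_abs p y \<le> 0" using that by (simp add: padic_abs_def)
    then have "y = 0" using padic_abs_nonneg[of y] padic_abs_zero_iff[of y] by linarith
    then show ?thesis using True by simp
  qed
  show ?thesis using main[of y x] main[of x y] by (cases "padic_abs p y \<le> padic_abs p x") (auto simp: add.commute)
qed

lemma padic_abs_add_le:
  "padic_abs p x \<le> e \<Longrightarrow> padic_abs p y \<le> e \<Longrightarrow> padic_abs p (x + y) \<le> e"
  "padic_abs p x < e \<Longrightarrow> padic_abs p y < e \<Longrightarrow> padic_abs p (x + y) < e"
  using padic_abs_add[of x y] by linarith+

end

text \<open>
  Isotropy over the p-adic field of the norm form \<open>\<langle>1, - a, - b, a * b\<rangle>\<close> and of the form \<open>\<langle>1, - a, - b\<rangle>\<close>,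
  spelled out for Cauchy sequences.
\<close>

definition quat_isotropic :: "nat \<Rightarrow> rat \<Rightarrow> rat \<Rightarrow> bool" where
  "quat_isotropic p a b \<longleftrightarrow> (\<exists>f0 f1 f2 f3.
    padic_Cauchy p f0 \<and> padic_Cauchy p f1 \<and> padic_Cauchy p f2 \<and> padic_Cauchy p f3 \<and>
    \<not> (f0 \<in> padic_null p \<and> f1 \<in> padic_null p \<and> f2 \<in> padic_null p \<and> f3 \<in> padic_null p) \<and>
    (\<lambda>n. f0 n * f0 n - a * (f1 n * f1 n) - b * (f2 n * f2 n) + a * b * (f3 n * f3 n)) \<in> padic_null p)"

definition conic_isotropic :: "nat \<Rightarrow> rat \<Rightarrow> rat \<Rightarrow> bool" where
  "conic_isotropic p a b \<longleftrightarrow> (\<exists>f g h. padic_Cauchy p f \<and> padic_Cauchy p g \<and> padic_Cauchy p h \<and>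
    \<not> (f \<in> padic_null p \<and> g \<in> padic_null p \<and> h \<in> padic_null p) \<and>
    (\<lambda>n. f n * f n - a * (g n * g n) - b * (h n * h n)) \<in> padic_null p)"

context
  fixes p :: nat
  assumes p: "prime p"
begin

section \<open>Cauchy sequences and null sequences of rationals\<close>

lemma padic_null_iff: "f \<in> padic_null p \<longleftrightarrow> (\<forall>e>0. \<exists>N. \<forall>n\<ge>N. padic_abs p (f n) < e)"
  using p by (simp add: padic_null_def LIMSEQ_iff)

lemma padic_Cauchy_const [simp]: "padic_Cauchy p (\<lambda>n. c)"
  by (auto simp: padic_Cauchy_def padic_abs_def)

lemma padic_Cauchy_minus: "padic_Cauchy p f \<Longrightarrow> padic_Cauchy p (\<lambda>n. - f n)"
  unfolding padic_Cauchy_def using padic_abs_diff_commute[OF p] by simp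

lemma padic_Cauchy_add:
  assumes "padic_Cauchy p f" "padic_Cauchy p g"
  shows "padic_Cauchy p (\<lambda>n. f n + g n)"
  unfolding padic_Cauchy_def
proof (intro allI impI)
  fix e :: real assume "e > 0"
  then obtain M N where M: "\<forall>m\<ge>M. \<forall>n\<ge>M. padic_abs p (f m - f n) < e"
    and N: "\<forall>m\<ge>N. \<forall>n\<ge>N. padic_abs p (g m - g n) < e"
    using assms unfolding padic_Cauchy_def by meson
  show "\<exists>N. \<forall>m\<ge>N. \<forall>n\<ge>N. padic_abs p (f m + g m - (f n + g n)) < e"
  proof (intro exI[of _ "max M N"] allI impI)
    fix m n assume "m \<ge> max M N" "n \<ge> max M N"
    then have "padic_abs p ((f m - f n) + (g m - g n)) < e" using M N by (intro padic_abs_add_le p) auto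
    then show "padic_abs p (f m + g m - (f n + g n)) < e" by (simp add: algebra_simps)
  qed
qed

lemma padic_Cauchy_bounded:
  assumes "padic_Cauchy p f"
  obtains B where "B > 0" "\<And>n. padic_abs p (f n) \<le> B"
proof -
  obtain N where N: "\<forall>m\<ge>N. \<forall>n\<ge>N. padic_abs p (f m - f n) < 1"
    using assms unfolding padic_Cauchy_def by (meson zero_less_one)
  define B where "B = Max (insert 1 ((\<lambda>n. padic_abs p (f n)) ` {..N}))"
  have B: "padic_abs p (f n) \<le> B" if "n \<le> N" for n unfolding B_def by (rule Max_ge) (use that in auto)
  have B1: "1 \<le> B" by (simp add: B_def)
  have "padic_abs p (f n) \<le> B" for n
  proof (cases "n \<le> N")
    case False
    then have "padic_abs p (f n - f N) \<le> B" using N B1 by (meson less_imp_le nat_le_linear order.trans order_refl)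
    then have "padic_abs p ((f n - f N) + f N) \<le> B" using B by (intro padic_abs_add_le p) auto
    then show ?thesis by simp
  qed (rule B)
  then show thesis using that[of B] B1 by simp
qed

lemma padic_null_mult:
  assumes "f \<in> padic_null p" "padic_Cauchy p g"
  shows "(\<lambda>n. f n * g n) \<in> padic_null p"
  unfolding padic_null_iff
proof (intro allI impI)
  fix e :: real assume e: "e > 0"
  obtain B where B: "B > 0" "\<And>n. padic_abs p (g n) \<le> B" using padic_Cauchy_bounded[OF assms(2)] by blast
  have "e / B > 0" using e B by simp
  then obtain N where N: "\<forall>n\<ge>N. padic_abs p (f n) < e / B" using assms(1) unfolding padic_null_iff by blast
  show "\<exists>N. \<forall>n\<ge>N. padic_abs p (f n * g n) < e"
  proof (intro exI[of _ N] allI impI)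
    fix n assume "n \<ge> N"
    then have "padic_abs p (f n) < e / B" using N by simp
    then have "padic_abs p (f n) * B < e" using B by (simp add: field_simps)
    moreover have "padic_abs p (f n) * padic_abs p (g n) \<le> padic_abs p (f n) * B"
      using B p by (intro mult_left_mono) auto
    ultimately show "padic_abs p (f n * g n) < e" using p by (simp add: padic_abs_mult)
  qed
qed

lemma padic_null_add:
  assumes "f \<in> padic_null p" "g \<in> padic_null p"
  shows "(\<lambda>n. f n + g n) \<in> padic_null p"
  unfolding padic_null_iff
proof (intro allI impI)
  fix e :: real assume "e > 0"
  then obtain M N where "\<forall>n\<ge>M. padic_abs p (f n) < e" "\<forall>n\<ge>N. padic_abs p (g n) < e"
    using assms unfolding padic_null_iff by meson
  then show "\<exists>N. \<forall>n\<ge>N. padic_abs p (f n + g n) < e"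
    by (intro exI[of _ "max M N"]) (auto intro: padic_abs_add_le[OF p])
qed

lemma padic_null_minus: "f \<in> padic_null p \<Longrightarrow> (\<lambda>n. - f n) \<in> padic_null p"
  using p by (simp add: padic_null_iff)

lemma padic_null_const_iff: "(\<lambda>n. c) \<in> padic_null p \<longleftrightarrow> c = 0"
proof
  assume "(\<lambda>n. c) \<in> padic_null p"
  then have "e > 0 \<Longrightarrow> padic_abs p c < e" for e unfolding padic_null_iff by blast
  then have "\<not> padic_abs p c > 0" by blast
  then show "c = 0" using padic_abs_nonneg[OF p, of c] padic_abs_zero_iff[OF p, of c] by linarith
qed (auto simp: padic_null_iff padic_abs_def)

lemma padic_null_imp_Cauchy:
  assumes "f \<in> padic_null p"
  shows "padic_Cauchy p f"
  unfolding padic_Cauchy_def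
proof (intro allI impI)
  fix e :: real assume "e > 0"
  then obtain N where N: "\<forall>n\<ge>N. padic_abs p (f n) < e" using assms unfolding padic_null_iff by blast
  have "padic_abs p (f m + - f n) < e" if "m \<ge> N" "n \<ge> N" for m n
    using N that p by (intro padic_abs_add_le) auto
  then show "\<exists>N. \<forall>m\<ge>N. \<forall>n\<ge>N. padic_abs p (f m - f n) < e" by auto
qed

lemma padic_Cauchy_mult:
  assumes "padic_Cauchy p f" "padic_Cauchy p g"
  shows "padic_Cauchy p (\<lambda>n. f n * g n)"
  unfolding padic_Cauchy_def
proof (intro allI impI)
  fix e :: real assume e: "e > 0"
  obtain B where B: "B > 0" "\<And>n. padic_abs p (f n) \<le> B" using padic_Cauchy_bounded[OF assms(1)] by blast
  obtain B' where B': "B' > 0" "\<And>n. padic_abs p (g n) \<le> B'" using padic_Cauchy_bounded[OF assms(2)] by blast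
  have "e / B' > 0" "e / B > 0" using e B B' by simp_all
  then obtain M N where M: "\<forall>m\<ge>M. \<forall>n\<ge>M. padic_abs p (f m - f n) < e / B'"
    and N: "\<forall>m\<ge>N. \<forall>n\<ge>N. padic_abs p (g m - g n) < e / B"
    using assms unfolding padic_Cauchy_def by meson
  show "\<exists>N. \<forall>m\<ge>N. \<forall>n\<ge>N. padic_abs p (f m * g m - f n * g n) < e"
  proof (intro exI[of _ "max M N"] allI impI)
    fix m n assume mn: "m \<ge> max M N" "n \<ge> max M N"
    have "padic_abs p (g m) * padic_abs p (f m - f n) \<le> B' * padic_abs p (f m - f n)"
      using B' p by (intro mult_right_mono) auto
    also have "\<dots> < e" using M mn B' by (simp add: field_simps)
    finally have 1: "padic_abs p (g m * (f m - f n)) < e" using p by (simp add: padic_abs_mult)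
    have "padic_abs p (f n) * padic_abs p (g m - g n) \<le> B * padic_abs p (g m - g n)"
      using B p by (intro mult_right_mono) auto
    also have "\<dots> < e" using N mn B by (simp add: field_simps)
    finally have 2: "padic_abs p (f n * (g m - g n)) < e" using p by (simp add: padic_abs_mult)
    have "f m * g m - f n * g n = g m * (f m - f n) + f n * (g m - g n)" by (simp add: algebra_simps)
    then show "padic_abs p (f m * g m - f n * g n) < e" using padic_abs_add_le(2)[OF p 1 2] by simp
  qed
qed

text \<open>Terms of size at least \<open>e\<close> occur arbitrarily late. Once differences are
  below \<open>e\<close>, the ultrametric inequality passes this size on to all later terms.\<close>

lemma padic_Cauchy_not_null:
  assumes "padic_Cauchy p f" "f \<notin> padic_null p"
  obtains e N where "e > 0" "\<And>n. n \<ge> N \<Longrightarrow> padic_abs p (f n) \<ge> e"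
proof -
  obtain e where e: "e > 0" "\<And>N. \<exists>n\<ge>N. padic_abs p (f n) \<ge> e"
    using assms(2) unfolding padic_null_iff by (meson linorder_not_less)
  obtain N where N: "\<forall>m\<ge>N. \<forall>n\<ge>N. padic_abs p (f m - f n) < e"
    using assms(1) e unfolding padic_Cauchy_def by meson
  obtain k where k: "k \<ge> N" "padic_abs p (f k) \<ge> e" using e by blast
  have "padic_abs p (f n) \<ge> e" if "n \<ge> N" for n
  proof (rule ccontr)
    assume "\<not> ?thesis"
    moreover have "padic_abs p (f k - f n) < e" using N k that by auto
    ultimately have "padic_abs p ((f k - f n) + f n) < e" by (intro padic_abs_add_le p) auto
    then show False using k by simp
  qed
  then show thesis using that e by blast
qed

text \<open>\<open>f\<close> may vanish at finitely many places, where \<open>inverse\<close>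
  returns 0; both claims only look at the tail on which \<open>f\<close> stays away from 0.\<close>

lemma padic_Cauchy_inverse:
  assumes "padic_Cauchy p f" "f \<notin> padic_null p"
  shows "padic_Cauchy p (\<lambda>n. inverse (f n))" "(\<lambda>n. f n * inverse (f n) - 1) \<in> padic_null p"
proof -
  obtain d M where d: "d > 0" "\<And>n. n \<ge> M \<Longrightarrow> padic_abs p (f n) \<ge> d"
    using padic_Cauchy_not_null[OF assms] by blast
  have nz: "f n \<noteq> 0" if "n \<ge> M" for n using d(2)[OF that] d(1) by (auto simp: padic_abs_def)
  show "padic_Cauchy p (\<lambda>n. inverse (f n))"
    unfolding padic_Cauchy_def
  proof (intro allI impI)
    fix e :: real assume e: "e > 0"
    then have "e * d\<^sup>2 > 0" using d by simp
    then obtain N where N: "\<forall>m\<ge>N. \<forall>n\<ge>N. padic_abs p (f m - f n) < e * d\<^sup>2"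
      using assms(1) unfolding padic_Cauchy_def by meson
    show "\<exists>N. \<forall>m\<ge>N. \<forall>n\<ge>N. padic_abs p (inverse (f m) - inverse (f n)) < e"
    proof (intro exI[of _ "max M N"] allI impI)
      fix m n assume mn: "m \<ge> max M N" "n \<ge> max M N"
      define c where "c = padic_abs p (inverse (f m) - inverse (f n))"
      have "(inverse (f m) - inverse (f n)) * (f m * f n) = f n - f m"
        using nz mn by (simp add: field_simps)
      then have "c * (padic_abs p (f m) * padic_abs p (f n)) = padic_abs p (f n - f m)"
        using p by (simp add: c_def padic_abs_mult[symmetric])
      also have "\<dots> < e * d\<^sup>2" using N mn by simp
      finally have lt: "c * (padic_abs p (f m) * padic_abs p (f n)) < e * d\<^sup>2" .
      have "d\<^sup>2 \<le> padic_abs p (f m) * padic_abs p (f n)"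
        unfolding power2_eq_square using d mn p by (intro mult_mono) auto
      then have "c * d\<^sup>2 \<le> c * (padic_abs p (f m) * padic_abs p (f n))"
        using p by (intro mult_left_mono) (auto simp: c_def)
      then have "c * d\<^sup>2 < e * d\<^sup>2" using lt by linarith
      then have "c < e" using d by simp
      then show "padic_abs p (inverse (f m) - inverse (f n)) < e" by (simp add: c_def)
    qed
  qed
  show "(\<lambda>n. f n * inverse (f n) - 1) \<in> padic_null p"
    unfolding padic_null_iff
    by (intro allI impI exI[of _ M]) (simp add: nz padic_abs_def)
qed

section \<open>The quotient of Cauchy sequences by null sequences is a field\<close>

lemma padic_Cauchy_ring_simps:
  "carrier (padic_Cauchy_ring p) = {f. padic_Cauchy p f}"
  "f \<otimes>\<^bsub>padic_Cauchy_ring p\<^esub> g = (\<lambda>n. f n * g n)"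
  "f \<oplus>\<^bsub>padic_Cauchy_ring p\<^esub> g = (\<lambda>n. f n + g n)"
  "\<one>\<^bsub>padic_Cauchy_ring p\<^esub> = (\<lambda>n. 1)"
  "\<zero>\<^bsub>padic_Cauchy_ring p\<^esub> = (\<lambda>n. 0)"
  by (simp_all add: padic_Cauchy_ring_def)

lemma padic_Cauchy_ring_cring: "cring (padic_Cauchy_ring p)"
proof (intro cringI abelian_groupI comm_monoidI)
  fix f assume "f \<in> carrier (padic_Cauchy_ring p)"
  then show "\<exists>g\<in>carrier (padic_Cauchy_ring p). g \<oplus>\<^bsub>padic_Cauchy_ring p\<^esub> f = \<zero>\<^bsub>padic_Cauchy_ring p\<^esub>"
    by (intro bexI[of _ "\<lambda>n. - f n"]) (auto simp: padic_Cauchy_ring_simps padic_Cauchy_minus)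
qed (auto simp: padic_Cauchy_ring_simps padic_Cauchy_add padic_Cauchy_mult algebra_simps)

lemma padic_Cauchy_ring_uminus:
  assumes "padic_Cauchy p f"
  shows "\<ominus>\<^bsub>padic_Cauchy_ring p\<^esub> f = (\<lambda>n. - f n)"
proof -
  interpret cring "padic_Cauchy_ring p" by (rule padic_Cauchy_ring_cring)
  show ?thesis
    by (rule minus_equality) (auto simp: padic_Cauchy_ring_simps padic_Cauchy_minus assms)
qed

lemma padic_null_ideal: "ideal (padic_null p) (padic_Cauchy_ring p)"
proof -
  interpret C: cring "padic_Cauchy_ring p" by (rule padic_Cauchy_ring_cring)
  have inv: "inv\<^bsub>add_monoid (padic_Cauchy_ring p)\<^esub> f = (\<lambda>n. - f n)" if "padic_Cauchy p f" for f
    using padic_Cauchy_ring_uminus[OF that] by (simp add: a_inv_def)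
  show ?thesis
  proof (rule idealI)
    show "subgroup (padic_null p) (add_monoid (padic_Cauchy_ring p))"
    proof (rule subgroup.intro)
      fix f assume f: "f \<in> padic_null p"
      show "inv\<^bsub>add_monoid (padic_Cauchy_ring p)\<^esub> f \<in> padic_null p"
        by (simp only: inv[OF padic_null_imp_Cauchy[OF f]] padic_null_minus[OF f])
    qed (auto simp: padic_Cauchy_ring_simps padic_null_imp_Cauchy padic_null_add padic_null_const_iff)
  next
    fix f g assume fg: "f \<in> padic_null p" "g \<in> carrier (padic_Cauchy_ring p)"
    then show "f \<otimes>\<^bsub>padic_Cauchy_ring p\<^esub> g \<in> padic_null p"
      by (simp add: padic_Cauchy_ring_simps padic_null_mult)
    then show "g \<otimes>\<^bsub>padic_Cauchy_ring p\<^esub> f \<in> padic_null p"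
      by (simp add: padic_Cauchy_ring_simps mult.commute)
  qed (rule C.ring_axioms)
qed

definition padic_of_seq :: "(nat \<Rightarrow> rat) \<Rightarrow> (nat \<Rightarrow> rat) set" where
  "padic_of_seq = (+>\<^bsub>padic_Cauchy_ring p\<^esub>) (padic_null p)"

lemma padic_field_cring: "cring (padic_field p)"
  unfolding padic_field_def
  by (intro ideal.quotient_is_cring padic_null_ideal padic_Cauchy_ring_cring)

lemma padic_of_seq_hom: "ring_hom_cring (padic_Cauchy_ring p) (padic_field p) padic_of_seq"
  unfolding padic_of_seq_def padic_field_def
  by (intro ideal.rcos_ring_hom_cring padic_null_ideal padic_Cauchy_ring_cring)

lemma carrier_padic_field: "carrier (padic_field p) = padic_of_seq ` {f. padic_Cauchy p f}"
  by (auto simp: padic_field_def FactRing_def A_RCOSETS_def' padic_of_seq_def padic_Cauchy_ring_simps)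

lemma zero_padic_field: "\<zero>\<^bsub>padic_field p\<^esub> = padic_null p"
  by (simp add: padic_field_def FactRing_def)

lemma padic_of_seq_eq_zero_iff:
  assumes "padic_Cauchy p f"
  shows "padic_of_seq f = \<zero>\<^bsub>padic_field p\<^esub> \<longleftrightarrow> f \<in> padic_null p"
proof -
  interpret ideal "padic_null p" "padic_Cauchy_ring p" by (rule padic_null_ideal)
  show ?thesis
    using rcos_const_imp_mem[of f] a_rcos_const[of f] assms
    by (auto simp: zero_padic_field padic_of_seq_def padic_Cauchy_ring_simps)
qed

lemma padic_field_field: "field (padic_field p)"
proof -
  interpret F: cring "padic_field p" by (rule padic_field_cring)
  interpret C: cring "padic_Cauchy_ring p" by (rule padic_Cauchy_ring_cring)
  interpret h: ring_hom_cring "padic_Cauchy_ring p" "padic_field p" padic_of_seq by (rule padic_of_seq_hom)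
  show ?thesis
  proof (rule F.cring_fieldI2)
    have "padic_of_seq (\<lambda>n. 1) \<noteq> \<zero>\<^bsub>padic_field p\<^esub>"
      by (subst padic_of_seq_eq_zero_iff) (auto simp: padic_null_const_iff)
    then show "\<zero>\<^bsub>padic_field p\<^esub> \<noteq> \<one>\<^bsub>padic_field p\<^esub>"
      unfolding h.hom_one[symmetric] padic_Cauchy_ring_simps(4) by (rule not_sym)
  next
    fix x assume x: "x \<in> carrier (padic_field p)" "x \<noteq> \<zero>\<^bsub>padic_field p\<^esub>"
    then obtain f where f: "padic_Cauchy p f" "x = padic_of_seq f" by (auto simp: carrier_padic_field)
    then have nn: "f \<notin> padic_null p" using x padic_of_seq_eq_zero_iff by blast
    define g where "g = (\<lambda>n. inverse (f n))"
    have g: "padic_Cauchy p g" and fg: "(\<lambda>n. f n * g n - 1) \<in> padic_null p"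
      using padic_Cauchy_inverse[OF f(1) nn] by (simp_all add: g_def)
    have fg': "padic_Cauchy p (\<lambda>n. f n * g n)" using f g by (intro padic_Cauchy_mult)
    have k: "(\<lambda>n. f n * g n - 1) \<in> carrier (padic_Cauchy_ring p)"
      using fg padic_null_imp_Cauchy by (simp add: padic_Cauchy_ring_simps(1))
    have "padic_of_seq (\<lambda>n. f n * g n - 1) = \<zero>\<^bsub>padic_field p\<^esub>"
      using fg padic_null_imp_Cauchy padic_of_seq_eq_zero_iff by blast
    moreover have "(\<lambda>n. f n * g n) = (\<lambda>n. f n * g n - 1) \<oplus>\<^bsub>padic_Cauchy_ring p\<^esub> \<one>\<^bsub>padic_Cauchy_ring p\<^esub>"
      by (simp add: padic_Cauchy_ring_simps)
    ultimately have "padic_of_seq (\<lambda>n. f n * g n) = \<one>\<^bsub>padic_field p\<^esub>"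
      using h.hom_add[OF k C.one_closed] by simp
    moreover have "padic_of_seq (\<lambda>n. f n * g n) = x \<otimes>\<^bsub>padic_field p\<^esub> padic_of_seq g"
      using f g h.hom_mult[of f g] by (simp add: padic_Cauchy_ring_simps)
    ultimately show "\<exists>y\<in>carrier (padic_field p). x \<otimes>\<^bsub>padic_field p\<^esub> y = \<one>\<^bsub>padic_field p\<^esub>"
      using g by (auto simp: carrier_padic_field)
  qed
qed

section \<open>Ramification at a prime in terms of rational sequences\<close>

lemma padic_of_rat_eq: "padic_of_rat p x = padic_of_seq (\<lambda>n. x)"
  by (simp add: padic_of_rat_def padic_of_seq_def)

text \<open>Failure to be a division algebra is used only to produce a zero of the quaternary norm
  form, and ramification only to exclude a zero of its ternary subform. This avoids proving the two
  kinds of isotropy equivalent.\<close>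

lemma not_ramified_imp_quat_isotropic:
  assumes "\<not> ramified_at a b (Finite_place p)"
  shows "quat_isotropic p a b"
proof -
  interpret C: cring "padic_Cauchy_ring p" by (rule padic_Cauchy_ring_cring)
  interpret F: field "padic_field p" by (rule padic_field_field)
  interpret h: ring_hom_cring "padic_Cauchy_ring p" "padic_field p" padic_of_seq by (rule padic_of_seq_hom)
  let ?C = "padic_Cauchy_ring p" and ?F = "padic_field p" and ?a = "padic_of_rat p a" and ?b = "padic_of_rat p b"
  have ab: "?a \<in> carrier ?F" "?b \<in> carrier ?F" by (auto simp: carrier_padic_field padic_of_rat_eq)
  have "\<not> is_division_algebra (quat_algebra ?F ?a ?b)" using assms by simp
  then obtain x0 x1 x2 x3 where x: "x0 \<in> carrier ?F" "x1 \<in> carrier ?F" "x2 \<in> carrier ?F" "x3 \<in> carrier ?F"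
    "\<not> (x0 = \<zero>\<^bsub>?F\<^esub> \<and> x1 = \<zero>\<^bsub>?F\<^esub> \<and> x2 = \<zero>\<^bsub>?F\<^esub> \<and> x3 = \<zero>\<^bsub>?F\<^esub>)"
    and eq: "x0 \<otimes>\<^bsub>?F\<^esub> x0 \<ominus>\<^bsub>?F\<^esub> ?a \<otimes>\<^bsub>?F\<^esub> (x1 \<otimes>\<^bsub>?F\<^esub> x1) \<ominus>\<^bsub>?F\<^esub> ?b \<otimes>\<^bsub>?F\<^esub> (x2 \<otimes>\<^bsub>?F\<^esub> x2)
      \<oplus>\<^bsub>?F\<^esub> ?a \<otimes>\<^bsub>?F\<^esub> ?b \<otimes>\<^bsub>?F\<^esub> (x3 \<otimes>\<^bsub>?F\<^esub> x3) = \<zero>\<^bsub>?F\<^esub>"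
    using F.not_division_quat_isotropic[OF ab] by blast
  obtain f0 f1 f2 f3 where f: "padic_Cauchy p f0" "padic_Cauchy p f1" "padic_Cauchy p f2" "padic_Cauchy p f3"
    and xf: "x0 = padic_of_seq f0" "x1 = padic_of_seq f1" "x2 = padic_of_seq f2" "x3 = padic_of_seq f3"
    using x(1-4) by (auto simp: carrier_padic_field)
  let ?N = "\<lambda>n. f0 n * f0 n - a * (f1 n * f1 n) - b * (f2 n * f2 n) + a * b * (f3 n * f3 n)"
  have c: "f0 \<in> carrier ?C" "f1 \<in> carrier ?C" "f2 \<in> carrier ?C" "f3 \<in> carrier ?C"
    "(\<lambda>n. a) \<in> carrier ?C" "(\<lambda>n. b) \<in> carrier ?C" using f by (simp_all add: padic_Cauchy_ring_simps)
  \<comment> \<open>The norm of the representatives, written with the ring operations so that the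
    quotient homomorphism carries it to the given zero of the norm form.\<close>
  let ?M = "f0 \<otimes>\<^bsub>?C\<^esub> f0 \<oplus>\<^bsub>?C\<^esub> \<ominus>\<^bsub>?C\<^esub> ((\<lambda>n. a) \<otimes>\<^bsub>?C\<^esub> (f1 \<otimes>\<^bsub>?C\<^esub> f1)) \<oplus>\<^bsub>?C\<^esub> \<ominus>\<^bsub>?C\<^esub> ((\<lambda>n. b) \<otimes>\<^bsub>?C\<^esub> (f2 \<otimes>\<^bsub>?C\<^esub> f2))
      \<oplus>\<^bsub>?C\<^esub> (\<lambda>n. a) \<otimes>\<^bsub>?C\<^esub> (\<lambda>n. b) \<otimes>\<^bsub>?C\<^esub> (f3 \<otimes>\<^bsub>?C\<^esub> f3)"
  have NM: "?N = ?M"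
    using f by (simp add: padic_Cauchy_ring_simps padic_Cauchy_ring_uminus padic_Cauchy_mult)
  have M: "?M \<in> carrier ?C" using c by simp
  have "padic_of_seq ?M = \<zero>\<^bsub>?F\<^esub>" using c eq by (simp add: xf padic_of_rat_eq a_minus_def)
  then have "?N \<in> padic_null p"
    using M NM padic_of_seq_eq_zero_iff[of ?M] by (simp add: padic_Cauchy_ring_simps(1))
  moreover have "\<not> (f0 \<in> padic_null p \<and> f1 \<in> padic_null p \<and> f2 \<in> padic_null p \<and> f3 \<in> padic_null p)"
    using x(5) f by (simp add: xf padic_of_seq_eq_zero_iff)
  ultimately show ?thesis unfolding quat_isotropic_def using f by blast
qed

lemma ramified_imp_not_conic_isotropic:
  assumes ram: "ramified_at a b (Finite_place p)"
  shows "\<not> conic_isotropic p a b"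
proof
  assume "conic_isotropic p a b"
  then obtain f g h where f: "padic_Cauchy p f" "padic_Cauchy p g" "padic_Cauchy p h"
    and nn: "\<not> (f \<in> padic_null p \<and> g \<in> padic_null p \<and> h \<in> padic_null p)"
    and null: "(\<lambda>n. f n * f n - a * (g n * g n) - b * (h n * h n)) \<in> padic_null p"
    unfolding conic_isotropic_def by blast
  interpret C: cring "padic_Cauchy_ring p" by (rule padic_Cauchy_ring_cring)
  interpret F: cring "padic_field p" by (rule padic_field_cring)
  interpret h: ring_hom_cring "padic_Cauchy_ring p" "padic_field p" padic_of_seq by (rule padic_of_seq_hom)
  let ?C = "padic_Cauchy_ring p" and ?F = "padic_field p"
  let ?a = "padic_of_seq (\<lambda>n. a)" and ?b = "padic_of_seq (\<lambda>n. b)"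
  have c: "f \<in> carrier ?C" "g \<in> carrier ?C" "h \<in> carrier ?C"
    "(\<lambda>n. a) \<in> carrier ?C" "(\<lambda>n. b) \<in> carrier ?C" using f by (simp_all add: padic_Cauchy_ring_simps)
  let ?N = "\<lambda>n. f n * f n - a * (g n * g n) - b * (h n * h n)"
  let ?R = "(\<lambda>n. a) \<otimes>\<^bsub>?C\<^esub> (g \<otimes>\<^bsub>?C\<^esub> g) \<oplus>\<^bsub>?C\<^esub> (\<lambda>n. b) \<otimes>\<^bsub>?C\<^esub> (h \<otimes>\<^bsub>?C\<^esub> h)"
  have fN: "f \<otimes>\<^bsub>?C\<^esub> f = ?N \<oplus>\<^bsub>?C\<^esub> ?R" by (simp add: padic_Cauchy_ring_simps)
  have N: "?N \<in> carrier ?C" using null padic_null_imp_Cauchy by (simp add: padic_Cauchy_ring_simps(1))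
  have R: "?R \<in> carrier ?C" using c by simp
  have "padic_of_seq (f \<otimes>\<^bsub>?C\<^esub> f) = padic_of_seq ?N \<oplus>\<^bsub>?F\<^esub> padic_of_seq ?R"
    unfolding fN by (rule h.hom_add[OF N R])
  moreover have "padic_of_seq ?N = \<zero>\<^bsub>?F\<^esub>"
    using null N padic_of_seq_eq_zero_iff[of ?N] by (simp add: padic_Cauchy_ring_simps(1))
  ultimately have "padic_of_seq f \<otimes>\<^bsub>?F\<^esub> padic_of_seq f =
      ?a \<otimes>\<^bsub>?F\<^esub> (padic_of_seq g \<otimes>\<^bsub>?F\<^esub> padic_of_seq g) \<oplus>\<^bsub>?F\<^esub> ?b \<otimes>\<^bsub>?F\<^esub> (padic_of_seq h \<otimes>\<^bsub>?F\<^esub> padic_of_seq h)"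
    using c by simp
  moreover have "is_division_algebra (quat_algebra ?F ?a ?b)" using ram by (simp add: padic_of_rat_eq)
  ultimately have "padic_of_seq f = \<zero>\<^bsub>?F\<^esub>" "padic_of_seq g = \<zero>\<^bsub>?F\<^esub>" "padic_of_seq h = \<zero>\<^bsub>?F\<^esub>"
    using F.division_quat_anisotropic[of ?a ?b "padic_of_seq f" "padic_of_seq g" "padic_of_seq h"] c by simp_all
  then show False using f nn by (simp add: padic_of_seq_eq_zero_iff)
qed

section \<open>Invariance under square factors and changes of generators\<close>

lemma padic_Cauchy_cmult: "padic_Cauchy p f \<Longrightarrow> padic_Cauchy p (\<lambda>n. c * f n)"
  using padic_Cauchy_mult[OF padic_Cauchy_const] .

lemma padic_null_cmult_iff:
  assumes "c \<noteq> 0"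
  shows "(\<lambda>n. c * f n) \<in> padic_null p \<longleftrightarrow> f \<in> padic_null p"
proof
  assume "(\<lambda>n. c * f n) \<in> padic_null p"
  from padic_null_mult[OF this padic_Cauchy_const[of "inverse c"]]
  show "f \<in> padic_null p" using assms by (simp add: field_simps)
next
  assume "f \<in> padic_null p"
  from padic_null_mult[OF this padic_Cauchy_const[of c]]
  show "(\<lambda>n. c * f n) \<in> padic_null p" by (simp add: mult.commute)
qed

lemma quat_isotropic_scale:
  assumes "quat_isotropic p (a * s\<^sup>2) (b * t\<^sup>2)" "s \<noteq> 0" "t \<noteq> 0"
  shows "quat_isotropic p a b"
proof -
  obtain f0 f1 f2 f3 where f: "padic_Cauchy p f0" "padic_Cauchy p f1" "padic_Cauchy p f2" "padic_Cauchy p f3"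
    "\<not> (f0 \<in> padic_null p \<and> f1 \<in> padic_null p \<and> f2 \<in> padic_null p \<and> f3 \<in> padic_null p)"
    "(\<lambda>n. f0 n * f0 n - a * s\<^sup>2 * (f1 n * f1 n) - b * t\<^sup>2 * (f2 n * f2 n) + a * s\<^sup>2 * (b * t\<^sup>2) * (f3 n * f3 n)) \<in> padic_null p"
    using assms(1) unfolding quat_isotropic_def by blast
  show ?thesis unfolding quat_isotropic_def
    by (rule exI[of _ f0], rule exI[of _ "\<lambda>n. s * f1 n"], rule exI[of _ "\<lambda>n. t * f2 n"], rule exI[of _ "\<lambda>n. (s * t) * f3 n"])
       (use f assms(2,3) in \<open>simp add: padic_Cauchy_cmult padic_null_cmult_iff power2_eq_square mult_ac\<close>)
qed

lemma quat_isotropic_commute: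
  assumes "quat_isotropic p a b"
  shows "quat_isotropic p b a"
proof -
  obtain f0 f1 f2 f3 where "padic_Cauchy p f0" "padic_Cauchy p f1" "padic_Cauchy p f2" "padic_Cauchy p f3"
    "\<not> (f0 \<in> padic_null p \<and> f1 \<in> padic_null p \<and> f2 \<in> padic_null p \<and> f3 \<in> padic_null p)"
    "(\<lambda>n. f0 n * f0 n - a * (f1 n * f1 n) - b * (f2 n * f2 n) + a * b * (f3 n * f3 n)) \<in> padic_null p"
    using assms unfolding quat_isotropic_def by blast
  then show ?thesis unfolding quat_isotropic_def
    by (intro exI[of _ f0] exI[of _ f2] exI[of _ f1] exI[of _ f3]) (simp add: algebra_simps)
qed

text \<open>This replaces the generators \<open>i\<close>, \<open>j\<close> by \<open>i\<close>,
  \<open>ij\<close>, since \<open>ij\<close> has square \<open>- (a * b)\<close>. It serves the case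
  in which \<open>r\<close> divides both entries.\<close>

lemma quat_isotropic_neg_mult:
  assumes "quat_isotropic p a b" "a \<noteq> 0"
  shows "quat_isotropic p a (- (a * b))"
proof -
  obtain f0 f1 f2 f3 where f: "padic_Cauchy p f0" "padic_Cauchy p f1" "padic_Cauchy p f2" "padic_Cauchy p f3"
    "\<not> (f0 \<in> padic_null p \<and> f1 \<in> padic_null p \<and> f2 \<in> padic_null p \<and> f3 \<in> padic_null p)"
    "(\<lambda>n. f0 n * f0 n - a * (f1 n * f1 n) - b * (f2 n * f2 n) + a * b * (f3 n * f3 n)) \<in> padic_null p"
    using assms unfolding quat_isotropic_def by blast
  have "(\<lambda>n. f0 n * f0 n - a * (f1 n * f1 n) - (- (a * b)) * (f3 n * f3 n)
      + a * (- (a * b)) * ((inverse a * f2 n) * (inverse a * f2 n))) \<in> padic_null p"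
    using f(6) assms(2) by (simp add: field_simps)
  with f assms(2) show ?thesis unfolding quat_isotropic_def
    by (intro exI[of _ f0] exI[of _ f1] exI[of _ f3] exI[of _ "\<lambda>n. inverse a * f2 n"])
       (simp only: padic_Cauchy_cmult padic_null_cmult_iff[of "inverse a"] nonzero_imp_inverse_nonzero simp_thms conj_commute conj_left_commute)
qed

text \<open>Anisotropy is what has to pass to squarefree representatives, so this runs in the
  direction opposite to \<open>quat_isotropic_scale\<close> and is applied by
  contraposition.\<close>

lemma conic_isotropic_scale:
  assumes "conic_isotropic p a b" "s \<noteq> 0" "t \<noteq> 0"
  shows "conic_isotropic p (a * s\<^sup>2) (b * t\<^sup>2)"
proof -
  obtain f g h where f: "padic_Cauchy p f" "padic_Cauchy p g" "padic_Cauchy p h"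
    "\<not> (f \<in> padic_null p \<and> g \<in> padic_null p \<and> h \<in> padic_null p)"
    "(\<lambda>n. f n * f n - a * (g n * g n) - b * (h n * h n)) \<in> padic_null p"
    using assms(1) unfolding conic_isotropic_def by blast
  have "(\<lambda>n. f n * f n - a * s\<^sup>2 * ((inverse s * g n) * (inverse s * g n))
      - b * t\<^sup>2 * ((inverse t * h n) * (inverse t * h n))) \<in> padic_null p"
    using f(5) assms(2,3) by (simp add: field_simps power2_eq_square)
  with f(1-4) assms(2,3) show ?thesis unfolding conic_isotropic_def
    by (intro exI[of _ f] exI[of _ "\<lambda>n. inverse s * g n"] exI[of _ "\<lambda>n. inverse t * h n"])
       (simp only: padic_Cauchy_cmult padic_null_cmult_iff[of "inverse s"] padic_null_cmult_iff[of "inverse t"]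
         nonzero_imp_inverse_nonzero simp_thms)
qed

lemma conic_isotropic_commute:
  assumes "conic_isotropic p a b"
  shows "conic_isotropic p b a"
proof -
  obtain f g h where "padic_Cauchy p f" "padic_Cauchy p g" "padic_Cauchy p h"
    "\<not> (f \<in> padic_null p \<and> g \<in> padic_null p \<and> h \<in> padic_null p)"
    "(\<lambda>n. f n * f n - a * (g n * g n) - b * (h n * h n)) \<in> padic_null p"
    using assms unfolding conic_isotropic_def by blast
  then show ?thesis unfolding conic_isotropic_def
    by (rule_tac exI[of _ f], rule_tac exI[of _ h], rule_tac exI[of _ g]) (auto simp: algebra_simps)
qed

text \<open>Multiplying by \<open>- a\<close>, the norm of a square root of \<open>a\<close>,
  exchanges the roles of the first two variables.\<close>

lemma conic_isotropic_neg_mult: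
  assumes "conic_isotropic p a (- (a * b))" "a \<noteq> 0"
  shows "conic_isotropic p a b"
proof -
  obtain f g h where f: "padic_Cauchy p f" "padic_Cauchy p g" "padic_Cauchy p h"
    "\<not> (f \<in> padic_null p \<and> g \<in> padic_null p \<and> h \<in> padic_null p)"
    "(\<lambda>n. f n * f n - a * (g n * g n) - (- (a * b)) * (h n * h n)) \<in> padic_null p"
    using assms unfolding conic_isotropic_def by blast
  have "(\<lambda>n. (- a) * (f n * f n - a * (g n * g n) - (- (a * b)) * (h n * h n))) \<in> padic_null p"
    using f(5) assms(2) padic_null_cmult_iff[of "- a"] by simp
  then have "(\<lambda>n. (a * g n) * (a * g n) - a * (f n * f n) - b * ((a * h n) * (a * h n))) \<in> padic_null p"
    by (simp add: algebra_simps)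
  then show ?thesis unfolding conic_isotropic_def using f(1-4) assms(2)
    by (intro exI[of _ "\<lambda>n. a * g n"] exI[of _ f] exI[of _ "\<lambda>n. a * h n"])
       (auto simp add: padic_Cauchy_cmult padic_null_cmult_iff)
qed

section \<open>From p-adic zeros to primitive zeros modulo prime powers\<close>

lemma rat_common_denominator:
  fixes y0 y1 y2 y3 :: rat
  obtains d n0 n1 n2 n3 :: int where "d > 0" "of_int d * y0 = of_int n0" "of_int d * y1 = of_int n1"
    "of_int d * y2 = of_int n2" "of_int d * y3 = of_int n3"
proof -
  obtain a0 b0 :: int where 0: "y0 = of_int a0 / of_int b0" "b0 > 0" by (rule rat_int_fraction)
  obtain a1 b1 :: int where 1: "y1 = of_int a1 / of_int b1" "b1 > 0" by (rule rat_int_fraction)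
  obtain a2 b2 :: int where 2: "y2 = of_int a2 / of_int b2" "b2 > 0" by (rule rat_int_fraction)
  obtain a3 b3 :: int where 3: "y3 = of_int a3 / of_int b3" "b3 > 0" by (rule rat_int_fraction)
  show thesis
    by (rule that[of "b0 * b1 * b2 * b3" "a0 * b1 * b2 * b3" "a1 * b0 * b2 * b3" "a2 * b0 * b1 * b3" "a3 * b0 * b1 * b2"])
       (use 0 1 2 3 in \<open>simp_all add: field_simps\<close>)
qed

lemma rat_primitive_multiple:
  fixes y0 y1 y2 y3 :: rat
  assumes "\<not> (y0 = 0 \<and> y1 = 0 \<and> y2 = 0 \<and> y3 = 0)"
  obtains l and x0 x1 x2 x3 :: int where "l * y0 = of_int x0" "l * y1 = of_int x1"
    "l * y2 = of_int x2" "l * y3 = of_int x3"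
    "\<not> (int p dvd x0 \<and> int p dvd x1 \<and> int p dvd x2 \<and> int p dvd x3)"
proof -
  obtain d n0 n1 n2 n3 :: int where d: "d > 0" "of_int d * y0 = of_int n0" "of_int d * y1 = of_int n1"
    "of_int d * y2 = of_int n2" "of_int d * y3 = of_int n3" by (rule rat_common_denominator)
  define g where "g = gcd n0 (gcd n1 (gcd n2 n3))"
  have nz: "\<not> (n0 = 0 \<and> n1 = 0 \<and> n2 = 0 \<and> n3 = 0)" using d assms by auto
  then have g: "g \<noteq> 0" by (auto simp: g_def)
  have "g dvd n0" "g dvd n1" "g dvd n2" "g dvd n3"
    unfolding g_def by (meson dvd_trans gcd_dvd1 gcd_dvd2)+
  then obtain x0 x1 x2 x3 where x: "n0 = g * x0" "n1 = g * x1" "n2 = g * x2" "n3 = g * x3"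
    by (auto simp: dvd_def)
  have "\<not> (int p dvd x0 \<and> int p dvd x1 \<and> int p dvd x2 \<and> int p dvd x3)"
  proof
    assume "int p dvd x0 \<and> int p dvd x1 \<and> int p dvd x2 \<and> int p dvd x3"
    then have "g * int p dvd n0" "g * int p dvd n1" "g * int p dvd n2" "g * int p dvd n3"
      by (simp_all add: x)
    then have "g * int p dvd gcd n0 (gcd n1 (gcd n2 n3))" by (intro gcd_greatest)
    then have "g * int p dvd g" by (simp only: g_def[symmetric])
    then have "int p dvd 1" using g by simp
    then show False using p not_prime_1 by (metis int_dvd_int_iff nat_dvd_1_iff_1 of_nat_1)
  qed
  moreover have "of_int d / of_int g * y = of_int z" if "of_int d * y = of_int (g * z)" for y :: rat and z
    using that g by (simp add: field_simps)
  ultimately show thesis using d x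
    by (intro that[of "of_int d / of_int g" x0 x1 x2 x3]) simp_all
qed

lemma quat_isotropic_primitive_zero:
  assumes "quat_isotropic p (of_int a) (of_int b)"
  obtains x0 x1 x2 x3 :: int where
    "\<not> (int p dvd x0 \<and> int p dvd x1 \<and> int p dvd x2 \<and> int p dvd x3)"
    "int p ^ k dvd x0\<^sup>2 - a * x1\<^sup>2 - b * x2\<^sup>2 + a * b * x3\<^sup>2"
proof -
  obtain f0 f1 f2 f3 where f: "padic_Cauchy p f0" "padic_Cauchy p f1" "padic_Cauchy p f2" "padic_Cauchy p f3"
    "\<not> (f0 \<in> padic_null p \<and> f1 \<in> padic_null p \<and> f2 \<in> padic_null p \<and> f3 \<in> padic_null p)"
    and null: "(\<lambda>n. f0 n * f0 n - of_int a * (f1 n * f1 n) - of_int b * (f2 n * f2 n)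
      + of_int a * of_int b * (f3 n * f3 n)) \<in> padic_null p"
    using assms unfolding quat_isotropic_def by blast
  obtain g where g: "g \<in> {f0, f1, f2, f3}" "padic_Cauchy p g" "g \<notin> padic_null p" using f by blast
  obtain e N where e: "e > 0" "\<And>n. n \<ge> N \<Longrightarrow> padic_abs p (g n) \<ge> e"
    using padic_Cauchy_not_null[OF g(2,3)] by blast
  \<comment> \<open>The terms at one index will be scaled by a rational \<open>l\<close> to integers
    not all divisible by \<open>p\<close>. As \<open>l * g n\<close> is an integer, \<open>l\<close>
    has absolute value at most \<open>1 / e\<close>; the form is quadratic, so a factor
    \<open>e\<^sup>2\<close> in the tolerance absorbs the scaling.\<close>
  have "e\<^sup>2 / real p ^ k > 0" using e prime_gt_0_nat[OF p] by simp
  then obtain M where M: "\<forall>n\<ge>M. padic_abs p (f0 n * f0 n - of_int a * (f1 n * f1 n) - of_int b * (f2 n * f2 n)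
      + of_int a * of_int b * (f3 n * f3 n)) < e\<^sup>2 / real p ^ k"
    using null unfolding padic_null_iff by blast
  define n where "n = max M N"
  let ?N = "f0 n * f0 n - of_int a * (f1 n * f1 n) - of_int b * (f2 n * f2 n)
      + of_int a * of_int b * (f3 n * f3 n)"
  have small: "padic_abs p ?N < e\<^sup>2 / real p ^ k" using M by (simp add: n_def)
  have ge: "padic_abs p (g n) \<ge> e" using e by (simp add: n_def)
  then have "g n \<noteq> 0" using e by (auto simp: padic_abs_def)
  then have "\<not> (f0 n = 0 \<and> f1 n = 0 \<and> f2 n = 0 \<and> f3 n = 0)" using g by auto
  then obtain l and x0 x1 x2 x3 :: int where l: "l * f0 n = of_int x0" "l * f1 n = of_int x1"
    "l * f2 n = of_int x2" "l * f3 n = of_int x3"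
    and prim: "\<not> (int p dvd x0 \<and> int p dvd x1 \<and> int p dvd x2 \<and> int p dvd x3)"
    by (rule rat_primitive_multiple)
  have "padic_abs p (l * g n) \<le> 1" using g l padic_abs_of_int_le_1[OF p] by auto
  then have "padic_abs p l * padic_abs p (g n) \<le> 1" using p by (simp add: padic_abs_mult)
  moreover have "padic_abs p l * e \<le> padic_abs p l * padic_abs p (g n)"
    using ge p by (intro mult_left_mono) auto
  ultimately have le: "padic_abs p l * e \<le> 1" by linarith
  have "of_int (x0\<^sup>2 - a * x1\<^sup>2 - b * x2\<^sup>2 + a * b * x3\<^sup>2) = l * l * ?N"
    by (simp add: power2_eq_square algebra_simps flip: l)
  then have "padic_abs p (of_int (x0\<^sup>2 - a * x1\<^sup>2 - b * x2\<^sup>2 + a * b * x3\<^sup>2)) = (padic_abs p l)\<^sup>2 * padic_abs p ?N"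
    using p by (simp only: padic_abs_mult power2_eq_square)
  also have "\<dots> \<le> (padic_abs p l)\<^sup>2 * (e\<^sup>2 / real p ^ k)"
    using small by (intro mult_left_mono) auto
  also have "\<dots> = (padic_abs p l * e)\<^sup>2 / real p ^ k" by (simp add: power_mult_distrib)
  also have "\<dots> \<le> 1 / real p ^ k"
    using le p e by (intro divide_right_mono power_le_one) auto
  finally have "int p ^ k dvd x0\<^sup>2 - a * x1\<^sup>2 - b * x2\<^sup>2 + a * b * x3\<^sup>2"
    using padic_abs_of_int_le_iff[OF p] by blast
  then show thesis using that prim by blast
qed

end

section \<open>Local conditions as quadratic residues\<close>

lemma QuadRes_iff: "QuadRes p a \<longleftrightarrow> (\<exists>y. p dvd y\<^sup>2 - a)"
  by (simp add: QuadRes_def cong_iff_dvd_diff)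

lemma prime_inverse_mod:
  fixes p :: int
  assumes "prime p" "\<not> p dvd y"
  obtains w where "p dvd y * w - 1"
proof -
  have "coprime y p" using assms by (simp add: prime_imp_coprime coprime_commute)
  then show thesis using that cong_solve_coprime_int[of y p] by (auto simp: cong_iff_dvd_diff)
qed

text \<open>If \<open>p\<close> did not divide \<open>y\<close>, an inverse \<open>w\<close> of
  \<open>y\<close> modulo \<open>p\<close> would make \<open>x * w\<close> a square root of
  \<open>b\<close>.\<close>

lemma nonresidue_form_dvd:
  fixes p :: int
  assumes p: "prime p" and nr: "\<not> QuadRes p b" and dvd: "p dvd x\<^sup>2 - b * y\<^sup>2"
  shows "p dvd x" "p dvd y"
proof -
  show y: "p dvd y"
  proof (rule ccontr)
    assume "\<not> p dvd y"
    then obtain w where w: "p dvd y * w - 1" by (rule prime_inverse_mod[OF p])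
    have "(x * w)\<^sup>2 - b = w\<^sup>2 * (x\<^sup>2 - b * y\<^sup>2) + b * ((y * w + 1) * (y * w - 1))"
      by (simp add: power2_eq_square algebra_simps)
    then have "p dvd (x * w)\<^sup>2 - b" using dvd w by simp
    then show False using nr by (auto simp: QuadRes_iff)
  qed
  then have "p dvd (x\<^sup>2 - b * y\<^sup>2) + b * y\<^sup>2" using dvd by (intro dvd_add) (simp_all add: power2_eq_square)
  then show "p dvd x" using p prime_dvd_power by (metis diff_add_cancel)
qed

context
  fixes p :: nat
  assumes p: "prime p"
begin

text \<open>The norm form is \<open><1, - b> - a * <1, - b>\<close>. For a nonresidue
  \<open>b\<close>, divisibility by \<open>p\<close> makes \<open>x0\<close> and \<open>x2\<close>
  multiples of \<open>p\<close>; as \<open>a\<close> contains \<open>p\<close> only once,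
  divisibility by \<open>p ^ 2\<close> then does the same to \<open>x1\<close> and
  \<open>x3\<close>, against primitivity.\<close>

lemma quat_isotropic_imp_QuadRes:
  assumes iso: "quat_isotropic p (of_int a) (of_int b)"
    and a: "int p dvd a" "squarefree a" and b: "\<not> int p dvd b"
  shows "QuadRes (int p) b"
proof (rule ccontr)
  assume nr: "\<not> QuadRes (int p) b"
  have pi: "prime (int p)" using p by simp
  obtain x0 x1 x2 x3 :: int where prim: "\<not> (int p dvd x0 \<and> int p dvd x1 \<and> int p dvd x2 \<and> int p dvd x3)"
    and dvd: "int p ^ 2 dvd x0\<^sup>2 - a * x1\<^sup>2 - b * x2\<^sup>2 + a * b * x3\<^sup>2"
    using quat_isotropic_primitive_zero[OF p iso] by blast
  obtain a' where a': "a = int p * a'" using a by (auto simp: dvd_def)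
  have pa': "\<not> int p dvd a'"
  proof
    assume "int p dvd a'"
    then have "(int p)\<^sup>2 dvd a" by (simp add: a' power2_eq_square)
    then have "is_unit (int p)" using a(2) unfolding squarefree_def by blast
    then show False using pi not_prime_unit by blast
  qed
  have "int p dvd x0\<^sup>2 - a * x1\<^sup>2 - b * x2\<^sup>2 + a * b * x3\<^sup>2" using dvd by (meson dvd_trans dvd_power pos2)
  moreover have "x0\<^sup>2 - b * x2\<^sup>2 = (x0\<^sup>2 - a * x1\<^sup>2 - b * x2\<^sup>2 + a * b * x3\<^sup>2) + int p * (a' * (x1\<^sup>2 - b * x3\<^sup>2))"
    by (simp add: a' algebra_simps)
  ultimately have "int p dvd x0\<^sup>2 - b * x2\<^sup>2" by (metis dvd_add dvd_triv_left)
  from nonresidue_form_dvd[OF pi nr this] obtain u v where u: "x0 = int p * u" "x2 = int p * v"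
    by (auto simp: dvd_def)
  have "x0\<^sup>2 - a * x1\<^sup>2 - b * x2\<^sup>2 + a * b * x3\<^sup>2 = (int p)\<^sup>2 * (u\<^sup>2 - b * v\<^sup>2) - int p * (a' * (x1\<^sup>2 - b * x3\<^sup>2))"
    by (simp add: u a' power2_eq_square algebra_simps)
  then have "(int p)\<^sup>2 dvd int p * (a' * (x1\<^sup>2 - b * x3\<^sup>2))"
    using dvd by (metis dvd_diff_right_iff dvd_triv_left)
  then have "int p dvd a' * (x1\<^sup>2 - b * x3\<^sup>2)" using prime_gt_0_nat[OF p] by (simp add: power2_eq_square)
  then have "int p dvd x1\<^sup>2 - b * x3\<^sup>2" using pa' pi prime_dvd_mult_iff by blast
  from nonresidue_form_dvd[OF pi nr this] show False using prim u by simp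
qed

text \<open>The descent has three layers: \<open>x0\<close>, then \<open>x1\<close> and
  \<open>x2\<close> through \<open>a * x1\<^sup>2 + b * x2\<^sup>2\<close>, then \<open>x3\<close>
  through \<open>u\<^sup>2 + a * b * x3\<^sup>2\<close>. Hence the zero modulo
  \<open>p ^ 3\<close>.\<close>

lemma quat_isotropic_imp_QuadRes_both:
  assumes iso: "quat_isotropic p (of_int (int p * a)) (of_int (int p * b))"
    and a: "\<not> int p dvd a" and b: "\<not> int p dvd b"
  shows "QuadRes (int p) (- (a * b))"
proof (rule ccontr)
  assume nr: "\<not> QuadRes (int p) (- (a * b))"
  have pi: "prime (int p)" using p by simp
  have p0: "int p \<noteq> 0" using prime_gt_0_nat[OF p] by simp
  obtain x0 x1 x2 x3 :: int where prim: "\<not> (int p dvd x0 \<and> int p dvd x1 \<and> int p dvd x2 \<and> int p dvd x3)"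
    and dvd: "int p ^ 3 dvd x0\<^sup>2 - (int p * a) * x1\<^sup>2 - (int p * b) * x2\<^sup>2 + (int p * a) * (int p * b) * x3\<^sup>2"
    using quat_isotropic_primitive_zero[OF p iso] by blast
  have "int p dvd x0\<^sup>2 - (int p * a) * x1\<^sup>2 - (int p * b) * x2\<^sup>2 + (int p * a) * (int p * b) * x3\<^sup>2"
    using dvd by (meson dvd_trans dvd_power zero_less_numeral)
  moreover have "x0\<^sup>2 = (x0\<^sup>2 - (int p * a) * x1\<^sup>2 - (int p * b) * x2\<^sup>2 + (int p * a) * (int p * b) * x3\<^sup>2)
     + int p * (a * x1\<^sup>2 + b * x2\<^sup>2 - int p * a * b * x3\<^sup>2)" by (simp add: algebra_simps)
  ultimately have "int p dvd x0\<^sup>2" by (metis dvd_add dvd_triv_left)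
  then have "int p dvd x0" using pi prime_dvd_power by blast
  then obtain u where u: "x0 = int p * u" by (auto simp: dvd_def)
  have eq: "x0\<^sup>2 - (int p * a) * x1\<^sup>2 - (int p * b) * x2\<^sup>2 + (int p * a) * (int p * b) * x3\<^sup>2 =
      int p * (int p * (u\<^sup>2 + a * b * x3\<^sup>2) - (a * x1\<^sup>2 + b * x2\<^sup>2))"
    by (simp add: u power2_eq_square algebra_simps)
  have dvd2: "int p ^ 2 dvd int p * (u\<^sup>2 + a * b * x3\<^sup>2) - (a * x1\<^sup>2 + b * x2\<^sup>2)"
    using dvd p0 unfolding eq by (simp add: power2_eq_square power3_eq_cube)
  then have "int p dvd int p * (u\<^sup>2 + a * b * x3\<^sup>2) - (a * x1\<^sup>2 + b * x2\<^sup>2)"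
    by (meson dvd_trans dvd_power pos2)
  then have "int p dvd a * x1\<^sup>2 + b * x2\<^sup>2" by (metis dvd_diff_right_iff dvd_triv_left)
  then have "int p dvd a * (a * x1\<^sup>2 + b * x2\<^sup>2)" by simp
  moreover have "a * (a * x1\<^sup>2 + b * x2\<^sup>2) = (a * x1)\<^sup>2 - (- (a * b)) * x2\<^sup>2"
    by (simp add: power2_eq_square algebra_simps)
  ultimately have "int p dvd (a * x1)\<^sup>2 - (- (a * b)) * x2\<^sup>2" by simp
  from nonresidue_form_dvd[OF pi nr this] have "int p dvd x1" "int p dvd x2"
    using a pi prime_dvd_mult_iff by blast+
  then obtain v w where vw: "x1 = int p * v" "x2 = int p * w" by (auto simp: dvd_def)
  have "int p * (u\<^sup>2 + a * b * x3\<^sup>2) - (a * x1\<^sup>2 + b * x2\<^sup>2) =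
     int p * (u\<^sup>2 + a * b * x3\<^sup>2) - int p ^ 2 * (a * v\<^sup>2 + b * w\<^sup>2)"
    by (simp add: vw power2_eq_square algebra_simps)
  then have "int p ^ 2 dvd int p * (u\<^sup>2 + a * b * x3\<^sup>2)"
    using dvd2 by (metis dvd_diff_left_iff dvd_triv_left)
  then have "int p dvd u\<^sup>2 - (- (a * b)) * x3\<^sup>2" using p0 by (simp add: power2_eq_square)
  from nonresidue_form_dvd[OF pi nr this] show False using prim u vw by simp
qed

end

section \<open>Hensel lifting of square roots\<close>

lemma hensel_sqrt_step:
  fixes p s u :: int
  assumes p: "prime p" "odd p" and s: "\<not> p dvd s" and dvd: "p ^ Suc n dvd s\<^sup>2 - u"
  shows "\<exists>s'. p ^ Suc (Suc n) dvd s'\<^sup>2 - u \<and> p ^ Suc n dvd s' - s"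
proof -
  obtain c where c: "s\<^sup>2 - u = p ^ Suc n * c" using dvd by (auto simp: dvd_def)
  have "\<not> p dvd 2" using p primes_dvd_imp_eq[of p 2] by auto
  then have "\<not> p dvd 2 * s" using p s prime_dvd_mult_iff by blast
  then obtain w where w: "p dvd (2 * s) * w - 1" by (rule prime_inverse_mod[OF p(1)])
  \<comment> \<open>\<open>k\<close> solves the linearised congruence
    \<open>c + 2 * s * k = 0\<close> modulo \<open>p\<close>, with \<open>w\<close> inverse to
    \<open>2 * s\<close>; the quadratic term has a factor \<open>p\<close> to spare.\<close>
  define k where "k = - c * w"
  have "c + 2 * s * k = - (c * ((2 * s) * w - 1))" by (simp add: k_def algebra_simps)
  then have "p dvd c + 2 * s * k" using w by simp
  then have "p dvd (c + 2 * s * k) + k\<^sup>2 * p ^ n * p" by simp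
  then have "p ^ Suc n * p dvd p ^ Suc n * ((c + 2 * s * k) + k\<^sup>2 * p ^ n * p)" by simp
  moreover have "(s + k * p ^ Suc n)\<^sup>2 - u = p ^ Suc n * ((c + 2 * s * k) + k\<^sup>2 * p ^ n * p)"
  proof -
    have "(s + k * p ^ Suc n)\<^sup>2 - u = (s\<^sup>2 - u) + 2 * s * k * p ^ Suc n + k\<^sup>2 * p ^ Suc n * p ^ Suc n"
      by (simp add: power2_eq_square algebra_simps)
    then show ?thesis unfolding c by (simp add: algebra_simps)
  qed
  ultimately show ?thesis by (intro exI[of _ "s + k * p ^ Suc n"]) (simp add: mult.commute)
qed

lemma hensel_sqrt:
  fixes p u :: int
  assumes p: "prime p" "odd p" and u: "\<not> p dvd u" "QuadRes p u"
  obtains f :: "nat \<Rightarrow> int" where "\<And>n. p ^ Suc n dvd (f n)\<^sup>2 - u" "\<And>n. p ^ Suc n dvd f (Suc n) - f n"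
proof -
  define P where "P = (\<lambda>n s. \<not> p dvd s \<and> p ^ Suc n dvd s\<^sup>2 - u)"
  have "\<exists>f. \<forall>n. P n (f n) \<and> p ^ Suc n dvd f (Suc n) - f n"
  proof (rule dependent_nat_choice)
    obtain y where y: "p dvd y\<^sup>2 - u" using u by (auto simp: QuadRes_iff)
    have "\<not> p dvd y"
    proof
      assume "p dvd y"
      then have "p dvd y\<^sup>2" by (simp add: power2_eq_square)
      from dvd_diff[OF this y] show False using u(1) by simp
    qed
    then show "\<exists>x. P 0 x" using y by (auto simp: P_def)
  next
    fix s n assume P: "P n s"
    then obtain s' where s': "p ^ Suc (Suc n) dvd s'\<^sup>2 - u" "p ^ Suc n dvd s' - s"
      using hensel_sqrt_step[OF p, of s n u] by (auto simp: P_def)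
    have "p dvd s' - s" using s'(2) by (meson dvd_trans dvd_power zero_less_Suc)
    then have "\<not> p dvd s'" using P unfolding P_def by (metis dvd_diffD dvd_diff_commute diff_diff_eq2 add_diff_cancel_left' dvd_diff)
    then show "\<exists>s'. P (Suc n) s' \<and> p ^ Suc n dvd s' - s" using s' by (auto simp: P_def)
  qed
  then show thesis using that by (auto simp: P_def)
qed

context
  fixes p :: nat
  assumes p: "prime p" and odd: "odd p"
begin

lemma padic_sqrt:
  assumes u: "\<not> int p dvd u" "QuadRes (int p) u"
  obtains f where "padic_Cauchy p f" "(\<lambda>n. f n * f n - of_int u) \<in> padic_null p"
proof -
  have pi: "prime (int p)" "odd (int p)" using p odd by simp_all
  obtain f :: "nat \<Rightarrow> int" where f: "\<And>n. int p ^ Suc n dvd (f n)\<^sup>2 - u" "\<And>n. int p ^ Suc n dvd f (Suc n) - f n"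
    using hensel_sqrt[OF pi u] by blast
  have small: "\<exists>N. \<forall>n\<ge>N. 1 / real p ^ Suc n < e" if "e > 0" for e
  proof -
    have "(\<lambda>n. (1 / real p) ^ n) \<longlonglongrightarrow> 0" using prime_gt_1_nat[OF p] by (intro LIMSEQ_power_zero) auto
    then have "(\<lambda>n. (1 / real p) ^ Suc n) \<longlonglongrightarrow> 0" by (rule LIMSEQ_Suc)
    from LIMSEQ_D[OF this that] obtain N where "\<forall>n\<ge>N. norm ((1 / real p) ^ Suc n - 0) < e" by blast
    then have "\<forall>n\<ge>N. 1 / real p ^ Suc n < e" by (simp add: power_one_over del: power_Suc)
    then show ?thesis ..
  qed
  have diff: "int p ^ Suc N dvd f (N + k) - f N" for N k
  proof (induction k)
    case (Suc k)
    have "int p ^ Suc N dvd f (Suc (N + k)) - f (N + k)"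
      using f(2)[of "N + k"] by (rule dvd_trans[OF le_imp_power_dvd, rotated]) simp
    from dvd_add[OF this Suc] show ?case by simp
  qed simp
  have C: "padic_Cauchy p (\<lambda>n. of_int (f n))"
    unfolding padic_Cauchy_def
  proof (intro allI impI)
    fix e :: real assume "e > 0"
    then obtain N where N: "1 / real p ^ Suc N < e" using small by blast
    show "\<exists>N. \<forall>m\<ge>N. \<forall>n\<ge>N. padic_abs p (of_int (f m) - of_int (f n)) < e"
    proof (intro exI[of _ N] allI impI)
      fix m n assume "m \<ge> N" "n \<ge> N"
      then have "int p ^ Suc N dvd f m - f N" "int p ^ Suc N dvd f n - f N"
        using diff[of N "m - N"] diff[of N "n - N"] by simp_all
      then have "int p ^ Suc N dvd (f m - f N) - (f n - f N)" by (rule dvd_diff)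
      then have "padic_abs p (of_int (f m - f n)) \<le> 1 / real p ^ Suc N"
        by (subst padic_abs_of_int_le_iff[OF p]) simp
      then show "padic_abs p (of_int (f m) - of_int (f n)) < e" using N by simp
    qed
  qed
  have "(\<lambda>n. of_int (f n) * of_int (f n) - of_int u) \<in> padic_null p"
    unfolding padic_null_iff[OF p]
  proof (intro allI impI)
    fix e :: real assume "e > 0"
    then obtain N where N: "\<forall>n\<ge>N. 1 / real p ^ Suc n < e" using small by blast
    show "\<exists>N. \<forall>n\<ge>N. padic_abs p (of_int (f n) * of_int (f n) - of_int u) < e"
    proof (intro exI[of _ N] allI impI)
      fix n assume "n \<ge> N"
      have "padic_abs p (of_int ((f n)\<^sup>2 - u)) \<le> 1 / real p ^ Suc n"
        using f(1) by (subst padic_abs_of_int_le_iff[OF p])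
      then show "padic_abs p (of_int (f n) * of_int (f n) - of_int u) < e"
        using N \<open>n \<ge> N\<close> by (auto simp: power2_eq_square simp del: power_Suc)
    qed
  qed
  then show thesis using that C by blast
qed

text \<open>Two coordinates of the zero can be constant integers; only the first is a genuine p-adic
  limit.\<close>

lemma conic_isotropic_of_sum:
  assumes "\<not> int p dvd a * y\<^sup>2 + b * z\<^sup>2" "QuadRes (int p) (a * y\<^sup>2 + b * z\<^sup>2)"
  shows "conic_isotropic p (of_int a) (of_int b)"
proof -
  obtain f where f: "padic_Cauchy p f" "(\<lambda>n. f n * f n - of_int (a * y\<^sup>2 + b * z\<^sup>2)) \<in> padic_null p"
    using padic_sqrt[OF assms] by blast
  have "y \<noteq> 0 \<or> z \<noteq> 0" using assms(1) by auto
  then show ?thesis unfolding conic_isotropic_def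
    using f padic_null_const_iff[OF p] padic_Cauchy_const[OF p]
    by (intro exI[of _ f] exI[of _ "\<lambda>n. of_int y"] exI[of _ "\<lambda>n. of_int z"])
       (auto simp: power2_eq_square algebra_simps)
qed

section \<open>Counting squares modulo an odd prime\<close>

lemma inj_on_square_mod:
  assumes "\<not> int p dvd a"
  shows "inj_on (\<lambda>y. (a * y\<^sup>2 + c) mod int p) {0..(int p - 1) div 2}"
proof (rule inj_onI)
  fix x y assume x: "x \<in> {0..(int p - 1) div 2}" and y: "y \<in> {0..(int p - 1) div 2}"
    and eq: "(a * x\<^sup>2 + c) mod int p = (a * y\<^sup>2 + c) mod int p"
  have pi: "prime (int p)" using p by simp
  have "int p dvd (a * x\<^sup>2 + c) - (a * y\<^sup>2 + c)" using eq by (simp only: mod_eq_dvd_iff)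
  moreover have "(a * x\<^sup>2 + c) - (a * y\<^sup>2 + c) = a * ((x - y) * (x + y))"
    by (simp add: power2_eq_square algebra_simps)
  ultimately have "int p dvd a * ((x - y) * (x + y))" by simp
  then have "int p dvd x - y \<or> int p dvd x + y" using assms pi by (simp add: prime_dvd_mult_iff)
  then show "x = y"
  proof
    assume "int p dvd x - y"
    then show ?thesis using x y zdvd_imp_le[of "int p" "x - y"] zdvd_imp_le[of "int p" "y - x"]
      by (cases "x - y" "0 :: int" rule: linorder_cases) (auto simp: dvd_diff_commute)
  next
    assume "int p dvd x + y"
    then show ?thesis using x y zdvd_imp_le[of "int p" "x + y"] by (cases "x + y = 0") auto
  qed
qed

lemma card_half_residues: "card {0..(int p - 1) div 2} = (p + 1) div 2"
  using odd by (auto elim!: oddE)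

text \<open>The values of \<open>a * y\<^sup>2\<close> and of \<open>1 - b * z\<^sup>2\<close> fill
  \<open>(p + 1) div 2\<close> residue classes each, and two such sets must meet among
  \<open>p\<close> classes.\<close>

lemma sum_of_squares_form_residue:
  assumes a: "\<not> int p dvd a" and b: "\<not> int p dvd b"
  obtains y z where "int p dvd a * y\<^sup>2 + b * z\<^sup>2 - 1"
proof -
  let ?H = "{0..(int p - 1) div 2}"
  let ?S = "(\<lambda>y. (a * y\<^sup>2 + 0) mod int p) ` ?H" and ?T = "(\<lambda>y. ((- b) * y\<^sup>2 + 1) mod int p) ` ?H"
  have p0: "int p > 0" using prime_gt_0_nat[OF p] by simp
  have "card ?S = (p + 1) div 2" using card_image[OF inj_on_square_mod[OF a, of 0]] card_half_residues by simp
  moreover have "card ?T = (p + 1) div 2"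
    using card_image[OF inj_on_square_mod[of "- b" 1]] b card_half_residues by simp
  moreover have "?S \<union> ?T \<subseteq> {0..<int p}" using p0 by auto
  then have "card (?S \<union> ?T) \<le> p" using card_mono[of "{0..<int p}" "?S \<union> ?T"] by simp
  moreover have "(p + 1) div 2 + (p + 1) div 2 = p + 1" using odd by (auto elim!: oddE)
  ultimately have "?S \<inter> ?T \<noteq> {}" using card_Un_disjoint[of ?S ?T] by auto
  then obtain y z where "(a * y\<^sup>2 + 0) mod int p = ((- b) * z\<^sup>2 + 1) mod int p" by auto
  then have "int p dvd a * y\<^sup>2 + 0 - ((- b) * z\<^sup>2 + 1)" by (simp only: mod_eq_dvd_iff)
  then show thesis using that by (simp add: algebra_simps)
qed

text \<open>A residue \<open>a\<close> would lift to a zero with \<open>y = 1\<close>,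
  \<open>z = 0\<close>. If \<open>p\<close> did not divide \<open>b\<close>, the form
  \<open>a * y\<^sup>2 + b * z\<^sup>2\<close> would represent 1 modulo \<open>p\<close>, which
  lifts as well.\<close>

lemma not_conic_isotropic_imp:
  assumes nc: "\<not> conic_isotropic p (of_int a) (of_int b)" and a: "\<not> int p dvd a"
  shows "\<not> QuadRes (int p) a" "int p dvd b"
proof -
  show "\<not> QuadRes (int p) a" using conic_isotropic_of_sum[of a 1 b 0] nc a by auto
  show "int p dvd b"
  proof (rule ccontr)
    assume b: "\<not> int p dvd b"
    obtain y z where yz: "int p dvd a * y\<^sup>2 + b * z\<^sup>2 - 1" using sum_of_squares_form_residue[OF a b] .
    have "\<not> int p dvd a * y\<^sup>2 + b * z\<^sup>2"
    proof
      assume "int p dvd a * y\<^sup>2 + b * z\<^sup>2"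
      from dvd_diff[OF this yz] have "int p dvd 1" by simp
      then show False using prime_gt_1_nat[OF p] by simp
    qed
    moreover have "QuadRes (int p) (a * y\<^sup>2 + b * z\<^sup>2)"
      using yz by (auto simp: QuadRes_iff dvd_diff_commute intro!: exI[of _ 1])
    ultimately show False using conic_isotropic_of_sum nc by blast
  qed
qed

text \<open>Otherwise squaring would be onto modulo \<open>p\<close>, hence injective, although
  \<open>1\<close> and \<open>p - 1\<close> have the same square.\<close>

lemma exists_nonresidue: "\<exists>a. \<not> QuadRes (int p) a"
proof (rule ccontr)
  assume "\<not> ?thesis"
  then have all: "QuadRes (int p) a" for a by blast
  have p2: "p > 2" using p odd prime_ge_2_nat[OF p] by (cases "p = 2") auto
  let ?f = "\<lambda>y. y\<^sup>2 mod int p"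
  have "{0..<int p} \<subseteq> ?f ` {0..<int p}"
  proof
    fix a assume a: "a \<in> {0..<int p}"
    obtain y where "int p dvd y\<^sup>2 - a" using all[of a] by (auto simp: QuadRes_iff)
    then have "y\<^sup>2 mod int p = a mod int p" by (simp add: mod_eq_dvd_iff)
    then have "a = ?f (y mod int p)" using a by (simp add: power_mod)
    then show "a \<in> ?f ` {0..<int p}" using p2 by auto
  qed
  then have "inj_on ?f {0..<int p}" by (intro finite_surj_inj) auto
  moreover have "?f 1 = ?f (int p - 1)"
  proof -
    have "(int p - 1)\<^sup>2 - 1 = int p * (int p - 2)" by (simp add: power2_eq_square algebra_simps)
    then have "int p dvd (int p - 1)\<^sup>2 - 1\<^sup>2" by simp
    then show ?thesis by (metis mod_eq_dvd_iff)
  qed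
  ultimately have "1 = int p - 1" by (rule inj_onD) (use p2 in auto)
  then show False using p2 by simp
qed

text \<open>If every \<open>t\<^sup>2 - d\<close> were a square, the squares modulo \<open>p\<close>
  would be closed under subtracting \<open>d\<close>; as \<open>d\<close> generates all residues
  additively, there would be no nonresidue.\<close>

lemma exists_square_minus_nonresidue:
  assumes d: "\<not> int p dvd d"
  obtains t where "\<bar>t\<bar> \<le> (int p - 1) div 2" "\<not> QuadRes (int p) (t\<^sup>2 - d)"
proof -
  have p0: "int p > 0" using prime_gt_0_nat[OF p] by simp
  have "\<exists>t. \<not> QuadRes (int p) (t\<^sup>2 - d)"
  proof (rule ccontr)
    assume "\<not> ?thesis"
    then have all: "QuadRes (int p) (t\<^sup>2 - d)" for t by blast
    have step: "QuadRes (int p) (x - d)" if x: "QuadRes (int p) x" for x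
    proof -
      obtain y where y: "int p dvd y\<^sup>2 - x" using x by (auto simp: QuadRes_iff)
      obtain z where z: "int p dvd z\<^sup>2 - (y\<^sup>2 - d)" using all[of y] by (auto simp: QuadRes_iff)
      from dvd_add[OF y z] show ?thesis by (auto simp: QuadRes_iff algebra_simps)
    qed
    have mult: "QuadRes (int p) (- (int j * d))" for j
    proof (induction j)
      case 0 show ?case by (auto simp: QuadRes_iff intro!: exI[of _ 0])
    next
      case (Suc j)
      have "- (int (Suc j) * d) = - (int j * d) - d" by (simp add: algebra_simps)
      then show ?case using step[OF Suc] by (simp only:)
    qed
    obtain a where a: "\<not> QuadRes (int p) a" using exists_nonresidue by blast
    obtain w where w: "int p dvd d * w - 1" using prime_inverse_mod[of "int p" d] d p by auto
    define j where "j = nat ((- a * w) mod int p)"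
    have j: "int j = (- a * w) mod int p" using p0 by (simp add: j_def)
    obtain y where y: "int p dvd y\<^sup>2 - (- (int j * d))" using mult[of j] by (auto simp: QuadRes_iff)
    have "int p dvd (- a * w) - int j" using j by (metis dvd_minus_mod)
    then have "int p dvd ((- a * w) - int j) * d" by simp
    moreover have "int p dvd a * (d * w - 1)" using w by simp
    ultimately have "int p dvd (y\<^sup>2 - (- (int j * d))) + ((- a * w) - int j) * d + a * (d * w - 1)"
      using y by (intro dvd_add)
    then have "int p dvd y\<^sup>2 - a" by (simp add: algebra_simps)
    then show False using a by (auto simp: QuadRes_iff)
  qed
  then obtain t where t: "\<not> QuadRes (int p) (t\<^sup>2 - d)" by blast
  define h where "h = (int p - 1) div 2"
  have h: "int p = 2 * h + 1" using odd by (auto simp: h_def elim!: oddE)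
  \<comment> \<open>The representative of \<open>t\<close> between \<open>- h\<close> and
    \<open>h\<close>, an interval that meets every class exactly once because
    \<open>p = 2 * h + 1\<close>.\<close>
  define t' where "t' = (t + h) mod int p - h"
  have "0 \<le> (t + h) mod int p" "(t + h) mod int p < int p" using p0 by simp_all
  then have "\<bar>t'\<bar> \<le> h" using h unfolding t'_def by linarith
  moreover have "\<not> QuadRes (int p) (t'\<^sup>2 - d)"
  proof
    assume "QuadRes (int p) (t'\<^sup>2 - d)"
    then obtain y where y: "int p dvd y\<^sup>2 - (t'\<^sup>2 - d)" by (auto simp: QuadRes_iff)
    have "int p dvd (t + h) - (t + h) mod int p" by (rule dvd_minus_mod)
    then have "int p dvd t - t'" by (simp add: t'_def algebra_simps)
    then have "int p dvd (t - t') * (t + t')" by simp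
    from dvd_diff[OF y this] have "int p dvd y\<^sup>2 - (t\<^sup>2 - d)" by (simp add: power2_eq_square algebra_simps)
    then show False using t by (auto simp: QuadRes_iff)
  qed
  ultimately show thesis using that by (simp add: h_def)
qed

end

section \<open>Legendre's theorem\<close>

text \<open>Chinese remaindering, one prime at a time. The prime 2 carries no hypothesis because
  every integer is a square modulo 2; hence only odd primes are examined when Legendre's theorem is
  applied.\<close>

lemma QuadRes_squarefree_modulus:
  fixes n x :: int
  assumes "n > 0" "squarefree n" and "\<And>p. prime p \<Longrightarrow> odd p \<Longrightarrow> p dvd n \<Longrightarrow> QuadRes p x"
  shows "QuadRes n x"
  using assms
proof (induction "nat n" arbitrary: n rule: less_induct)
  case less
  show ?case
  proof (cases "n = 1")
    case False
    then obtain p where p: "prime p" "p dvd n"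
      using less.prems(1) prime_divisor_exists[of n] by auto
    then obtain m where m: "n = p * m" by (auto simp: dvd_def)
    have p1: "p > 1" using p prime_gt_1_int by blast
    have m0: "m > 0" using less.prems(1) m p1 by (simp add: zero_less_mult_iff)
    have "squarefree m" using less.prems(2) m squarefree_mono[of m n] by simp
    moreover have "nat m < nat n" using m m0 p1 by simp
    moreover have "QuadRes q x" if "prime q" "odd q" "q dvd m" for q
      using that less.prems(3)[of q] m by simp
    ultimately have "QuadRes m x" using less.hyps m0 by blast
    then obtain s where s: "m dvd s\<^sup>2 - x" by (auto simp: QuadRes_iff)
    have "QuadRes p x"
    proof (cases "odd p")
      case True then show ?thesis using less.prems(3) p by blast
    next
      case False
      then have "p = 2" using p(1) primes_dvd_imp_eq[of 2 p] by auto
      then show ?thesis by (cases "even x") (auto simp: QuadRes_iff intro: exI[of _ 0] exI[of _ 1])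
    qed
    then obtain t where t: "p dvd t\<^sup>2 - x" by (auto simp: QuadRes_iff)
    have "\<not> p dvd m"
    proof
      assume "p dvd m"
      then have "p\<^sup>2 dvd n" by (simp add: m power2_eq_square)
      then have "is_unit p" using less.prems(2) unfolding squarefree_def by blast
      then show False using p not_prime_unit by blast
    qed
    then have cop: "coprime p m" using p prime_imp_coprime by blast
    then obtain y where y: "[y = t] (mod p)" "[y = s] (mod m)"
      using binary_chinese_remainder_int by blast
    have "[y\<^sup>2 = x] (mod p)" "[y\<^sup>2 = x] (mod m)"
      using cong_pow[OF y(1), of 2] cong_pow[OF y(2), of 2] s t
      by (auto intro: cong_trans simp: cong_iff_dvd_diff[of "t\<^sup>2"] cong_iff_dvd_diff[of "s\<^sup>2"])
    then have "p * m dvd y\<^sup>2 - x" using cop by (auto simp: cong_iff_dvd_diff intro: divides_mult)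
    then show ?thesis by (auto simp: QuadRes_iff m)
  qed (auto simp: QuadRes_iff)
qed

text \<open>Side length for a pigeonhole box: \<open>k\<close> is at least the square root of
  \<open>n\<close>, so the box has enough points, yet differences of coordinates have squares
  strictly below \<open>n\<close>.\<close>

lemma ceiling_sqrt_nat:
  fixes n :: int
  assumes "n > 0"
  obtains k where "k > 0" "n \<le> k\<^sup>2" "\<And>x. \<bar>x\<bar> < k \<Longrightarrow> x\<^sup>2 < n"
proof -
  define j where "j = (LEAST j. n \<le> (int j)\<^sup>2)"
  have "n \<le> (int (nat n))\<^sup>2" using assms by (simp add: power2_eq_square)
  then have le: "n \<le> (int j)\<^sup>2" unfolding j_def by (rule LeastI)
  have "x\<^sup>2 < n" if "\<bar>x\<bar> < int j" for x
    using that not_less_Least[of "nat \<bar>x\<bar>" "\<lambda>j. n \<le> (int j)\<^sup>2"] by (simp add: j_def not_le)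
  moreover have "j > 0" using le assms by (cases j) auto
  ultimately show thesis using that[of "int j"] le by auto
qed

text \<open>
  The congruences cut out a lattice of index at most \<open>a * b * c\<close> on which the form is divisible by
  \<open>a * b * c\<close>. A short vector of this lattice makes the form \<open>0\<close> or \<open>a * b * c\<close>, and the latter
  value is turned into a zero by an identity expressing that \<open>a * b\<close> is a norm.
\<close>

lemma legendre_ternary:
  fixes a b c :: int
  assumes pos: "a > 0" "b > 0" "c > 0"
    and cop: "coprime a b" "coprime a c" "coprime b c"
    and res: "QuadRes a (b * c)" "QuadRes b (a * c)" "QuadRes c (- (a * b))"
  obtains x y z where "a * x\<^sup>2 + b * y\<^sup>2 = c * z\<^sup>2" "\<not> (x = 0 \<and> y = 0 \<and> z = 0)"
proof -
  obtain s1 where s1: "a dvd s1\<^sup>2 - b * c" using res by (auto simp: QuadRes_iff)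
  obtain s2 where s2: "b dvd s2\<^sup>2 - a * c" using res by (auto simp: QuadRes_iff)
  obtain s3 where s3: "c dvd s3\<^sup>2 + a * b" using res by (auto simp: QuadRes_iff)
  have "b * c > 0" "a * c > 0" "a * b > 0" using pos by simp_all
  then obtain K L M where K: "K > 0" "b * c \<le> K\<^sup>2" "\<And>x. \<bar>x\<bar> < K \<Longrightarrow> x\<^sup>2 < b * c"
    and L: "L > 0" "a * c \<le> L\<^sup>2" "\<And>x. \<bar>x\<bar> < L \<Longrightarrow> x\<^sup>2 < a * c"
    and M: "M > 0" "a * b \<le> M\<^sup>2" "\<And>x. \<bar>x\<bar> < M \<Longrightarrow> x\<^sup>2 < a * b"
    using ceiling_sqrt_nat by metis
  show thesis
  \<comment> \<open>Equality here could spoil the strict count \<open>a * b * c < K * L * M\<close>,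
    but then a zero is visible at once.\<close>
  proof (cases "L\<^sup>2 = a * c")
    case True
    show thesis
      by (rule that[of c 0 L]) (use True pos in \<open>simp_all add: power2_eq_square\<close>)
  next
    case False
    have "(a * b * c)\<^sup>2 = (b * c) * (a * c) * (a * b)" by (simp add: power2_eq_square)
    also have "\<dots> < K\<^sup>2 * L\<^sup>2 * M\<^sup>2"
    proof -
      have "(b * c) * (a * c) < K\<^sup>2 * L\<^sup>2"
        using K L False pos by (intro mult_le_less_imp_less) auto
      moreover have "0 \<le> b * c * (a * c)" "0 < a * b" using pos by simp_all
      ultimately show ?thesis using M(2) by (intro mult_less_le_imp_less[of "b * c * (a * c)"])
    qed
    also have "\<dots> = (K * L * M)\<^sup>2" by (simp add: power_mult_distrib)
    finally have big: "a * b * c < K * L * M"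
      by (rule power2_less_imp_less) (use K L M in simp)
    let ?S = "{0..<K} \<times> {0..<L} \<times> {0..<M}"
    let ?T = "{0..<a} \<times> {0..<b} \<times> {0..<c}"
    \<comment> \<open>Modulo \<open>a\<close>, the form times \<open>b\<close> is
      \<open>(b * y)\<^sup>2 - (s1 * z)\<^sup>2\<close>, and it is similar for the other two moduli.
      Each component of \<open>?f\<close> is a linear factor of such a difference of
      squares.\<close>
    let ?f = "\<lambda>(x, y, z). ((b * y - s1 * z) mod a, (a * x - s2 * z) mod b, (a * x - s3 * y) mod c)"
    have sub: "?f ` ?S \<subseteq> ?T" using pos by auto
    have "card ?T = nat (a * b * c)" using pos by (simp add: card_cartesian_product nat_mult_distrib)
    also have "\<dots> < nat (K * L * M)" using big pos K L M by (simp add: zless_nat_conj)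
    also have "\<dots> = card ?S" using K L M by (simp add: card_cartesian_product nat_mult_distrib)
    finally have "\<not> inj_on ?f ?S" using card_inj_on_le[of ?f ?S ?T] sub by auto
    then obtain u v where uv: "u \<in> ?S" "v \<in> ?S" "u \<noteq> v" "?f u = ?f v"
      unfolding inj_on_def by blast
    obtain x1 y1 z1 where u: "u = (x1, y1, z1)" by (cases u)
    obtain x2 y2 z2 where v: "v = (x2, y2, z2)" by (cases v)
    define x y z where "x = x1 - x2" and "y = y1 - y2" and "z = z1 - z2"
    have nz: "\<not> (x = 0 \<and> y = 0 \<and> z = 0)" using uv(3) by (simp add: u v x_def y_def z_def)
    have bounds: "\<bar>x\<bar> < K" "\<bar>y\<bar> < L" "\<bar>z\<bar> < M"
      using uv(1,2) by (simp_all add: u v x_def y_def z_def abs_less_iff)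
    have "(b * y1 - s1 * z1) mod a = (b * y2 - s1 * z2) mod a"
      and "(a * x1 - s2 * z1) mod b = (a * x2 - s2 * z2) mod b"
      and "(a * x1 - s3 * y1) mod c = (a * x2 - s3 * y2) mod c"
      using uv(4) by (simp_all add: u v)
    then have "a dvd (b * y1 - s1 * z1) - (b * y2 - s1 * z2)"
      and "b dvd (a * x1 - s2 * z1) - (a * x2 - s2 * z2)"
      and "c dvd (a * x1 - s3 * y1) - (a * x2 - s3 * y2)"
      by (simp_all only: mod_eq_dvd_iff)
    then have d1: "a dvd b * y - s1 * z" and d2: "b dvd a * x - s2 * z" and d3: "c dvd a * x - s3 * y"
      by (simp_all add: x_def y_def z_def algebra_simps)
    define Q where "Q = a * x\<^sup>2 + b * y\<^sup>2 - c * z\<^sup>2"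
    have "b * Q = (b * y - s1 * z) * (b * y + s1 * z) + (s1\<^sup>2 - b * c) * z\<^sup>2 + a * (b * x\<^sup>2)"
      by (simp add: Q_def power2_eq_square algebra_simps)
    then have "a dvd b * Q" using d1 s1 by simp
    then have aQ: "a dvd Q" using cop by (simp add: coprime_dvd_mult_right_iff)
    have "a * Q = (a * x - s2 * z) * (a * x + s2 * z) + (s2\<^sup>2 - a * c) * z\<^sup>2 + b * (a * y\<^sup>2)"
      by (simp add: Q_def power2_eq_square algebra_simps)
    then have "b dvd a * Q" using d2 s2 by simp
    then have bQ: "b dvd Q" using cop by (simp add: coprime_dvd_mult_right_iff coprime_commute)
    have "a * Q = (a * x - s3 * y) * (a * x + s3 * y) + (s3\<^sup>2 + a * b) * y\<^sup>2 - c * (a * z\<^sup>2)"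
      by (simp add: Q_def power2_eq_square algebra_simps)
    then have "c dvd a * Q" using d3 s3 by simp
    then have cQ: "c dvd Q" using cop by (simp add: coprime_dvd_mult_right_iff coprime_commute)
    have "a * b * c dvd Q" using aQ bQ cQ cop by (intro divides_mult) auto
    then obtain k where k: "Q = a * b * c * k" by (auto simp: dvd_def)
    have abc: "a * b * c > 0" using pos by simp
    have "a * x\<^sup>2 < a * b * c"
      using mult_strict_left_mono[OF K(3)[OF bounds(1)] pos(1)] by (simp only: mult.assoc)
    moreover have "b * y\<^sup>2 < a * b * c"
      using mult_strict_left_mono[OF L(3)[OF bounds(2)] pos(2)] by (simp only: mult.assoc mult.left_commute)
    moreover have "c * z\<^sup>2 < a * b * c"
      using mult_strict_left_mono[OF M(3)[OF bounds(3)] pos(3)] by (simp only: mult_ac)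
    moreover have "a * x\<^sup>2 \<ge> 0" "b * y\<^sup>2 \<ge> 0" "c * z\<^sup>2 \<ge> 0" using pos by simp_all
    ultimately have "- (a * b * c) < Q" "Q < 2 * (a * b * c)" unfolding Q_def by linarith+
    then have "(a * b * c) * (-1) < (a * b * c) * k" "(a * b * c) * k < (a * b * c) * 2"
      unfolding k by simp_all
    then have "-1 < k" "k < 2" using abc by (simp_all only: mult_less_cancel_left_pos)
    then consider "k = 0" | "k = 1" by linarith
    then show thesis
    proof cases
      case 1
      then show thesis using that[of x y z] nz k by (simp add: Q_def)
    next
      case 2
      then have e: "a * x\<^sup>2 + b * y\<^sup>2 = c * z\<^sup>2 + a * b * c" using k by (simp add: Q_def)
      let ?x = "c * (x * z + b * y)" and ?y = "c * (y * z - a * x)" and ?z = "c * z\<^sup>2 + a * b * c"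
      \<comment> \<open>Multiplicativity of the norm: with
        \<open>\<omega>\<^sup>2 = - (a * b)\<close>, multiply \<open>a * x + y * \<omega>\<close> by
        \<open>z - \<omega>\<close> and cancel \<open>a\<close>. By \<open>e\<close>, the value
        \<open>a * x\<^sup>2 + b * y\<^sup>2\<close> is itself \<open>c\<close> times the norm of
        \<open>z - \<omega>\<close>, whence the square on the right.\<close>
      have "a * (x * z + b * y)\<^sup>2 + b * (y * z - a * x)\<^sup>2 = (z\<^sup>2 + a * b) * (a * x\<^sup>2 + b * y\<^sup>2)"
        by (simp add: power2_eq_square algebra_simps)
      also have "\<dots> = c * (z\<^sup>2 + a * b)\<^sup>2"
        unfolding e by (simp add: power2_eq_square algebra_simps)
      finally have "a * (x * z + b * y)\<^sup>2 + b * (y * z - a * x)\<^sup>2 = c * (z\<^sup>2 + a * b)\<^sup>2" .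
      moreover have "z\<^sup>2 + a * b \<noteq> 0" using pos zero_le_power2[of z] by (smt (verit) mult_pos_pos)
      ultimately show thesis using that[of "x * z + b * y" "y * z - a * x" "z\<^sup>2 + a * b"] by auto
    qed
  qed
qed

section \<open>Real characters\<close>

definition real_char :: "nat \<Rightarrow> (nat \<Rightarrow> real) \<Rightarrow> bool" where
  "real_char N \<psi> \<longleftrightarrow> (\<forall>m n. \<psi> (m * n) = \<psi> m * \<psi> n) \<and> (\<forall>n. \<psi> (n + N) = \<psi> n) \<and>
     (\<forall>n. \<psi> n \<noteq> 0 \<longleftrightarrow> coprime n N) \<and> (\<forall>n. \<psi> n \<in> {-1, 0, 1})"

lemma abel_summation_bound:
  fixes c a :: "nat \<Rightarrow> real"
  assumes c: "\<And>n. \<bar>\<Sum>k<n. c k\<bar> \<le> B" and dec: "\<And>n. a (Suc n) \<le> a n" and nonneg: "\<And>n. a n \<ge> 0"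
  shows "\<bar>\<Sum>k<n. c k * a k\<bar> \<le> B * a 0"
proof -
  define S where "S = (\<lambda>n. \<Sum>k<n. c k)"
  have eq: "(\<Sum>k<n. c k * a k) = S n * a n + (\<Sum>k<n. S (Suc k) * (a k - a (Suc k)))"
    by (induction n) (simp_all add: S_def algebra_simps)
  have B: "B \<ge> 0" using c[of 0] by simp
  have "\<bar>\<Sum>k<n. S (Suc k) * (a k - a (Suc k))\<bar> \<le> (\<Sum>k<n. B * (a k - a (Suc k)))"
    by (rule order.trans[OF sum_abs], rule sum_mono)
       (use c dec B in \<open>auto simp: abs_mult S_def simp del: sum.lessThan_Suc intro!: mult_mono\<close>)
  also have "\<dots> = B * (a 0 - a n)"
    by (simp add: sum_distrib_left[symmetric] sum_lessThan_telescope')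
  finally have "\<bar>\<Sum>k<n. S (Suc k) * (a k - a (Suc k))\<bar> \<le> B * (a 0 - a n)" .
  moreover have "\<bar>S n * a n\<bar> \<le> B * a n"
    using c nonneg by (auto simp: abs_mult S_def intro!: mult_right_mono)
  ultimately have "\<bar>S n * a n + (\<Sum>k<n. S (Suc k) * (a k - a (Suc k)))\<bar> \<le> B * a n + B * (a 0 - a n)"
    by linarith
  then show ?thesis unfolding eq by (simp add: algebra_simps)
qed

text \<open>AM-GM for the exponents \<open>i + j\<close> and \<open>(n - 1 - i) + (n - j)\<close>, whose sum is \<open>2 * n - 1\<close>.\<close>

lemma geometric_sum_product_bound:
  fixes z :: real
  assumes z: "0 \<le> z" "z \<le> 1"
  shows "real n * real (Suc n) * z ^ n \<le> (\<Sum>i<n. z ^ i) * (\<Sum>j<Suc n. z ^ j)"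
proof -
  have pair: "2 * z ^ n \<le> z ^ u + z ^ v" if uv: "u + v + 1 = 2 * n" for u v
  proof -
    have aux: "2 * z ^ n \<le> z ^ u + z ^ v" if uv: "u + v + 1 = 2 * n" "u < n" for u v
    proof -
      obtain d where d: "n = Suc u + d" using uv(2) by (metis less_iff_Suc_add add_Suc)
      then have v: "v = n + d" using uv(1) by simp
      \<comment> \<open>\<open>n\<close> is not halfway between \<open>u\<close> and
        \<open>v\<close>, whose sum is odd, but it is halfway between \<open>u + 1\<close> and
        \<open>v\<close>. Replacing \<open>z ^ u\<close> by the smaller \<open>z ^ (u + 1)\<close>
        leaves a perfect square.\<close>
      have "0 \<le> z ^ Suc u * (1 - z ^ d)\<^sup>2" using z by simp
      also have "\<dots> = z ^ Suc u + z ^ v - 2 * z ^ n"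
        by (simp add: v d power2_eq_square power_add algebra_simps)
      also have "z ^ Suc u \<le> z ^ u" using z by (intro power_decreasing) auto
      finally show ?thesis by simp
    qed
    show ?thesis using aux[of u v] aux[of v u] uv by (cases "u < n") auto
  qed
  let ?A = "\<Sum>i<n. z ^ i" and ?B = "\<Sum>j<Suc n. z ^ j"
  have A: "?A = (\<Sum>i<n. z ^ (n - Suc i))" by (rule sum.nat_diff_reindex[symmetric])
  have B: "?B = (\<Sum>j<Suc n. z ^ (n - j))" using sum.nat_diff_reindex[of "\<lambda>j. z ^ j" "Suc n"] by simp
  have "2 * (?A * ?B) = ?A * ?B + (\<Sum>i<n. z ^ (n - Suc i)) * (\<Sum>j<Suc n. z ^ (n - j))"
    using A B by simp
  also have "\<dots> = (\<Sum>i<n. \<Sum>j<Suc n. z ^ (i + j) + z ^ (n - Suc i + (n - j)))"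
    by (simp only: sum_product sum.distrib power_add)
  also have "\<dots> \<ge> (\<Sum>i<n. \<Sum>j<Suc n. 2 * z ^ n)"
    by (intro sum_mono pair) auto
  also have "(\<Sum>i<n. \<Sum>j<Suc n. 2 * z ^ n) = 2 * (real n * real (Suc n) * z ^ n)" by simp
  finally show ?thesis by simp
qed

context
  fixes N :: nat and \<psi> :: "nat \<Rightarrow> real"
  assumes char: "real_char N \<psi>" and N: "N > 0"
begin

section \<open>Divisor sums of a real character\<close>

lemma char_mult: "\<psi> (m * n) = \<psi> m * \<psi> n"
  and char_period: "\<psi> (n + N) = \<psi> n"
  and char_nonzero: "\<psi> n \<noteq> 0 \<longleftrightarrow> coprime n N"
  and char_values: "\<psi> n = -1 \<or> \<psi> n = 0 \<or> \<psi> n = 1"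
  using char by (auto simp: real_char_def)

lemma char_1: "\<psi> (Suc 0) = 1"
  using char_mult[of 1 1] char_nonzero[of 1] by simp

lemma char_abs_le_1: "\<bar>\<psi> n\<bar> \<le> 1"
  using char_values[of n] by auto

lemma char_add_mult: "\<psi> (n + k * N) = \<psi> n"
proof (induction k)
  case (Suc k)
  then show ?case using char_period[of "n + k * N"] by (simp add: algebra_simps)
qed simp

lemma char_mod: "\<psi> (n mod N) = \<psi> n"
  using char_add_mult[of "n mod N" "n div N"] by simp

lemma char_power: "\<psi> (m ^ k) = \<psi> m ^ k"
  by (induction k) (simp_all add: char_mult char_1)

text \<open>The Dirichlet coefficients of the zeta function times the L-series of
  \<open>\<psi>\<close>.\<close>

definition divisor_sum :: "nat \<Rightarrow> real" where
  "divisor_sum m = (\<Sum>d | d dvd m. \<psi> d)"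

lemma divisor_sum_prime_power_mult:
  assumes p: "prime p" and m: "\<not> p dvd m" "m > 0"
  shows "divisor_sum (p ^ k * m) = (\<Sum>i\<le>k. \<psi> p ^ i) * divisor_sum m"
proof -
  have cop: "coprime (p ^ i) d" if "d dvd m" for i d
    using p m that by (meson coprime_power_left_iff dvd_trans prime_imp_coprime)
  have inj: "inj_on (\<lambda>(i, d). p ^ i * d) ({..k} \<times> {d. d dvd m})"
  proof (rule inj_onI, clarify)
    fix i d j e assume a: "d dvd m" "e dvd m" "p ^ i * d = p ^ j * e"
    have nd: "\<not> p dvd d" "\<not> p dvd e" using a m by (meson dvd_trans)+
    have "d \<noteq> 0" "e \<noteq> 0" using a m by auto
    then have "multiplicity p (p ^ i * d) = i" "multiplicity p (p ^ j * e) = j"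
      using p nd by (simp_all add: prime_elem_multiplicity_mult_distrib not_dvd_imp_multiplicity_0)
    then have "i = j" using a by simp
    then show "i = j \<and> d = e" using a prime_gt_0_nat[OF p] by simp
  qed
  have img: "(\<lambda>(i, d). p ^ i * d) ` ({..k} \<times> {d. d dvd m}) = {d. d dvd p ^ k * m}"
  proof (intro equalityI subsetI)
    fix e assume "e \<in> {d. d dvd p ^ k * m}"
    then obtain u v where uv: "e = u * v" "u dvd p ^ k" "v dvd m" using division_decomp by blast
    then obtain i where "i \<le> k" "u = p ^ i" using p divides_primepow_nat by blast
    then show "e \<in> (\<lambda>(i, d). p ^ i * d) ` ({..k} \<times> {d. d dvd m})" using uv by auto
  qed (auto intro!: mult_dvd_mono le_imp_power_dvd)
  have "divisor_sum (p ^ k * m) = (\<Sum>(i, d)\<in>{..k} \<times> {d. d dvd m}. \<psi> (p ^ i * d))"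
    unfolding divisor_sum_def img[symmetric] using sum.reindex[OF inj, of \<psi>]
    by (simp add: o_def case_prod_unfold)
  also have "\<dots> = (\<Sum>i\<le>k. \<Sum>d | d dvd m. \<psi> p ^ i * \<psi> d)"
    by (simp add: sum.cartesian_product char_mult char_power case_prod_unfold)
  also have "\<dots> = (\<Sum>i\<le>k. \<psi> p ^ i) * divisor_sum m"
    by (simp add: divisor_sum_def sum_product)
  finally show ?thesis .
qed

lemma char_geometric_sum: "(\<Sum>i\<le>k. \<psi> p ^ i) \<ge> (if even k then 1 else 0)"
proof -
  consider "\<psi> p = -1" | "\<psi> p = 0" | "\<psi> p = 1" using char_values[of p] by blast
  then show ?thesis
  proof cases
    case 1
    have "(\<Sum>i\<le>k. (-1::real) ^ i) = (if even k then 1 else 0)" by (induction k) auto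
    then show ?thesis using 1 by simp
  next
    case 2
    have "(\<Sum>i\<le>k. (0::real) ^ i) = 1" by (induction k) auto
    then show ?thesis using 2 by simp
  qed auto
qed

text \<open>Split off one prime power at a time: the factor
  \<open>1 + \<psi> p + ... + \<psi> p ^ k\<close> is never negative, and it is at least 1 for even
  \<open>k\<close>. A square has only even exponents.\<close>

lemma divisor_sum_nonneg_square:
  "m > 0 \<Longrightarrow> divisor_sum m \<ge> 0 \<and> ((\<exists>k. m = k\<^sup>2) \<longrightarrow> divisor_sum m \<ge> 1)"
proof (induction m rule: less_induct)
  case (less m)
  show ?case
  proof (cases "m = 1")
    case True
    have "{d. d dvd (1::nat)} = {1}" by auto
    then show ?thesis using True by (simp add: divisor_sum_def char_1)
  next
    case False
    then obtain p where p: "prime p" "p dvd m" using prime_factor_nat by blast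
    obtain n where n: "m = p ^ multiplicity p m * n" "\<not> p dvd n"
      using multiplicity_decompose'[of m p] less.prems p not_prime_unit by blast
    define k where "k = multiplicity p m"
    have k: "k > 0" using p less.prems by (simp add: k_def prime_multiplicity_gt_zero_iff)
    have n0: "n > 0" using n less.prems by (cases n) auto
    have "p ^ k > 1" using k prime_gt_1_nat[OF p(1)] one_less_power[of p k] by simp
    then have "n < m" using n n0 by (simp add: k_def[symmetric])
    note IH = less.IH[OF this n0]
    have eq: "divisor_sum m = (\<Sum>i\<le>k. \<psi> p ^ i) * divisor_sum n"
      using divisor_sum_prime_power_mult[OF p(1) n(2) n0, of k] n by (simp add: k_def)
    have g0: "(\<Sum>i\<le>k. \<psi> p ^ i) \<ge> 0" using char_geometric_sum[where k = k and p = p] by (auto split: if_splits)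
    have "divisor_sum m \<ge> 1" if sq: "m = j\<^sup>2" for j
    proof -
      have j: "j > 0" using sq less.prems by (cases j) auto
      then obtain i where i: "j = p ^ multiplicity p j * i" "\<not> p dvd i"
        using multiplicity_decompose'[of j p] p not_prime_unit by blast
      have k2: "k = 2 * multiplicity p j"
        using p j sq by (simp add: k_def prime_elem_multiplicity_power_distrib)
      have "p ^ k * n = (p ^ multiplicity p j * i)\<^sup>2" using n sq i by (simp add: k_def)
      then have "p ^ k * n = p ^ k * i\<^sup>2" by (simp add: k2 power_mult_distrib power_mult[symmetric] mult.commute)
      then have "n = i\<^sup>2" using prime_gt_0_nat[OF p(1)] by simp
      then have "divisor_sum n \<ge> 1" using IH by blast
      moreover have "(\<Sum>i\<le>k. \<psi> p ^ i) \<ge> 1" using char_geometric_sum[where k = k and p = p] k2 by simp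
      ultimately show ?thesis unfolding eq
        using mult_mono[of 1 "\<Sum>i\<le>k. \<psi> p ^ i" 1 "divisor_sum n"] by simp
    qed
    moreover have "divisor_sum m \<ge> 0" unfolding eq using IH g0 by (intro mult_nonneg_nonneg) auto
    ultimately show ?thesis by blast
  qed
qed

text \<open>A Lambert series regrouped by the product \<open>m = n * k\<close>. The cutoff
  \<open>n * k \<le> x\<close> keeps every sum finite, so no infinite sums are interchanged.\<close>

lemma sum_multiples_eq_divisor_sum:
  fixes z :: real
  shows "(\<Sum>n\<in>{1..x}. \<Sum>k\<in>{1..x div n}. \<psi> n * z ^ (n * k)) = (\<Sum>m\<in>{1..x}. divisor_sum m * z ^ m)"
proof -
  have "(\<Sum>n\<in>{1..x}. \<Sum>k\<in>{1..x div n}. \<psi> n * z ^ (n * k)) =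
      (\<Sum>(n, k)\<in>(SIGMA n:{1..x}. {1..x div n}). \<psi> n * z ^ (n * k))"
    by (subst sum.Sigma) auto
  also have "\<dots> = (\<Sum>(m, d)\<in>(SIGMA m:{1..x}. {d. d dvd m}). \<psi> d * z ^ m)"
  proof (rule sum.reindex_bij_witness[of _ "\<lambda>(m, d). (d, m div d)" "\<lambda>(n, k). (n * k, n)"])
    fix u assume "u \<in> (SIGMA n:{1..x}. {1..x div n})"
    then obtain n k where u: "u = (n, k)" "1 \<le> n" "1 \<le> k" "k \<le> x div n" by auto
    have "n * k \<le> n * (x div n)" using u by simp
    also have "\<dots> \<le> x" by simp
    finally have le: "n * k \<le> x" .
    have "1 \<le> n * k" using u by simp
    then show "(case u of (n, k) \<Rightarrow> (n * k, n)) \<in> (SIGMA m:{1..x}. {d. d dvd m})" using u le by simp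
    show "(case (case u of (n, k) \<Rightarrow> (n * k, n)) of (m, d) \<Rightarrow> (d, m div d)) = u" using u by simp
    show "(case (case u of (n, k) \<Rightarrow> (n * k, n)) of (m, d) \<Rightarrow> \<psi> d * z ^ m) = (case u of (n, k) \<Rightarrow> \<psi> n * z ^ (n * k))"
      using u by simp
  next
    fix v assume "v \<in> (SIGMA m:{1..x}. {d. d dvd m})"
    then obtain d k where v: "v = (d * k, d)" "1 \<le> d * k" "d * k \<le> x" by (auto simp: dvd_def)
    have dk: "1 \<le> d" "1 \<le> k" using v(2) by (cases d; cases k; simp)+
    have "d * 1 \<le> d * k" using dk by (intro mult_le_mono2) simp
    also have "\<dots> \<le> x" by (rule v(3))
    finally have "d \<le> x" by simp
    moreover have "k \<le> x div d" using div_le_mono[OF v(3), of d] dk by simp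
    ultimately show "(case v of (m, d) \<Rightarrow> (d, m div d)) \<in> (SIGMA n:{1..x}. {1..x div n})" using v dk by simp
    show "(case (case v of (m, d) \<Rightarrow> (d, m div d)) of (n, k) \<Rightarrow> (n * k, n)) = v" using v dk by simp
  qed
  also have "\<dots> = (\<Sum>m\<in>{1..x}. \<Sum>d | d dvd m. \<psi> d * z ^ m)"
    by (subst sum.Sigma) auto
  finally show ?thesis by (simp add: divisor_sum_def sum_distrib_right)
qed

end

section \<open>The L-series of a nonprincipal real character at 1\<close>

context
  fixes N :: nat and \<psi> :: "nat \<Rightarrow> real" and u :: nat
  assumes char: "real_char N \<psi>" and N: "N > 0" and u: "\<psi> u = -1"
begin

text \<open>Multiplication by \<open>u\<close> permutes the residues modulo \<open>N\<close> and
  changes the sign of every value.\<close>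

lemma char_sum_period: "(\<Sum>n<N. \<psi> n) = 0"
proof -
  have cop: "coprime u N" using u char_nonzero[OF char N, of u] by simp
  have "inj_on (\<lambda>n. u * n mod N) {..<N}"
  proof (rule inj_onI)
    fix x y assume xy: "x \<in> {..<N}" "y \<in> {..<N}" "u * x mod N = u * y mod N"
    then have "[u * x = u * y] (mod N)" by (simp only: Cong.cong_def)
    then have "[x = y] (mod N)" using cop by (simp add: cong_mult_lcancel_nat)
    then show "x = y" using xy unfolding Cong.cong_def by simp
  qed
  moreover have "(\<lambda>n. u * n mod N) ` {..<N} \<subseteq> {..<N}" using N by auto
  ultimately have bij: "bij_betw (\<lambda>n. u * n mod N) {..<N} {..<N}"
    by (simp add: bij_betw_def endo_inj_surj)
  have "(\<Sum>n<N. \<psi> n) = (\<Sum>n<N. \<psi> (u * n mod N))" using sum.reindex_bij_betw[OF bij, of \<psi>] by simp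
  also have "\<dots> = (\<Sum>n<N. - \<psi> n)" by (simp add: char_mod[OF char N] char_mult[OF char N] u)
  finally show ?thesis by (simp add: sum_negf)
qed

lemma char_partial_sum: "\<bar>\<Sum>n<M. \<psi> n\<bar> \<le> real N"
proof (induction M rule: less_induct)
  case (less M)
  show ?case
  proof (cases "M < N")
    case True
    have "\<bar>\<Sum>n<M. \<psi> n\<bar> \<le> (\<Sum>n<M. 1)"
      by (rule order.trans[OF sum_abs], rule sum_mono) (rule char_abs_le_1[OF char N])
    then show ?thesis using True by simp
  next
    case False
    then obtain j where j: "M = N + j" by (metis le_Suc_ex not_less)
    have "(\<Sum>n<N + i. \<psi> n) = (\<Sum>n<N. \<psi> n) + (\<Sum>n<i. \<psi> (n + N))" for i
      by (induction i) (simp_all add: add.commute)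
    then have "(\<Sum>n<M. \<psi> n) = (\<Sum>n<N. \<psi> n) + (\<Sum>n<j. \<psi> (n + N))" by (simp only: j)
    also have "\<dots> = (\<Sum>n<j. \<psi> n)" by (simp add: char_sum_period char_period[OF char N])
    finally show ?thesis using less[of j] j N by simp
  qed
qed

lemma char_interval_sum: "\<bar>\<Sum>k<n. \<psi> (m + k)\<bar> \<le> 2 * real N"
proof -
  have "(\<Sum>k<m + n. \<psi> k) = (\<Sum>k<m. \<psi> k) + (\<Sum>k<n. \<psi> (m + k))"
    by (induction n) simp_all
  then show ?thesis using char_partial_sum[of "m + n"] char_partial_sum[of m] by linarith
qed

lemma char_weighted_sum:
  fixes a :: "nat \<Rightarrow> real"
  assumes "\<And>n. a (Suc n) \<le> a n" "\<And>n. a n \<ge> 0"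
  shows "\<bar>\<Sum>k<n. \<psi> (m + k) * a k\<bar> \<le> 2 * real N * a 0"
  by (rule abel_summation_bound[where c = "\<lambda>k. \<psi> (m + k)"]) (use assms char_interval_sum in auto)

text \<open>The bound does not depend on \<open>s\<close>. This uniformity later carries the
  nonvanishing at 1 to a neighbourhood on the right of 1.\<close>

lemma dirichlet_tail:
  assumes "s \<ge> 1"
  shows "\<bar>\<Sum>k<n. \<psi> (Suc (m + k)) * real (Suc (m + k)) powr (- s)\<bar> \<le> 2 * real N / real (Suc m)"
proof -
  have "\<bar>\<Sum>k<n. \<psi> (Suc m + k) * real (Suc (m + k)) powr (- s)\<bar> \<le> 2 * real N * real (Suc (m + 0)) powr (- s)"
    by (rule char_weighted_sum) (use assms in \<open>auto intro!: powr_mono2'\<close>)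
  also have "\<dots> \<le> 2 * real N * (real (Suc m) powr (- 1))"
  proof (rule mult_left_mono)
    show "real (Suc (m + 0)) powr (- s) \<le> real (Suc m) powr (- 1)"
      unfolding add_0_right by (rule powr_mono) (use assms in auto)
  qed simp
  also have "\<dots> = 2 * real N / real (Suc m)"
    by (simp add: powr_minus divide_inverse)
  finally show ?thesis by simp
qed

lemma dirichlet_summable:
  assumes "s \<ge> 1"
  shows "summable (\<lambda>n. \<psi> (Suc n) * real (Suc n) powr (- s))" (is "summable ?f")
  unfolding summable_Cauchy
proof (intro allI impI)
  fix e :: real assume e: "e > 0"
  obtain M where M: "2 * real N / e < real M" using reals_Archimedean2 by blast
  show "\<exists>N. \<forall>m\<ge>N. \<forall>n. norm (sum ?f {m..<n}) < e"
  proof (intro exI[of _ M] allI impI)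
    fix m n assume "m \<ge> M"
    have "2 * real N < e * real M" using M e by (simp add: field_simps)
    also have "\<dots> \<le> e * real (Suc m)" using \<open>m \<ge> M\<close> e by (intro mult_left_mono) auto
    finally have "2 * real N / real (Suc m) < e" by (simp add: field_simps)
    moreover have "sum ?f {m..<n} = (\<Sum>k<n - m. ?f (m + k))"
      by (simp only: sum.atLeastLessThan_shift_0[of ?f m n] atLeast0LessThan o_def)
    ultimately show "norm (sum ?f {m..<n}) < e"
      using dirichlet_tail[OF assms, of m "n - m"] by simp
  qed
qed

lemma dirichlet_tail_suminf:
  assumes "s \<ge> 1"
  shows "\<bar>(\<Sum>n. \<psi> (Suc n) * real (Suc n) powr (- s)) - (\<Sum>n<m. \<psi> (Suc n) * real (Suc n) powr (- s))\<bar>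
    \<le> 2 * real N / real (Suc m)"
proof -
  let ?f = "\<lambda>n. \<psi> (Suc n) * real (Suc n) powr (- s)"
  have "summable (\<lambda>k. ?f (m + k))"
    using iffD2[OF summable_iff_shift[of ?f m] dirichlet_summable[OF assms]] by (simp only: add.commute[of m])
  then have "(\<lambda>n. \<Sum>k<n. ?f (m + k)) \<longlonglongrightarrow> (\<Sum>k. ?f (m + k))" by (rule summable_LIMSEQ)
  then have "(\<lambda>n. \<bar>\<Sum>k<n. ?f (m + k)\<bar>) \<longlonglongrightarrow> \<bar>\<Sum>k. ?f (m + k)\<bar>" by (rule tendsto_rabs)
  then have "\<bar>\<Sum>k. ?f (m + k)\<bar> \<le> 2 * real N / real (Suc m)"
    by (rule LIMSEQ_le_const2) (use dirichlet_tail[OF assms] in auto)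
  moreover have "(\<Sum>k. ?f (m + k)) = suminf ?f - (\<Sum>n<m. ?f n)"
    using suminf_minus_initial_segment[OF dirichlet_summable[OF assms], of m] by (simp only: add.commute[of m])
  ultimately show ?thesis by simp
qed

text \<open>
  Monsky's argument for the nonvanishing of \<open>L(1)\<close>: the Lambert series of \<open>\<psi> n * z ^ n / (1 - z ^ n)\<close> has
  the divisor sums as coefficients, hence is at least the sum of the \<open>z ^ (k\<^sup>2)\<close>. If \<open>L(1) = 0\<close>, subtracting
  \<open>L(1) / (1 - z)\<close> turns it into a sum of \<open>\<psi> n\<close> against the decreasing sequence \<open>b n\<close>, which is bounded.
\<close>

lemma square_powers_bounded:
  fixes z :: real
  assumes z: "0 < z" "z < 1" and L: "(\<Sum>n. \<psi> (Suc n) * real (Suc n) powr (- 1)) = 0"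
  shows "(\<Sum>k\<in>{1..M}. z ^ (k\<^sup>2)) \<le> 2 * real N"
proof -
  define b where "b = (\<lambda>n. 1 / (real n * (1 - z)) - z ^ n / (1 - z ^ n))"
  have zn: "z ^ n < 1" if "n > 0" for n using z that by (simp add: power_less_one_iff)
  have geom: "(1 - z) * (\<Sum>i<n. z ^ i) = 1 - z ^ n" for n by (simp add: one_diff_power_eq)
  have S_pos: "(\<Sum>i<n. z ^ i) > 0" if "n > 0" for n using z that by (intro sum_pos) auto
  have frac: "z ^ n / (1 - z ^ n) = z ^ n / ((1 - z) * (\<Sum>i<n. z ^ i))" for n by (simp add: geom)
  have b_nonneg: "b (Suc n) \<ge> 0" for n
  proof -
    have "real (Suc n) * z ^ Suc n = (\<Sum>i<Suc n. z ^ Suc n)" by simp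
    also have "\<dots> \<le> (\<Sum>i<Suc n. z ^ i)" using z by (intro sum_mono power_decreasing) auto
    finally have le: "real (Suc n) * z ^ Suc n \<le> (\<Sum>i<Suc n. z ^ i)" .
    have "z ^ Suc n / ((1 - z) * (\<Sum>i<Suc n. z ^ i)) \<le> 1 / (real (Suc n) * (1 - z))"
    proof (rule iffD2[OF frac_le_eq])
      show "(1 - z) * (\<Sum>i<Suc n. z ^ i) \<noteq> 0" using S_pos[of "Suc n"] z by simp
      show "real (Suc n) * (1 - z) \<noteq> 0" using z by simp
      have "(z ^ Suc n * (real (Suc n) * (1 - z)) - 1 * ((1 - z) * (\<Sum>i<Suc n. z ^ i))) =
        (1 - z) * (real (Suc n) * z ^ Suc n - (\<Sum>i<Suc n. z ^ i))" by (simp only: algebra_simps)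
      also have "\<dots> \<le> 0" using le z by (intro mult_nonneg_nonpos) auto
      finally show "(z ^ Suc n * (real (Suc n) * (1 - z)) - 1 * ((1 - z) * (\<Sum>i<Suc n. z ^ i))) /
         ((1 - z) * (\<Sum>i<Suc n. z ^ i) * (real (Suc n) * (1 - z))) \<le> 0"
        using S_pos[of "Suc n"] z by (intro divide_nonpos_nonneg mult_nonneg_nonneg) auto
    qed
    then show ?thesis by (simp only: b_def frac diff_ge_0_iff_ge)
  qed
  \<comment> \<open>Write \<open>S n = 1 + ... + z ^ (n - 1)\<close>. With the factor
    \<open>1 / (1 - z)\<close> removed, the claim at an index \<open>n \<ge> 1\<close> is
    \<open>n * (n + 1) * z ^ n \<le> S n * S (n + 1)\<close>, which is
    \<open>geometric_sum_product_bound\<close>.\<close>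
  have b_dec: "b (Suc (Suc n)) \<le> b (Suc n)" for n
  proof -
    let ?n = "real (Suc n)" and ?m = "real (Suc (Suc n))"
    let ?S = "\<Sum>i<Suc n. z ^ i" and ?T = "\<Sum>i<Suc (Suc n). z ^ i"
    have pos: "?S > 0" "?T > 0" "?n > 0" "?m > 0" "1 - z > 0"
      using S_pos[of "Suc n"] S_pos[of "Suc (Suc n)"] z by (simp_all del: sum.lessThan_Suc)
    have T: "?T = ?S + z ^ Suc n" and nm: "?m = ?n + 1" by simp_all
    have key: "?n * ?m * z ^ Suc n \<le> ?S * ?T" using geometric_sum_product_bound[of z "Suc n"] z by simp
    have "z ^ Suc n / (?S * ?T) \<le> 1 / (?n * ?m)"
      using key pos by (simp add: divide_le_eq pos_le_divide_eq del: sum.lessThan_Suc of_nat_Suc power_Suc) (simp add: mult_ac)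
    moreover have "1 / ?n - 1 / ?m = 1 / (?n * ?m)" using pos unfolding nm by (simp add: field_simps)
    moreover have "z ^ Suc n / ?S - z ^ Suc (Suc n) / ?T = z ^ Suc n / (?S * ?T)"
    proof -
      have g: "?S * z = ?T - 1" using geom[of "Suc n"] unfolding T by (simp add: algebra_simps del: sum.lessThan_Suc)
      have "z ^ Suc n * ?T - z ^ Suc (Suc n) * ?S = z ^ Suc n * (?T - ?S * z)" by (simp add: algebra_simps del: sum.lessThan_Suc)
      also have "\<dots> = z ^ Suc n" unfolding g by simp
      finally have "z ^ Suc n * ?T - z ^ Suc (Suc n) * ?S = z ^ Suc n" .
      then show ?thesis using pos by (subst diff_frac_eq) (simp_all del: sum.lessThan_Suc power_Suc add: mult.commute)
    qed
    ultimately have "z ^ Suc n / ?S - z ^ Suc (Suc n) / ?T \<le> 1 / ?n - 1 / ?m" by simp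
    then have "(z ^ Suc n / ?S - z ^ Suc (Suc n) / ?T) / (1 - z) \<le> (1 / ?n - 1 / ?m) / (1 - z)"
      using pos by (intro divide_right_mono) auto
    then show ?thesis unfolding b_def frac
      by (simp only: diff_divide_distrib divide_divide_eq_left mult.commute)
  qed
  define T where "T = (\<lambda>x. \<Sum>n<x. \<psi> (Suc n) * real (Suc n) powr (- 1))"
  define E where "E = (\<lambda>x. \<Sum>m\<in>{1..x}. divisor_sum \<psi> m * z ^ m)"
  have "T \<longlonglongrightarrow> 0"
    using summable_LIMSEQ[OF dirichlet_summable[of 1]] L by (simp add: T_def)
  \<comment> \<open>Three contributions: \<open>T x\<close> tends to the vanishing value at 1; the
    sum against the decreasing \<open>b\<close> is at most \<open>2 * real N\<close>; stopping the
    geometric series at \<open>x div n\<close> costs at most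
    \<open>real x * z ^ x / (1 - z)\<close>, which tends to 0 as \<open>x\<close> grows.\<close>
  have E_le: "E x \<le> \<bar>T x\<bar> / (1 - z) + 2 * real N + real x * z ^ x / (1 - z)" for x
  proof -
    have "E x = (\<Sum>n\<in>{1..x}. \<psi> n * (\<Sum>k\<in>{1..x div n}. (z ^ n) ^ k))"
      unfolding E_def sum_multiples_eq_divisor_sum[OF char N, symmetric]
      by (simp add: sum_distrib_left power_mult)
    also have "\<dots> = (\<Sum>n\<in>{1..x}. \<psi> n * (z ^ n / (1 - z ^ n)) - \<psi> n * (z ^ (n * Suc (x div n)) / (1 - z ^ n)))"
    proof (rule sum.cong[OF refl])
      fix n assume n: "n \<in> {1..x}"
      have "(\<Sum>k\<in>{1..K}. w ^ k) = w / (1 - w) - w ^ Suc K / (1 - w)" if "w < 1" for w :: real and K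
      proof -
        have "(1 - w) * (\<Sum>k\<in>{1..K}. w ^ k) = w - w ^ Suc K"
        proof (induction K)
          case (Suc K)
          have "(1 - w) * (\<Sum>k\<in>{1..Suc K}. w ^ k) = (1 - w) * (\<Sum>k\<in>{1..K}. w ^ k) + (1 - w) * w ^ Suc K"
            by (simp add: distrib_left)
          then show ?case unfolding Suc by (simp add: left_diff_distrib)
        qed simp
        then have "(\<Sum>k\<in>{1..K}. w ^ k) = (w - w ^ Suc K) / (1 - w)"
          using that by (simp add: nonzero_eq_divide_eq mult.commute)
        then show ?thesis by (simp only: diff_divide_distrib)
      qed
      from this[of "z ^ n" "x div n"] zn[of n] n
      show "\<psi> n * (\<Sum>k\<in>{1..x div n}. (z ^ n) ^ k) =
          \<psi> n * (z ^ n / (1 - z ^ n)) - \<psi> n * (z ^ (n * Suc (x div n)) / (1 - z ^ n))"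
        by (simp add: power_mult power_add right_diff_distrib)
    qed
    also have "\<dots> = (\<Sum>n\<in>{1..x}. \<psi> n * (z ^ n / (1 - z ^ n))) - (\<Sum>n\<in>{1..x}. \<psi> n * (z ^ (n * Suc (x div n)) / (1 - z ^ n)))"
      by (rule sum_subtractf)
    also have "\<dots> \<le> (\<Sum>n\<in>{1..x}. \<psi> n * (z ^ n / (1 - z ^ n))) + real x * z ^ x / (1 - z)"
    proof -
      have "\<bar>\<Sum>n\<in>{1..x}. \<psi> n * (z ^ (n * Suc (x div n)) / (1 - z ^ n))\<bar> \<le> (\<Sum>n\<in>{1..x}. z ^ x / (1 - z))"
      proof (rule order.trans[OF sum_abs], rule sum_mono)
        fix n assume n: "n \<in> {1..x}"
        have "n * (x div n) + x mod n = x" by simp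
        moreover have "x mod n < n" using n by simp
        ultimately have "x \<le> n * Suc (x div n)" unfolding mult_Suc_right by linarith
        then have "z ^ (n * Suc (x div n)) \<le> z ^ x" using z by (intro power_decreasing) auto
        moreover have "z ^ n \<le> z ^ 1" using z n by (intro power_decreasing) auto
        ultimately have "z ^ (n * Suc (x div n)) / (1 - z ^ n) \<le> z ^ x / (1 - z)"
          using z by (intro frac_le) auto
        moreover have "z ^ (n * Suc (x div n)) / (1 - z ^ n) \<ge> 0" using z zn[of n] n by simp
        moreover have "\<bar>\<psi> n * (z ^ (n * Suc (x div n)) / (1 - z ^ n))\<bar> =
            \<bar>\<psi> n\<bar> * (z ^ (n * Suc (x div n)) / (1 - z ^ n))"
          using calculation(2) by (simp only: abs_mult abs_of_nonneg)
        moreover have "\<bar>\<psi> n\<bar> * (z ^ (n * Suc (x div n)) / (1 - z ^ n)) \<le> 1 * (z ^ (n * Suc (x div n)) / (1 - z ^ n))"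
          using calculation(2) char_abs_le_1[OF char N, of n] by (intro mult_right_mono) auto
        ultimately show "\<bar>\<psi> n * (z ^ (n * Suc (x div n)) / (1 - z ^ n))\<bar> \<le> z ^ x / (1 - z)" by linarith
      qed
      then show ?thesis by simp
    qed
    also have "(\<Sum>n\<in>{1..x}. \<psi> n * (z ^ n / (1 - z ^ n))) = (\<Sum>n<x. \<psi> (Suc n) * (z ^ Suc n / (1 - z ^ Suc n)))"
      by (simp only: One_nat_def sum.atLeast1_atMost_eq)
    also have "\<dots> = T x / (1 - z) - (\<Sum>n<x. \<psi> (1 + n) * b (Suc n))"
      unfolding T_def b_def sum_divide_distrib sum_subtractf[symmetric]
      by (rule sum.cong) (simp_all add: powr_minus field_simps del: power_Suc)
    also have "\<dots> \<le> \<bar>T x\<bar> / (1 - z) + 2 * real N"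
    proof -
      have "\<bar>\<Sum>n<x. \<psi> (1 + n) * b (Suc n)\<bar> \<le> 2 * real N * b (Suc 0)"
        by (rule char_weighted_sum) (rule b_dec b_nonneg)+
      \<comment> \<open>This value makes the resulting bound independent of \<open>z\<close>, so
        that \<open>z\<close> may tend to 1 afterwards.\<close>
      moreover have "b (Suc 0) = 1" using z by (simp add: b_def diff_divide_distrib[symmetric])
      moreover have "T x / (1 - z) \<le> \<bar>T x\<bar> / (1 - z)" using z by (intro divide_right_mono) auto
      ultimately show ?thesis by simp
    qed
    finally show ?thesis by simp
  qed
  have E_ge: "(\<Sum>k\<in>{1..M}. z ^ (k\<^sup>2)) \<le> E x" if x: "M\<^sup>2 \<le> x" for x
  proof -
    have inj: "inj_on (\<lambda>k::nat. k\<^sup>2) {1..M}" by (auto simp: inj_on_def)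
    have "(\<Sum>k\<in>{1..M}. z ^ (k\<^sup>2)) = (\<Sum>m\<in>(\<lambda>k. k\<^sup>2) ` {1..M}. z ^ m)" by (simp only: sum.reindex[OF inj] o_def)
    also have "\<dots> \<le> (\<Sum>m\<in>(\<lambda>k. k\<^sup>2) ` {1..M}. divisor_sum \<psi> m * z ^ m)"
    proof (rule sum_mono)
      fix m assume "m \<in> (\<lambda>k. k\<^sup>2) ` {1..M}"
      then have "divisor_sum \<psi> m \<ge> 1" using divisor_sum_nonneg_square[OF char N, of m] by auto
      then show "z ^ m \<le> divisor_sum \<psi> m * z ^ m" using z mult_right_mono[of 1 "divisor_sum \<psi> m" "z ^ m"] by simp
    qed
    also have "\<dots> \<le> E x"
      unfolding E_def
    proof (rule sum_mono2)
      show "(\<lambda>k. k\<^sup>2) ` {1..M} \<subseteq> {1..x}"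
      proof
        fix m assume "m \<in> (\<lambda>k. k\<^sup>2) ` {1..M}"
        then obtain k where k: "m = k\<^sup>2" "1 \<le> k" "k \<le> M" by auto
        then have "k\<^sup>2 \<le> M\<^sup>2" by (intro power_mono) auto
        then have "k\<^sup>2 \<le> x" using x by (rule order.trans)
        moreover have "1 \<le> k\<^sup>2" using k by simp
        ultimately show "m \<in> {1..x}" using k by simp
      qed
    next
      fix m assume "m \<in> {1..x} - (\<lambda>k. k\<^sup>2) ` {1..M}"
      then show "0 \<le> divisor_sum \<psi> m * z ^ m"
        using z divisor_sum_nonneg_square[OF char N, of m] by simp
    qed simp
    finally show ?thesis .
  qed
  have "(\<lambda>x. real x * z ^ x) \<longlonglongrightarrow> 0" using powser_times_n_limit_0[of z] z by simp
  then have "(\<lambda>x. \<bar>T x\<bar> / (1 - z) + 2 * real N + real x * z ^ x / (1 - z)) \<longlonglongrightarrow> \<bar>0\<bar> / (1 - z) + 2 * real N + 0 / (1 - z)"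
    using \<open>T \<longlonglongrightarrow> 0\<close> z by (intro tendsto_intros) auto
  then have lim: "(\<lambda>x. \<bar>T x\<bar> / (1 - z) + 2 * real N + real x * z ^ x / (1 - z)) \<longlonglongrightarrow> 2 * real N" by simp
  show ?thesis
  proof (rule LIMSEQ_le_const[OF lim], intro exI allI impI)
    fix x assume "x \<ge> M\<^sup>2"
    then show "(\<Sum>k\<in>{1..M}. z ^ (k\<^sup>2)) \<le> \<bar>T x\<bar> / (1 - z) + 2 * real N + real x * z ^ x / (1 - z)"
      using E_ge[of x] E_le[of x] by linarith
  qed
qed

lemma dirichlet_series_1_nonzero: "(\<Sum>n. \<psi> (Suc n) * real (Suc n) powr (- 1)) \<noteq> 0"
proof
  assume L: "(\<Sum>n. \<psi> (Suc n) * real (Suc n) powr (- 1)) = 0"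
  \<comment> \<open>As \<open>z\<close> tends to 1, a sum of \<open>M\<close> square powers tends to
    \<open>M\<close>, so one more than \<open>2 * N\<close> contradicts the bound.\<close>
  define M where "M = 2 * N + 1"
  have "((\<lambda>z::real. \<Sum>k\<in>{1..M}. z ^ (k\<^sup>2)) \<longlongrightarrow> (\<Sum>k\<in>{1..M}. 1 ^ (k\<^sup>2))) (at_left 1)"
    by (intro tendsto_intros)
  moreover have "\<forall>\<^sub>F z in at_left (1::real). (\<Sum>k\<in>{1..M}. z ^ (k\<^sup>2)) \<le> 2 * real N"
    using eventually_at_left_real[OF zero_less_one]
    by (rule eventually_mono) (rule square_powers_bounded[OF _ _ L], simp_all only: greaterThanLessThan_iff)
  ultimately have "(\<Sum>k\<in>{1..M}. (1::real) ^ (k\<^sup>2)) \<le> 2 * real N"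
    by (rule tendsto_upperbound) simp
  then show False by (simp add: M_def)
qed

end

section \<open>Primes with prescribed real character values\<close>

definition dirichlet_L :: "(nat \<Rightarrow> real) \<Rightarrow> real \<Rightarrow> real" where
  "dirichlet_L \<psi> s = (\<Sum>n. \<psi> (Suc n) * real (Suc n) powr (- s))"

text \<open>Multiplying by \<open>1 - \<psi> p * p powr (- s)\<close> sieves out the multiples of
  \<open>p\<close>; after all primes up to \<open>x\<close>, what remains is 1 plus terms beyond
  \<open>x\<close>. The sums over primes stay finite, and the bound depends neither on
  \<open>\<psi>\<close> nor on \<open>s\<close>.\<close>

lemma euler_product_log_bound:
  fixes \<psi> :: "nat \<Rightarrow> real" and s :: real
  assumes mult: "\<And>m n. \<psi> (m * n) = \<psi> m * \<psi> n" and le1: "\<And>n. \<bar>\<psi> n\<bar> \<le> 1" and one: "\<psi> 1 = 1"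
    and s: "s > 1"
  shows "dirichlet_L \<psi> s > 0"
    and "\<forall>\<^sub>F x in sequentially. \<bar>ln (dirichlet_L \<psi> s) - (\<Sum>p | prime p \<and> p \<le> x. \<psi> p * real p powr (- s))\<bar>
           \<le> 1 + 2 * (\<Sum>n. 1 / real n ^ 2)"
proof -
  define g where "g = (\<lambda>n. \<psi> n * real n powr (- s))"
  define D where "D = dirichlet_L \<psi> s"
  \<comment> \<open>The integers that survive the sieve by \<open>P\<close>. Unordered sums over
    such sets can be split and reindexed freely.\<close>
  define A where "A = (\<lambda>P. {n::nat. n > 0 \<and> (\<forall>p\<in>P. \<not> p dvd n)})"
  define Q where "Q = (\<lambda>x::nat. {p. prime p \<and> p \<le> x})"
  have g_mult: "g (m * n) = g m * g n" for m n by (simp add: g_def mult powr_mult)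
  have g_0: "g 0 = 0" and g_1: "g 1 = 1" using one by (simp_all add: g_def)
  have g_abs: "\<bar>g n\<bar> \<le> real n powr (- s)" for n
    using le1[of n] mult_right_mono[of "\<bar>\<psi> n\<bar>" 1 "real n powr (- s)"] by (simp add: g_def abs_mult)
  have "summable (\<lambda>n. real n powr (- s))" using s by (simp add: summable_real_powr_iff)
  then have norm_sm: "summable (\<lambda>n. norm (g n))" by (rule summable_comparison_test'[where N = 0]) (use g_abs in auto)
  have infsum_suminf: "infsum h UNIV = suminf h" if "summable (\<lambda>n. norm (h n))" for h :: "nat \<Rightarrow> real"
    using infsumI[OF norm_summable_imp_has_sum[OF that summable_sums]] that summable_norm_cancel by blast
  from norm_sm have abs: "(\<lambda>n. norm (g n)) summable_on UNIV" and sum_g: "g summable_on UNIV" and sm: "summable g"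
    by (auto simp: norm_summable_imp_summable_on summable_rabs_cancel intro: norm_summable_imp_summable_on)
  have gS: "g summable_on B" and aS: "(\<lambda>n. \<bar>g n\<bar>) summable_on B" for B
    using sum_g abs summable_on_subset_banach[of _ UNIV B] by auto
  have D: "D = infsum g (A {})"
  proof -
    have "infsum g UNIV = suminf g" using norm_sm by (rule infsum_suminf)
    also have "\<dots> = D" using suminf_split_head[OF sm] g_0 by (simp add: D_def dirichlet_L_def g_def)
    finally have "D = infsum g UNIV" by simp
    also have "\<dots> = infsum g (A {})" by (rule infsum_cong_neutral) (auto simp: A_def g_0)
    finally show ?thesis .
  qed
  have step: "(1 - g p) * infsum g (A P) = infsum g (A (insert p P))"
    if p: "prime p" "p \<notin> P" and P: "\<forall>q\<in>P. prime q" for p P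
  proof -
    have split: "A P = A (insert p P) \<union> (*) p ` A P"
    proof (intro equalityI subsetI)
      fix n assume n: "n \<in> A P"
      show "n \<in> A (insert p P) \<union> (*) p ` A P"
      proof (cases "p dvd n")
        case True
        then obtain m where m: "n = p * m" by (auto simp: dvd_def)
        have "\<not> q dvd p * m" if "q \<in> P" for q using n that by (simp add: A_def m)
        then have "\<not> q dvd m" if "q \<in> P" for q using that dvd_mult by blast
        moreover have "m > 0" using n by (simp add: A_def m)
        ultimately have "m \<in> A P" by (simp add: A_def)
        then show ?thesis unfolding m by (intro UnI2 imageI)
      qed (use n in \<open>auto simp: A_def\<close>)
    next
      fix n assume "n \<in> A (insert p P) \<union> (*) p ` A P"
      moreover have "p * m \<in> A P" if m: "m \<in> A P" for m
      proof -
        have "\<not> q dvd p * m" if q: "q \<in> P" for q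
        proof
          assume "q dvd p * m"
          moreover have "prime q" "\<not> q dvd m" using q P m by (auto simp: A_def)
          ultimately have "q dvd p" by (simp add: prime_dvd_mult_iff)
          then show False using primes_dvd_imp_eq[OF \<open>prime q\<close> p(1)] q p(2) by blast
        qed
        then show ?thesis using m prime_gt_0_nat[OF p(1)] by (simp add: A_def)
      qed
      moreover have "A (insert p P) \<subseteq> A P" by (auto simp: A_def)
      ultimately show "n \<in> A P" by (elim UnE imageE) (simp_all add: subsetD)
    qed
    have "infsum g (A P) = infsum g (A (insert p P)) + infsum g ((*) p ` A P)"
    proof -
      have "infsum g (A (insert p P) \<union> (*) p ` A P) = infsum g (A (insert p P)) + infsum g ((*) p ` A P)"
        by (rule infsum_Un_disjoint[OF gS gS]) (auto simp: A_def)
      then show ?thesis using split by simp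
    qed
    also have "infsum g ((*) p ` A P) = infsum (\<lambda>n. g p * g n) (A P)"
      using prime_gt_0_nat[OF p(1)] by (subst infsum_reindex) (auto simp: inj_on_def o_def g_mult)
    also have "\<dots> = g p * infsum g (A P)" by (rule infsum_cmult_right')
    finally show ?thesis unfolding left_diff_distrib by linarith
  qed
  have prod: "(\<Prod>p\<in>P. 1 - g p) * D = infsum g (A P)" if "finite P" "\<forall>q\<in>P. prime q" for P
    using that
  proof (induction P rule: finite_induct)
    case (insert p P)
    then have "infsum g (A (insert p P)) = (1 - g p) * ((\<Prod>p\<in>P. 1 - g p) * D)" using step[of p P] by simp
    then show ?case using insert by (simp add: mult.assoc)
  qed (simp add: D)
  have finQ: "finite (Q x)" and primeQ: "\<forall>q\<in>Q x. prime q" for x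
    by (auto simp: Q_def intro: finite_subset[of _ "{..x}"])
  have tail: "\<bar>infsum g (A (Q x)) - 1\<bar> \<le> infsum (\<lambda>n. \<bar>g n\<bar>) UNIV - (\<Sum>n\<le>x. \<bar>g n\<bar>)" if "x \<ge> 1" for x
  proof -
    have "\<not> p dvd 1" if "p \<in> Q x" for p using prime_gt_1_nat[of p] that by (simp add: Q_def)
    then have 1: "1 \<in> A (Q x)" by (simp add: A_def)
    then have "infsum g (A (Q x)) = infsum g {1} + infsum g (A (Q x) - {1})"
      using infsum_Un_disjoint[OF gS gS, of "{1}" "A (Q x) - {1}"] by (simp add: insert_absorb)
    then have "infsum g (A (Q x)) - 1 = infsum g (A (Q x) - {1})" using g_1 by simp
    then have "\<bar>infsum g (A (Q x)) - 1\<bar> \<le> infsum (\<lambda>n. \<bar>g n\<bar>) (A (Q x) - {1})"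
      using norm_infsum_bound[of g "A (Q x) - {1}"] aS by simp
    also have "\<dots> \<le> infsum (\<lambda>n. \<bar>g n\<bar>) {x<..}"
    proof (rule infsum_mono_neutral[OF aS aS])
      fix n assume n: "n \<in> A (Q x) - {1} - {x<..}"
      then have "n \<noteq> 1" "n > 0" by (auto simp: A_def)
      then obtain p where p: "prime p" "p dvd n" using prime_factor_nat by blast
      then have "p \<le> n" using \<open>n > 0\<close> by (simp add: dvd_imp_le)
      then have "p \<in> Q x" using n p by (auto simp: Q_def)
      then show "\<bar>g n\<bar> \<le> 0" using n p by (auto simp: A_def)
    qed auto
    also have "\<dots> = infsum (\<lambda>n. \<bar>g n\<bar>) UNIV - (\<Sum>n\<le>x. \<bar>g n\<bar>)"
    proof -
      have "UNIV = {..x} \<union> {x<..}" by auto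
      then have "infsum (\<lambda>n. \<bar>g n\<bar>) UNIV = infsum (\<lambda>n. \<bar>g n\<bar>) {..x} + infsum (\<lambda>n. \<bar>g n\<bar>) {x<..}"
        using infsum_Un_disjoint[OF aS aS, of "{..x}" "{x<..}"] by (simp add: disjoint_iff)
      then show ?thesis by simp
    qed
    finally show ?thesis .
  qed
  have "(\<lambda>x. \<Sum>n\<le>x. \<bar>g n\<bar>) \<longlonglongrightarrow> infsum (\<lambda>n. \<bar>g n\<bar>) UNIV"
    using summable_LIMSEQ'[of "\<lambda>n. \<bar>g n\<bar>"] infsum_suminf[of "\<lambda>n. \<bar>g n\<bar>"] norm_sm by simp
  then have "\<forall>\<^sub>F x in sequentially. dist (\<Sum>n\<le>x. \<bar>g n\<bar>) (infsum (\<lambda>n. \<bar>g n\<bar>) UNIV) < 1 / 2"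
    by (rule tendstoD) simp
  then have near: "\<forall>\<^sub>F x in sequentially. \<bar>infsum g (A (Q x)) - 1\<bar> \<le> 1 / 2"
    using eventually_ge_at_top[of 1]
  proof eventually_elim
    case (elim x)
    then show ?case using tail[of x] by (simp add: dist_real_def abs_if split: if_splits)
  qed
  have g_half: "\<bar>g p\<bar> \<le> 1 / real p" "\<bar>g p\<bar> \<le> 1 / 2" if "prime p" for p
  proof -
    have p2: "real p \<ge> 2" using prime_ge_2_nat[OF that] by simp
    have "real p powr (- s) \<le> real p powr (- 1)" using s p2 by (intro powr_mono) auto
    also have "real p powr (- 1) = 1 / real p" using p2 by (simp add: powr_minus divide_inverse)
    finally show "\<bar>g p\<bar> \<le> 1 / real p" using g_abs[of p] by linarith
    also have "\<dots> \<le> 1 / 2" using p2 by (simp add: field_simps)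
    finally show "\<bar>g p\<bar> \<le> 1 / 2" .
  qed
  have g_lt: "1 - g p > 0" if "p \<in> Q x" for p x
    using g_half(2)[of p] that by (simp add: Q_def abs_le_iff)
  have prod_pos: "(\<Prod>p\<in>Q x. 1 - g p) > 0" for x
    by (rule prod_pos) (rule g_lt)
  obtain x where "\<bar>infsum g (A (Q x)) - 1\<bar> \<le> 1 / 2"
    using near by (auto simp: eventually_sequentially)
  then have "(\<Prod>p\<in>Q x. 1 - g p) * D > 0" using prod[OF finQ primeQ, of x] by linarith
  then have Dpos: "D > 0" using prod_pos[of x] by (simp add: zero_less_mult_iff)
  then show "dirichlet_L \<psi> s > 0" by (simp add: D_def)
  have "\<forall>\<^sub>F x in sequentially. \<bar>ln D - (\<Sum>p\<in>Q x. g p)\<bar> \<le> 1 + 2 * (\<Sum>n. 1 / real n ^ 2)"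
    using near
  proof eventually_elim
    case (elim x)
    define y where "y = infsum g (A (Q x))"
    have y: "1 / 2 \<le> y" "y \<le> 3 / 2" using elim unfolding y_def by linarith+
    have "ln y = (\<Sum>p\<in>Q x. ln (1 - g p)) + ln D"
    proof -
      have "ln y = ln ((\<Prod>p\<in>Q x. 1 - g p) * D)" using prod[OF finQ primeQ, of x] by (simp add: y_def)
      also have "\<dots> = ln (\<Prod>p\<in>Q x. 1 - g p) + ln D" using prod_pos[of x] Dpos by (rule ln_mult_pos)
      also have "ln (\<Prod>p\<in>Q x. 1 - g p) = (\<Sum>p\<in>Q x. ln (1 - g p))"
        by (rule ln_prod[OF finQ], drule g_lt, simp)
      finally show ?thesis .
    qed
    \<comment> \<open>The summand 1 of the bound comes from \<open>y\<close> lying between 1/2 and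
      3/2; the other one comes from the quadratic remainder of the logarithm, and its series has the
      value 0 at \<open>n = 0\<close> since \<open>1 / 0 = 0\<close>.\<close>
    moreover have "ln y \<le> 1" using ln_le_minus_one[of y] y by simp
    moreover have "- 1 \<le> ln y"
    proof -
      have "ln (1 / 2) \<le> ln y" using y by simp
      then show ?thesis using ln2_le_25_over_36 by (simp add: ln_div)
    qed
    moreover have "\<bar>\<Sum>p\<in>Q x. ln (1 - g p) + g p\<bar> \<le> 2 * (\<Sum>n. 1 / real n ^ 2)"
    proof -
      have "\<bar>ln (1 - g p) + g p\<bar> \<le> 2 * (1 / real p ^ 2)" if "p \<in> Q x" for p
      proof -
        have p: "prime p" using that by (simp add: Q_def)
        have "\<bar>ln (1 + (- g p)) - (- g p)\<bar> \<le> 2 * (- g p)\<^sup>2"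
          by (rule abs_ln_one_plus_x_minus_x_bound) (use g_half(2)[OF p] in simp)
        also have "(- g p)\<^sup>2 \<le> (1 / real p)\<^sup>2"
          using power_mono[OF g_half(1)[OF p] abs_ge_zero, of 2] by simp
        finally show ?thesis by (simp add: power_one_over)
      qed
      then have "(\<Sum>p\<in>Q x. \<bar>ln (1 - g p) + g p\<bar>) \<le> (\<Sum>p\<in>Q x. 2 * (1 / real p ^ 2))"
        by (rule sum_mono)
      then have "\<bar>\<Sum>p\<in>Q x. ln (1 - g p) + g p\<bar> \<le> (\<Sum>p\<in>Q x. 2 * (1 / real p ^ 2))"
        by (rule order.trans[OF sum_abs])
      also have "\<dots> = 2 * (\<Sum>p\<in>Q x. 1 / real p ^ 2)" by (simp add: sum_distrib_left)
      also have "\<dots> \<le> 2 * (\<Sum>n. 1 / real n ^ 2)"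
        using inverse_power_summable[of 2, where 'a = real]
        by (intro mult_left_mono sum_le_suminf finQ) (auto simp: divide_inverse)
      finally show ?thesis .
    qed
    ultimately show ?case unfolding sum.distrib by linarith
  qed
  then show "\<forall>\<^sub>F x in sequentially. \<bar>ln (dirichlet_L \<psi> s) - (\<Sum>p | prime p \<and> p \<le> x. \<psi> p * real p powr (- s))\<bar>
           \<le> 1 + 2 * (\<Sum>n. 1 / real n ^ 2)"
    by (simp add: Q_def D_def g_def)
qed

text \<open>By the uniform tail bound the series is within \<open>l / 4\<close> of one fixed finite
  sum for all \<open>s \<ge> 1\<close>, and that sum is continuous. Three errors of
  \<open>l / 4\<close> still leave \<open>l / 4\<close> of the nonzero absolute value
  \<open>l\<close> at 1.\<close>

lemma nonprincipal_log_bounded: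
  assumes char: "real_char N \<psi>" and N: "N > 0" and u: "\<psi> u = -1"
  shows "\<exists>B. \<forall>\<^sub>F s in at_right 1. \<bar>ln (dirichlet_L \<psi> s)\<bar> \<le> B"
proof -
  define l where "l = \<bar>dirichlet_L \<psi> 1\<bar>"
  have l: "l > 0" using dirichlet_series_1_nonzero[OF char N u] by (simp add: l_def dirichlet_L_def)
  obtain m :: nat where m: "8 * real N / l < real m" using reals_Archimedean2 by blast
  have m': "2 * real N / real (Suc m) \<le> l / 4"
  proof -
    have "8 * real N < l * real m" using m l by (simp add: field_simps)
    also have "\<dots> \<le> l * real (Suc m)" using l by simp
    finally show ?thesis by (simp add: field_simps)
  qed
  define F where "F = (\<lambda>s. \<Sum>n<m. \<psi> (Suc n) * real (Suc n) powr (- s))"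
  have tail: "\<bar>dirichlet_L \<psi> s - F s\<bar> \<le> l / 4" if "s \<ge> 1" for s
    using dirichlet_tail_suminf[OF char N u that, of m] m' by (simp add: dirichlet_L_def F_def)
  have "(F \<longlongrightarrow> F 1) (at_right 1)" unfolding F_def by (intro tendsto_intros) auto
  then have "\<forall>\<^sub>F s in at_right 1. dist (F s) (F 1) < l / 4" by (rule tendstoD) (use l in simp)
  moreover have "\<forall>\<^sub>F s in at_right (1::real). s > 1" by (simp add: eventually_at_right_less)
  ultimately have "\<forall>\<^sub>F s in at_right 1. \<bar>ln (dirichlet_L \<psi> s)\<bar> \<le> max (ln (2 * real N)) (- ln (l / 4))"
  proof eventually_elim
    case (elim s)
    have pos: "dirichlet_L \<psi> s > 0"
      by (rule euler_product_log_bound(1))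
         (use elim char_mult[OF char N] char_abs_le_1[OF char N] char_1[OF char N] in auto)
    have "\<bar>dirichlet_L \<psi> s\<bar> \<ge> l / 4"
      using tail[of s] tail[of 1] elim unfolding l_def dist_real_def by linarith
    then have lo: "l / 4 \<le> dirichlet_L \<psi> s" using pos by simp
    have "\<bar>dirichlet_L \<psi> s\<bar> \<le> 2 * real N"
      using dirichlet_tail_suminf[OF char N u, of s 0] elim by (simp add: dirichlet_L_def)
    then have hi: "dirichlet_L \<psi> s \<le> 2 * real N" by simp
    have "ln (l / 4) \<le> ln (dirichlet_L \<psi> s)" using lo l by (subst ln_le_cancel_iff) auto
    moreover have "ln (dirichlet_L \<psi> s) \<le> ln (2 * real N)" using hi pos by (subst ln_le_cancel_iff) auto
    ultimately show ?case by linarith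
  qed
  then show ?thesis by blast
qed

definition principal_char :: "nat \<Rightarrow> nat \<Rightarrow> real" where
  "principal_char N n = (if coprime n N then 1 else 0)"

lemma real_char_principal: "real_char N (principal_char N)"
proof -
  have "coprime (n + N) N \<longleftrightarrow> coprime n N" for n by (simp only: coprime_iff_gcd_eq_1 gcd_add1)
  then show ?thesis by (auto simp: real_char_def principal_char_def)
qed

text \<open>The terms at integers congruent to 1 modulo \<open>N\<close> already dominate
  \<open>1 / N\<close> times the harmonic series. A long finite part exceeds any bound at
  \<open>s = 1\<close>, hence also for \<open>s\<close> slightly above 1.\<close>

lemma principal_log_unbounded:
  assumes N: "N > 0"
  shows "\<forall>\<^sub>F s in at_right 1. ln (dirichlet_L (principal_char N) s) \<ge> B"
proof -
  let ?f = "\<lambda>n s. principal_char N (Suc n) * real (Suc n) powr (- s)"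
  have "\<not> summable (\<lambda>n. inverse (real (Suc n)))"
    using not_summable_harmonic[where 'a = real] summable_Suc_iff[of "\<lambda>n. inverse (real n)"] by simp
  then have "\<exists>M. (\<Sum>j<M. inverse (real (Suc j))) > real N * (exp B + 1)"
  proof (rule contrapos_np)
    assume "\<not> ?thesis"
    then show "summable (\<lambda>n. inverse (real (Suc n)))"
      by (intro summableI_nonneg_bounded[of _ "real N * (exp B + 1)"]) (auto simp: not_less)
  qed
  then obtain M where M: "(\<Sum>j<M. inverse (real (Suc j))) > real N * (exp B + 1)" ..
  have "real N * (\<Sum>n<M * N. ?f n 1) \<ge> (\<Sum>j<M. inverse (real (Suc j)))"
  proof -
    have inj: "inj_on (\<lambda>j. j * N) {..<M}" using N by (auto simp: inj_on_def)
    have "(\<Sum>j<M. inverse (real (Suc j))) \<le> (\<Sum>j<M. real N * ?f (j * N) 1)"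
    proof (rule sum_mono)
      fix j
      have "gcd N (j * N + 1) = 1" using gcd_add_mult[of N j 1] by simp
      then have "coprime (Suc (j * N)) N" by (metis Suc_eq_plus1 coprime_iff_gcd_eq_1 gcd.commute)
      then have "?f (j * N) 1 = inverse (real (Suc (j * N)))" by (simp add: principal_char_def powr_minus)
      moreover have "real (Suc (j * N)) \<le> real N * real (Suc j)"
        using N by (simp add: algebra_simps)
      then have "inverse (real N * real (Suc j)) \<le> inverse (real (Suc (j * N)))"
        by (rule le_imp_inverse_le) (simp only: of_nat_0_less_iff zero_less_Suc)
      then have "real N * inverse (real N * real (Suc j)) \<le> real N * inverse (real (Suc (j * N)))"
        by (intro mult_left_mono) auto
      moreover have "real N * inverse (real N * real (Suc j)) = inverse (real (Suc j))"
        using N by (simp only: inverse_mult_distrib mult.assoc[symmetric]) simp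
      ultimately show "inverse (real (Suc j)) \<le> real N * ?f (j * N) 1" by (simp only:)
    qed
    also have "\<dots> = real N * (\<Sum>n\<in>(\<lambda>j. j * N) ` {..<M}. ?f n 1)"
      by (simp add: sum.reindex[OF inj] sum_distrib_left)
    also have "\<dots> \<le> real N * (\<Sum>n<M * N. ?f n 1)"
      using N by (intro mult_left_mono sum_mono2) (auto simp: principal_char_def)
    finally show ?thesis .
  qed
  then have "real N * (\<Sum>n<M * N. ?f n 1) > real N * (exp B + 1)" using M by linarith
  then have big: "(\<Sum>n<M * N. ?f n 1) > exp B + 1" using N by simp
  have "((\<lambda>s. \<Sum>n<M * N. ?f n s) \<longlongrightarrow> (\<Sum>n<M * N. ?f n 1)) (at_right 1)"
    by (intro tendsto_intros) auto
  then have "\<forall>\<^sub>F s in at_right 1. (\<Sum>n<M * N. ?f n s) > exp B + 1"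
    using big by (rule order_tendstoD)
  moreover have "\<forall>\<^sub>F s in at_right (1::real). s > 1" by (simp add: eventually_at_right_less)
  ultimately show ?thesis
  proof eventually_elim
    case (elim s)
    have "summable (\<lambda>n. real (Suc n) powr (- s))"
      using elim by (subst summable_Suc_iff) (simp add: summable_real_powr_iff)
    then have "summable (\<lambda>n. ?f n s)"
      by (rule summable_comparison_test'[where N = 0]) (simp add: principal_char_def)
    then have "(\<Sum>n<M * N. ?f n s) \<le> dirichlet_L (principal_char N) s"
      unfolding dirichlet_L_def by (intro sum_le_suminf) (auto simp: principal_char_def)
    then have "exp B \<le> dirichlet_L (principal_char N) s" using elim by linarith
    moreover from this have "dirichlet_L (principal_char N) s > 0" by (rule less_le_trans[OF exp_gt_zero])
    ultimately show ?case by (simp add: ln_ge_iff)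
  qed
qed

lemma finite_real_chars: "N > 0 \<Longrightarrow> finite {\<psi>. real_char N \<psi>}"
proof -
  assume N: "N > 0"
  have "inj_on (\<lambda>\<psi>. restrict \<psi> {..<N}) {\<psi>. real_char N \<psi>}"
  proof (rule inj_onI)
    fix \<psi> \<phi> assume a: "\<psi> \<in> {\<psi>. real_char N \<psi>}" "\<phi> \<in> {\<psi>. real_char N \<psi>}"
      "restrict \<psi> {..<N} = restrict \<phi> {..<N}"
    show "\<psi> = \<phi>"
    proof
      fix n
      have "\<psi> (n mod N) = \<phi> (n mod N)" using N fun_cong[OF a(3), of "n mod N"] by simp
      moreover have "\<psi> (n mod N) = \<psi> n" by (rule char_mod[OF _ N]) (use a(1) in simp)
      moreover have "\<phi> (n mod N) = \<phi> n" by (rule char_mod[OF _ N]) (use a(2) in simp)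
      ultimately show "\<psi> n = \<phi> n" by (simp only:)
    qed
  qed
  moreover have "(\<lambda>\<psi>. restrict \<psi> {..<N}) ` {\<psi>. real_char N \<psi>} \<subseteq> PiE {..<N} (\<lambda>_. {-1, 0, 1})"
  proof (rule image_subsetI)
    fix \<psi> assume "\<psi> \<in> {\<psi>. real_char N \<psi>}"
    then have "\<psi> n \<in> {-1, 0, 1}" for n unfolding real_char_def by blast
    then show "restrict \<psi> {..<N} \<in> PiE {..<N} (\<lambda>_. {-1, 0, 1})" by simp
  qed
  moreover have "finite (PiE {..<N} (\<lambda>_. {-1, 0, 1::real}))" by (intro finite_PiE) auto
  ultimately show ?thesis by (rule inj_on_finite)
qed

lemma real_char_prod:
  assumes "real_char N \<psi>" "real_char N \<phi>" and N: "N > 0"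
  shows "real_char N (\<lambda>n. \<psi> n * \<phi> n)"
  unfolding real_char_def
proof (intro conjI allI)
  note c = char_mult[OF assms(1) N] char_mult[OF assms(2) N] char_period[OF assms(1) N]
    char_period[OF assms(2) N] char_nonzero[OF assms(1) N] char_nonzero[OF assms(2) N]
  fix m n
  show "(\<psi> n * \<phi> n \<noteq> 0) = coprime n N" using c(5,6)[of n] by simp
  show "\<psi> n * \<phi> n \<in> {-1, 0, 1}"
    using char_values[OF assms(1) N, of n] char_values[OF assms(2) N, of n] by auto
  show "\<psi> (m * n) * \<phi> (m * n) = \<psi> m * \<phi> m * (\<psi> n * \<phi> n)"
    by (simp only: c mult_ac)
  show "\<psi> (n + N) * \<phi> (n + N) = \<psi> n * \<phi> n" by (simp only: c)
qed

text \<open>Orthogonality inside the group \<open>G\<close> of real characters: \<open>F q\<close>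
  vanishes unless \<open>q\<close> agrees with \<open>k\<close> under all of them. With finitely
  many such primes the sums of \<open>F p * p powr (- s)\<close> would be bounded, yet the principal
  character makes them grow while the others contribute boundedly.\<close>

lemma infinite_primes_with_char_values:
  assumes N: "N > 0" and k: "coprime k N"
  shows "infinite {q. prime q \<and> (\<forall>\<psi>. real_char N \<psi> \<longrightarrow> \<psi> q = \<psi> k)}"
proof
  define S where "S = {q. prime q \<and> (\<forall>\<psi>. real_char N \<psi> \<longrightarrow> \<psi> q = \<psi> k)}"
  assume "finite {q. prime q \<and> (\<forall>\<psi>. real_char N \<psi> \<longrightarrow> \<psi> q = \<psi> k)}"
  then have finS: "finite S" by (simp add: S_def)
  define G where "G = {\<psi>. real_char N \<psi>}"
  define F where "F = (\<lambda>n. \<Sum>\<psi>\<in>G. \<psi> k * \<psi> n)"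
  have finG: "finite G" using finite_real_chars[OF N] by (simp add: G_def)
  have pr: "principal_char N \<in> G" by (simp add: G_def real_char_principal)
  have abs1: "\<bar>\<psi> n\<bar> \<le> 1" if "\<psi> \<in> G" for \<psi> n using char_abs_le_1[of N \<psi>] that N by (simp add: G_def)
  \<comment> \<open>Multiplying by a character \<open>\<phi>\<close> with \<open>\<phi> (k * q) = -1\<close> permutes \<open>G\<close> and negates the sum.\<close>
  have F_zero: "F q = 0" if q: "prime q" "q \<notin> S" for q
  proof (cases "coprime q N")
    case False
    then have "\<psi> q = 0" if "\<psi> \<in> G" for \<psi> using that by (auto simp: G_def real_char_def)
    then show ?thesis unfolding F_def by (intro sum.neutral) simp
  next
    case True
    obtain \<phi> where \<phi>: "real_char N \<phi>" "\<phi> q \<noteq> \<phi> k" using q by (auto simp: S_def)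
    have "\<phi> q \<noteq> 0" "\<phi> k \<noteq> 0" using \<phi>(1) True k by (auto simp: real_char_def)
    then have m1: "\<phi> k * \<phi> q = -1"
      using \<phi> char_values[of N \<phi> q] char_values[of N \<phi> k] N by auto
    have inv: "\<phi> n * (\<phi> n * \<psi> n) = \<psi> n" if "\<psi> \<in> G" for \<psi> n
    proof (cases "coprime n N")
      case True
      then have "\<phi> n \<noteq> 0" using \<phi>(1) by (simp add: real_char_def)
      then have "\<phi> n * \<phi> n = 1" using char_values[OF \<phi>(1) N, of n] by auto
      then show ?thesis by (simp add: mult.assoc[symmetric])
    next
      case False
      then have "\<psi> n = 0" using that by (auto simp: G_def real_char_def)
      then show ?thesis by simp
    qed
    have cl: "(\<lambda>n. \<phi> n * \<psi> n) \<in> G" if "\<psi> \<in> G" for \<psi>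
      using that real_char_prod[OF \<phi>(1) _ N] by (simp add: G_def)
    have "F q = (\<Sum>\<psi>\<in>G. (\<phi> k * \<psi> k) * (\<phi> q * \<psi> q))"
      unfolding F_def
      by (rule sum.reindex_bij_witness[of _ "\<lambda>\<psi> n. \<phi> n * \<psi> n" "\<lambda>\<psi> n. \<phi> n * \<psi> n"])
         (simp_all add: inv cl)
    also have "\<dots> = (\<Sum>\<psi>\<in>G. (\<phi> k * \<phi> q) * (\<psi> k * \<psi> q))" by (simp add: mult_ac)
    also have "\<dots> = - F q" unfolding m1 F_def by (simp add: sum_negf)
    finally show ?thesis by simp
  qed
  have F_le: "F q \<le> real (card G)" for q
  proof -
    have "F q \<le> (\<Sum>\<psi>\<in>G. 1)" unfolding F_def
    proof (rule sum_mono)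
      fix \<psi> assume "\<psi> \<in> G"
      then have "\<bar>\<psi> k * \<psi> q\<bar> \<le> 1 * 1" unfolding abs_mult by (intro mult_mono abs1) auto
      then show "\<psi> k * \<psi> q \<le> 1" by simp
    qed
    then show ?thesis by simp
  qed
  define K where "K = 1 + 2 * (\<Sum>n. 1 / real n ^ 2)"
  define P where "P = (\<lambda>\<psi> s x. \<Sum>p | prime p \<and> p \<le> x. \<psi> p * real p powr (- s))"
  have "\<exists>B. \<forall>\<^sub>F s in at_right 1. \<bar>ln (dirichlet_L \<psi> s)\<bar> \<le> B" if \<psi>: "\<psi> \<in> G - {principal_char N}" for \<psi>
  proof -
    have c: "real_char N \<psi>" using \<psi> by (simp add: G_def)
    have "\<exists>u. \<psi> u = -1"
    proof (rule ccontr)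
      assume "\<not> ?thesis"
      then have "\<psi> n = principal_char N n" for n
        using char_nonzero[OF c N, of n] char_values[OF c N, of n] by (auto simp: principal_char_def)
      then show False using \<psi> by auto
    qed
    then show ?thesis using nonprincipal_log_bounded[OF c N] by blast
  qed
  then have "\<forall>\<psi>\<in>G - {principal_char N}. \<exists>B. \<forall>\<^sub>F s in at_right 1. \<bar>ln (dirichlet_L \<psi> s)\<bar> \<le> B" by blast
  then obtain B where B: "\<forall>\<psi>\<in>G - {principal_char N}. \<forall>\<^sub>F s in at_right 1. \<bar>ln (dirichlet_L \<psi> s)\<bar> \<le> B \<psi>"
    by (rule bchoice[THEN exE])
  have ev1: "\<forall>\<^sub>F s in at_right 1. \<forall>\<psi>\<in>G - {principal_char N}. \<bar>ln (dirichlet_L \<psi> s)\<bar> \<le> B \<psi>"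
    by (rule eventually_ball_finite) (use finG B in auto)
  \<comment> \<open>A threshold just beyond what \<open>upper\<close> allows. First \<open>s\<close>
    is taken so close to 1 that the principal logarithm reaches \<open>T\<close>, then
    \<open>x\<close> large depending on \<open>s\<close>; \<open>K\<close> can be fixed beforehand
    because it does not depend on \<open>s\<close>.\<close>
  define T where "T = real (card G) * real (card S) + 1 + K + (\<Sum>\<psi>\<in>G - {principal_char N}. B \<psi> + K)"
  have "\<forall>\<^sub>F s in at_right (1::real). s > 1" by (simp add: eventually_at_right_less)
  then have "\<forall>\<^sub>F s in at_right 1. s > 1 \<and> (\<forall>\<psi>\<in>G - {principal_char N}. \<bar>ln (dirichlet_L \<psi> s)\<bar> \<le> B \<psi>) \<and>
      ln (dirichlet_L (principal_char N) s) \<ge> T"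
    using ev1 principal_log_unbounded[OF N, of T] by eventually_elim auto
  then have "\<exists>s. s > 1 \<and> (\<forall>\<psi>\<in>G - {principal_char N}. \<bar>ln (dirichlet_L \<psi> s)\<bar> \<le> B \<psi>) \<and>
      ln (dirichlet_L (principal_char N) s) \<ge> T"
    by (rule eventually_happens'[OF trivial_limit_at_right_real])
  then obtain s where s: "s > 1" "\<And>\<psi>. \<psi> \<in> G - {principal_char N} \<Longrightarrow> \<bar>ln (dirichlet_L \<psi> s)\<bar> \<le> B \<psi>"
      "ln (dirichlet_L (principal_char N) s) \<ge> T" by blast
  have "\<forall>\<^sub>F x in sequentially. \<forall>\<psi>\<in>G. \<bar>ln (dirichlet_L \<psi> s) - P \<psi> s x\<bar> \<le> K"
  proof (rule eventually_ball_finite[OF finG], rule ballI)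
    fix \<psi> assume "\<psi> \<in> G"
    then have c: "real_char N \<psi>" by (simp add: G_def)
    show "\<forall>\<^sub>F x in sequentially. \<bar>ln (dirichlet_L \<psi> s) - P \<psi> s x\<bar> \<le> K"
      unfolding K_def P_def
      by (rule euler_product_log_bound(2))
         (use s(1) char_mult[OF c N] char_abs_le_1[OF c N] char_1[OF c N] in auto)
  qed
  then obtain x where x: "\<And>\<psi>. \<psi> \<in> G \<Longrightarrow> \<bar>ln (dirichlet_L \<psi> s) - P \<psi> s x\<bar> \<le> K"
    by (auto simp: eventually_sequentially)
  have "(\<Sum>\<psi>\<in>G. \<psi> k * P \<psi> s x) = (\<Sum>p | prime p \<and> p \<le> x. F p * real p powr (- s))"
    unfolding P_def F_def sum_distrib_left sum_distrib_right mult.assoc by (rule sum.swap)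
  also have "\<dots> \<le> (\<Sum>p\<in>S. real (card G))"
  proof -
    have "(\<Sum>p | prime p \<and> p \<le> x. F p * real p powr (- s)) \<le> (\<Sum>p | prime p \<and> p \<le> x. if p \<in> S then real (card G) else 0)"
    proof (rule sum_mono)
      fix p assume "p \<in> {p. prime p \<and> p \<le> x}"
      then have p: "prime p" by simp
      have "real p powr (- s) \<le> real p powr 0"
        using prime_ge_1_nat[OF p] s(1) by (intro powr_mono) auto
      then have le1: "real p powr (- s) \<le> 1" using prime_gt_0_nat[OF p] by simp
      have "F p * real p powr (- s) \<le> real (card G) * 1" if "p \<in> S"
      proof -
        have "F p * real p powr (- s) \<le> real (card G) * real p powr (- s)" using F_le by (intro mult_right_mono) auto
        also have "\<dots> \<le> real (card G) * 1" using le1 by (intro mult_left_mono) auto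
        finally show ?thesis .
      qed
      then show "F p * real p powr (- s) \<le> (if p \<in> S then real (card G) else 0)"
        using F_zero[OF p] by auto
    qed
    also have "\<dots> = (\<Sum>p\<in>{p. prime p \<and> p \<le> x} \<inter> S. real (card G))"
      by (subst sum.inter_restrict) (auto intro: finite_subset[of _ "{..x}"])
    also have "\<dots> \<le> (\<Sum>p\<in>S. real (card G))" using finS by (intro sum_mono2) auto
    finally show ?thesis .
  qed
  also have "\<dots> = real (card G) * real (card S)" by simp
  finally have upper: "(\<Sum>\<psi>\<in>G. \<psi> k * P \<psi> s x) \<le> real (card G) * real (card S)" .
  have "(\<Sum>\<psi>\<in>G. \<psi> k * P \<psi> s x) =
      P (principal_char N) s x + (\<Sum>\<psi>\<in>G - {principal_char N}. \<psi> k * P \<psi> s x)"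
    using sum.remove[OF finG pr, of "\<lambda>\<psi>. \<psi> k * P \<psi> s x"] k by (simp add: principal_char_def)
  moreover have "\<bar>\<Sum>\<psi>\<in>G - {principal_char N}. \<psi> k * P \<psi> s x\<bar> \<le> (\<Sum>\<psi>\<in>G - {principal_char N}. B \<psi> + K)"
  proof (rule order.trans[OF sum_abs], rule sum_mono)
    fix \<psi> assume \<psi>: "\<psi> \<in> G - {principal_char N}"
    have "\<bar>P \<psi> s x\<bar> \<le> B \<psi> + K" using x[of \<psi>] s(2)[OF \<psi>] \<psi> by auto
    moreover have "\<bar>\<psi> k\<bar> * \<bar>P \<psi> s x\<bar> \<le> 1 * \<bar>P \<psi> s x\<bar>" using abs1[of \<psi>] \<psi> by (intro mult_right_mono) auto
    ultimately show "\<bar>\<psi> k * P \<psi> s x\<bar> \<le> B \<psi> + K" by (simp add: abs_mult)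
  qed
  moreover have "P (principal_char N) s x \<ge> T - K" using x[OF pr] s(3) by linarith
  ultimately show False using upper unfolding T_def by linarith
qed

section \<open>Quadratic reciprocity and the auxiliary prime\<close>

lemma Legendre_values: "Legendre a p = -1 \<or> Legendre a p = 0 \<or> Legendre a p = 1"
  by (simp add: Legendre_def)

lemma Legendre_eq_0_iff: "Legendre a p = 0 \<longleftrightarrow> p dvd a"
  by (simp add: Legendre_def cong_0_iff)

lemma Legendre_eq_1_iff: "Legendre a p = 1 \<longleftrightarrow> \<not> p dvd a \<and> QuadRes p a"
  by (auto simp: Legendre_def cong_0_iff)

lemma QuadRes_iff_Legendre: "QuadRes p a \<longleftrightarrow> Legendre a p \<noteq> -1"
proof -
  have "QuadRes p a" if "p dvd a"
    unfolding QuadRes_iff by (rule exI[of _ 0]) (use that in simp)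
  then show ?thesis by (auto simp: Legendre_def cong_0_iff)
qed

lemma Legendre_cong:
  assumes "[a = b] (mod p)"
  shows "Legendre a p = Legendre b p"
proof -
  have *: "[y = a] (mod p) \<longleftrightarrow> [y = b] (mod p)" for y
    using cong_trans[of y a p b] cong_trans[of y b p a] assms cong_sym[OF assms] by blast
  have "[a = 0] (mod p) \<longleftrightarrow> [b = 0] (mod p)" using *[of 0] by (simp only: cong_sym_eq)
  then show ?thesis by (simp only: Legendre_def QuadRes_def *)
qed

lemma Legendre_one: "p > 1 \<Longrightarrow> Legendre 1 (int p) = 1"
proof -
  assume "p > 1"
  then have "\<not> int p dvd 1" by simp
  moreover have "QuadRes (int p) 1" unfolding QuadRes_iff by (rule exI[of _ 1]) simp
  ultimately show ?thesis unfolding Legendre_eq_1_iff by blast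
qed

lemma small_multiple_zero:
  fixes x :: int
  assumes "int p dvd x" "\<bar>x\<bar> \<le> 2" "p > 2"
  shows "x = 0"
  using dvd_imp_le_int[of x "int p"] assms by linarith

context
  fixes p :: nat
  assumes p: "prime p" "p > 2"
begin

text \<open>Euler's criterion gives the equality modulo \<open>p\<close>, and the two sides differ
  by at most 2, which is less than \<open>p\<close>.\<close>

lemma Legendre_mult: "Legendre (a * b) (int p) = Legendre a (int p) * Legendre b (int p)"
proof -
  have "[Legendre (a * b) p = (a * b) ^ ((p - 1) div 2)] (mod p)" by (rule euler_criterion[OF p])
  moreover have "[Legendre a p * Legendre b p = a ^ ((p - 1) div 2) * b ^ ((p - 1) div 2)] (mod p)"
    by (intro cong_mult euler_criterion[OF p])
  ultimately have "[Legendre (a * b) p = Legendre a p * Legendre b p] (mod p)"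
    unfolding power_mult_distrib using cong_trans cong_sym by blast
  then have dvd: "int p dvd Legendre (a * b) p - Legendre a p * Legendre b p"
    by (simp add: cong_iff_dvd_diff)
  have "\<bar>Legendre (a * b) p - Legendre a p * Legendre b p\<bar> \<le> 2"
    using Legendre_values[of "a * b" p] Legendre_values[of a p] Legendre_values[of b p] by auto
  then have "Legendre (a * b) p - Legendre a p * Legendre b p = 0"
    using dvd p(2) by (intro small_multiple_zero)
  then show ?thesis by simp
qed

lemma Legendre_minus_one: "Legendre (-1) (int p) = (if p mod 4 = 1 then 1 else -1)"
proof -
  have "odd p" using p prime_odd_nat by simp
  have eq: "(-1::int) ^ ((p - 1) div 2) = (if p mod 4 = 1 then 1 else -1)"
  proof (cases "p mod 4 = 1")
    case True
    then have "even ((p - 1) div 2)" by presburger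
    then show ?thesis using True by simp
  next
    case False
    then have "odd ((p - 1) div 2)" using \<open>odd p\<close> by presburger
    then show ?thesis using False by simp
  qed
  have "[Legendre (-1) p = (-1) ^ ((p - 1) div 2)] (mod p)" by (rule euler_criterion[OF p])
  then have dvd: "int p dvd Legendre (-1) p - (if p mod 4 = 1 then 1 else -1)"
    unfolding eq by (simp only: cong_iff_dvd_diff)
  have "\<bar>Legendre (-1) p - (if p mod 4 = 1 then 1 else -1)\<bar> \<le> 2"
    using Legendre_values[of "-1" p] by auto
  then have "Legendre (-1) p - (if p mod 4 = 1 then 1 else -1) = 0"
    using dvd p(2) by (intro small_multiple_zero)
  then show ?thesis by simp
qed

text \<open>Gauss's lemma. For \<open>x\<close> up to \<open>h\<close> the double
  \<open>2 * x\<close> is already reduced modulo \<open>p\<close>, so those beyond \<open>h\<close>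
  come exactly from \<open>x > h div 2\<close>.\<close>

lemma Legendre_two: "Legendre 2 (int p) = (if p mod 8 = 1 \<or> p mod 8 = 7 then 1 else -1)"
proof -
  interpret G: GAUSS p 2
  proof
    show "[2 \<noteq> 0] (mod int p)" using p(2) zdvd_imp_le[of "int p" 2] by (auto simp: cong_0_iff)
  qed (use p in auto)
  define h where "h = (p - 1) div 2"
  have "odd p" using p prime_odd_nat by simp
  then have h: "p = 2 * h + 1" by (auto simp: h_def elim!: oddE)
  have hi: "(int p - 1) div 2 = int h" using h by simp
  have "G.E = (\<lambda>x. 2 * int x) ` {h div 2<..h}"
  proof (intro equalityI subsetI)
    fix y assume "y \<in> G.E"
    then obtain x where x: "0 < x" "x \<le> int h" "y = x * 2 mod int p" "int h < y"
      by (auto simp: G.E_def G.C_def G.B_def G.A_def hi)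
    have "x * 2 mod int p = x * 2" using x h by (intro mod_pos_pos_trivial) auto
    then have "y = 2 * int (nat x)" "nat x \<in> {h div 2<..h}" using x by auto
    then show "y \<in> (\<lambda>x. 2 * int x) ` {h div 2<..h}" by blast
  next
    fix y assume "y \<in> (\<lambda>x. 2 * int x) ` {h div 2<..h}"
    then obtain x where x: "y = 2 * int x" "h div 2 < x" "x \<le> h" by auto
    have "int x * 2 mod int p = int x * 2" using x h by (intro mod_pos_pos_trivial) auto
    then have "y = (int x * 2) mod int p" using x by simp
    moreover have "int x \<in> G.A" using x by (auto simp: G.A_def hi)
    ultimately have "y \<in> G.C" unfolding G.C_def G.B_def by blast
    moreover have "int h < y" using x by simp
    ultimately show "y \<in> G.E" by (simp add: G.E_def hi)
  qed
  then have "card G.E = h - h div 2" by (simp add: card_image inj_on_def)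
  then have L: "Legendre 2 (int p) = (-1) ^ (h - h div 2)" using G.gauss_lemma by simp
  have "even (h - h div 2) \<longleftrightarrow> p mod 8 = 1 \<or> p mod 8 = 7" unfolding h by presburger
  then show ?thesis unfolding L by auto
qed

end

lemma prime_int_cases:
  fixes P :: int assumes "prime P" obtains p where "prime p" "P = int p"
  using assms prime_int_nat_transfer[of P] prime_ge_0_int[of P] by (metis nat_0_le)

text \<open>
  By quadratic reciprocity, \<open>Legendre n q * Legendre n r\<close> is \<open>1\<close> for every \<open>n > 0\<close> whose odd prime
  factors all split in the field generated by the square root of \<open>- q * r\<close>.
\<close>

context
  fixes q r :: nat
  assumes q: "prime q" "q > 2" and r: "prime r" "r > 2" and qr: "q \<noteq> r" and mod8: "(q * r) mod 8 = 7"
begin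

lemma qr_mod: "q mod 8 = 1 \<and> r mod 8 = 7 \<or> q mod 8 = 7 \<and> r mod 8 = 1 \<or>
    q mod 8 = 3 \<and> r mod 8 = 5 \<or> q mod 8 = 5 \<and> r mod 8 = 3"
proof -
  have "odd q" "odd r" using q r prime_odd_nat by simp_all
  then have "q mod 8 \<in> {1, 3, 5, 7}" "r mod 8 \<in> {1, 3, 5, 7}" by (simp; presburger)+
  moreover have "((q mod 8) * (r mod 8)) mod 8 = 7" using mod8 by (simp add: mod_mult_eq)
  ultimately show ?thesis by auto
qed

text \<open>The product \<open>q * r\<close> is 3 modulo 4, so exactly one of the two primes
  is.\<close>

lemma Legendre_pair_minus_one: "Legendre (-1) (int q) * Legendre (-1) (int r) = -1"
proof -
  have "q mod 4 = (q mod 8) mod 4" "r mod 4 = (r mod 8) mod 4" by (simp_all add: mod_mod_cancel)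
  then show ?thesis using qr_mod unfolding Legendre_minus_one[OF q] Legendre_minus_one[OF r] by auto
qed

lemma Legendre_pair_two: "Legendre 2 (int q) * Legendre 2 (int r) = 1"
  using qr_mod unfolding Legendre_two[OF q] Legendre_two[OF r] by auto

text \<open>Reciprocity used twice gives \<open>(-1) ^ (a * (b + c))\<close> times the symbols of
  \<open>q\<close> and \<open>r\<close> modulo \<open>p\<close>. As \<open>b + c\<close> is odd, the
  sign is the symbol of \<open>-1\<close> modulo \<open>p\<close>, and altogether the symbol of
  \<open>- int (q * r)\<close> appears.\<close>

lemma Legendre_pair_odd_prime:
  assumes p: "prime p" "p > 2" and split: "Legendre (- int (q * r)) (int p) = 1"
  shows "Legendre (int p) (int q) * Legendre (int p) (int r) = 1"
proof -
  have nd: "\<not> int p dvd - int (q * r)" using split Legendre_eq_1_iff by blast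
  then have "p \<noteq> q" "p \<noteq> r" by auto
  define a b c where "a = (p - 1) div 2" and "b = (q - 1) div 2" and "c = (r - 1) div 2"
  have 1: "Legendre p q * Legendre q p = (-1::int) ^ (a * b)"
    unfolding a_def b_def by (rule Quadratic_Reciprocity) (use p q \<open>p \<noteq> q\<close> in auto)
  have 2: "Legendre p r * Legendre r p = (-1::int) ^ (a * c)"
    unfolding a_def c_def by (rule Quadratic_Reciprocity) (use p r \<open>p \<noteq> r\<close> in auto)
  have "odd p" using p prime_odd_nat by simp
  have "odd (b + c)" using qr_mod unfolding b_def c_def by presburger
  then have "even (a * b + a * c) \<longleftrightarrow> even a" by (simp add: distrib_left[symmetric])
  then have "(-1::int) ^ (a * b) * (-1) ^ (a * c) = (-1) ^ a" unfolding power_add[symmetric] by (simp add: minus_one_power_iff)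
  also have "\<dots> = Legendre (-1) p"
  proof -
    have "even a \<longleftrightarrow> p mod 4 = 1" using \<open>odd p\<close> unfolding a_def by presburger
    then show ?thesis unfolding Legendre_minus_one[OF p] by simp
  qed
  finally have "(Legendre p q * Legendre q p) * (Legendre p r * Legendre r p) = Legendre (-1) p" by (simp only: 1 2)
  moreover have "Legendre (-1) p * (Legendre q p * Legendre r p) = 1"
  proof -
    have "- int (q * r) = (-1) * (int q * int r)" by simp
    then show ?thesis using split by (simp only: Legendre_mult[OF p])
  qed
  ultimately have e1: "Legendre p q * Legendre p r * (Legendre q p * Legendre r p) * (Legendre q p * Legendre r p) = 1"
    and "Legendre (-1) p * (Legendre q p * Legendre r p) = 1" by (simp_all only: mult_ac)
  then have "Legendre q p * Legendre r p = 1 \<or> Legendre q p * Legendre r p = -1"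
    by (simp only: zmult_eq_1_iff) blast
  then show ?thesis using e1 by (elim disjE) (simp_all only: mult_1_right mult_minus1_right minus_minus)
qed

lemma Legendre_pair_positive:
  assumes "n > 0" and "\<And>p. prime p \<Longrightarrow> p > 2 \<Longrightarrow> p dvd n \<Longrightarrow> Legendre (- int (q * r)) (int p) = 1"
  shows "Legendre (int n) (int q) * Legendre (int n) (int r) = 1"
  using assms
proof (induction n rule: less_induct)
  case (less n)
  show ?case
  proof (cases "n = 1")
    case True
    then show ?thesis using Legendre_one[of q] Legendre_one[of r] q r by simp
  next
    case False
    then obtain p where p: "prime p" "p dvd n" using prime_factor_nat by blast
    then obtain m where m: "n = p * m" by (auto simp: dvd_def)
    have m0: "m > 0" using less.prems(1) m by simp
    have mn: "m < n" using m m0 prime_gt_1_nat[OF p(1)] by simp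
    have "Legendre (int m) (int q) * Legendre (int m) (int r) = 1"
      by (rule less.IH[OF mn m0]) (use less.prems(2) m in auto)
    moreover have "Legendre (int p) (int q) * Legendre (int p) (int r) = 1"
    proof (cases "p = 2")
      case True then show ?thesis using Legendre_pair_two by simp
    next
      case False
      then have "p > 2" using prime_ge_2_nat[OF p(1)] by simp
      then show ?thesis using Legendre_pair_odd_prime p less.prems(2) by blast
    qed
    moreover have "Legendre (int n) (int q) * Legendre (int n) (int r) =
      (Legendre (int p) (int q) * Legendre (int p) (int r)) * (Legendre (int m) (int q) * Legendre (int m) (int r))"
      unfolding m of_nat_mult Legendre_mult[OF q] Legendre_mult[OF r] by (simp only: mult_ac)
    ultimately show ?thesis by simp
  qed
qed

text \<open>The sign of \<open>a\<close> contributes the only factor -1, by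
  \<open>Legendre_pair_minus_one\<close>; this turns a nonresidue modulo \<open>r\<close> into a
  residue modulo \<open>q\<close>. It will be applied to \<open>A\<close> and to
  \<open>D\<close>.\<close>

lemma Legendre_transfer_negative:
  fixes a :: int
  assumes "a < 0" and "\<And>p. prime p \<Longrightarrow> p > 2 \<Longrightarrow> int p dvd a \<Longrightarrow> Legendre (- int (q * r)) (int p) = 1"
    and nr: "Legendre a (int r) = -1"
  shows "Legendre a (int q) = 1"
proof -
  define n where "n = nat (- a)"
  have a: "a = (-1) * int n" using assms(1) by (simp add: n_def)
  have "Legendre (int n) (int q) * Legendre (int n) (int r) = 1"
  proof (rule Legendre_pair_positive)
    show "n > 0" using assms(1) by (simp add: n_def)
    fix p assume p: "prime p" "p > 2" "p dvd n"
    then have "int p dvd int n" by simp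
    then have "int p dvd a" by (subst a) simp
    then show "Legendre (- int (q * r)) (int p) = 1" using assms(2) p by blast
  qed
  moreover have "Legendre a (int q) * Legendre a (int r) =
     (Legendre (-1) (int q) * Legendre (-1) (int r)) * (Legendre (int n) (int q) * Legendre (int n) (int r))"
    unfolding a Legendre_mult[OF q] Legendre_mult[OF r] by (simp only: mult_ac)
  ultimately have "Legendre a (int q) * Legendre a (int r) = -1" using Legendre_pair_minus_one by simp
  then show ?thesis using nr by simp
qed

end

section \<open>The auxiliary prime\<close>

lemma real_char_Legendre:
  assumes p: "prime p" "p > 2" and dvd: "p dvd N"
  shows "real_char N (\<lambda>n. if coprime n N then of_int (Legendre (int n) (int p)) else 0)"
  unfolding real_char_def
proof (intro conjI allI)
  fix m n
  have cop: "coprime (n + N) N \<longleftrightarrow> coprime n N" by (simp only: coprime_iff_gcd_eq_1 gcd_add1)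
  have "[int (n + N) = int n] (mod int p)" using dvd by (simp add: cong_iff_dvd_diff)
  from Legendre_cong[OF this]
  show "(if coprime (n + N) N then real_of_int (Legendre (int (n + N)) (int p)) else 0) =
    (if coprime n N then real_of_int (Legendre (int n) (int p)) else 0)" using cop by simp
  have "\<not> p dvd n" if "coprime n N"
  proof
    assume "p dvd n"
    then have "p = 1" using coprime_common_divisor_nat[OF that _ dvd] by blast
    then show False using p by simp
  qed
  then show "((if coprime n N then real_of_int (Legendre (int n) (int p)) else 0) \<noteq> 0) = coprime n N"
    using Legendre_eq_0_iff[of "int n" "int p"] by (cases "coprime n N") simp_all
  show "(if coprime n N then real_of_int (Legendre (int n) (int p)) else 0) \<in> {- 1, 0, 1}"
    using Legendre_values[of "int n" "int p"] by auto
  show "(if coprime (m * n) N then real_of_int (Legendre (int (m * n)) (int p)) else 0) =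
      (if coprime m N then real_of_int (Legendre (int m) (int p)) else 0) *
      (if coprime n N then real_of_int (Legendre (int n) (int p)) else 0)"
    by (simp add: Legendre_mult[OF p])
qed

text \<open>The units modulo 8 are generated by 3 and 5, each of order 2, with product 7, so two
  arbitrary signs determine a character. The sign pairs (-1, 1) and (-1, -1) together separate the
  four classes.\<close>

lemma real_char_mod_8:
  fixes f :: "nat \<Rightarrow> real"
  assumes dvd: "8 dvd N" and period: "\<And>n. f (n mod 8) = f n"
    and vals: "f 1 = 1" "f 3 = s" "f 5 = t" "f 7 = s * t" "s = 1 \<or> s = -1" "t = 1 \<or> t = -1"
  shows "real_char N (\<lambda>n. if coprime n N then f n else 0)"
  unfolding real_char_def
proof (intro conjI allI)
  fix m n
  have cop: "coprime (n + N) N \<longleftrightarrow> coprime n N" by (simp only: coprime_iff_gcd_eq_1 gcd_add1)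
  have "(n + N) mod 8 = n mod 8" using dvd by (auto simp: dvd_def)
  then have "f (n + N) = f n" using period[of "n + N"] period[of n] by simp
  then show "(if coprime (n + N) N then f (n + N) else 0) = (if coprime n N then f n else 0)"
    using cop by simp
  have odd: "n mod 8 \<in> {1, 3, 5, 7}" if "coprime n N" for n
  proof -
    have "odd n"
    proof
      assume "even n"
      moreover have "even N" using dvd by (auto simp: dvd_def)
      ultimately show False using that coprime_common_divisor_nat[of n N 2] by simp
    qed
    then show ?thesis by simp presburger
  qed
  have unit: "f n = 1 \<or> f n = -1" if "coprime n N" for n
    using odd[OF that] vals period[of n] by auto
  then show "((if coprime n N then f n else 0) \<noteq> 0) = coprime n N" by (cases "coprime n N") force+
  show "(if coprime n N then f n else 0) \<in> {- 1, 0, 1}" using unit[of n] by auto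
  have "f (m * n) = f m * f n" if "coprime m N" "coprime n N"
  proof -
    have "f (m * n) = f (((m mod 8) * (n mod 8)) mod 8)" using period[of "m * n"] by (simp add: mod_mult_eq)
    moreover have "f m = f (m mod 8)" "f n = f (n mod 8)" by (simp_all only: period)
    ultimately show ?thesis using odd[OF that(1)] odd[OF that(2)] vals by auto
  qed
  then show "(if coprime (m * n) N then f (m * n) else 0) =
      (if coprime m N then f m else 0) * (if coprime n N then f n else 0)"
    by simp
qed

text \<open>\<open>- int (q * r)\<close> should look like 1 to every quadratic symbol in question.
  For this it is enough that \<open>q\<close> shares its real character values with some
  \<open>k\<close> for which \<open>- (k * r)\<close> really is 1 modulo \<open>N\<close>.\<close>

lemma exists_auxiliary_prime:
  fixes N M r :: nat
  assumes N: "N > 0" "8 dvd N" and r: "coprime r N"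
  obtains q where "prime q" "q > M" "(q * r) mod 8 = 7"
    "\<And>p. prime p \<Longrightarrow> p > 2 \<Longrightarrow> p dvd N \<Longrightarrow> Legendre (- int (q * r)) (int p) = 1"
proof -
  obtain x where x: "[r * x = 1] (mod N)" using cong_solve_coprime_nat[OF r] by auto
  \<comment> \<open>\<open>N - 1\<close> plays the part of -1 among the natural numbers, so
    \<open>k\<close> is \<open>- 1 / r\<close> modulo \<open>N\<close>.\<close>
  define k where "k = x * (N - 1)"
  have "[r * x * (N - 1) + 1 = 1 * (N - 1) + 1] (mod N)" by (intro cong_add cong_mult x cong_refl)
  then have "[r * k + 1 = N] (mod N)" using N(1) by (simp add: k_def mult.assoc)
  then have "[r * k + 1 = 0] (mod N)" using cong_trans[of "r * k + 1" N N 0] by (simp add: cong_0_iff)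
  then have k: "N dvd r * k + 1" by (simp only: cong_0_iff)
  have cop: "coprime k N"
  proof (rule coprimeI)
    fix d assume "d dvd k" "d dvd N"
    then have "d dvd r * k + 1" "d dvd r * k" using k by auto
    then show "is_unit d" using dvd_add_right_iff[of d "r * k" 1] by blast
  qed
  have inf: "infinite {q. prime q \<and> (\<forall>\<psi>. real_char N \<psi> \<longrightarrow> \<psi> q = \<psi> k)}"
    by (rule infinite_primes_with_char_values[OF N(1) cop])
  then have "\<exists>q>M. q \<in> {q. prime q \<and> (\<forall>\<psi>. real_char N \<psi> \<longrightarrow> \<psi> q = \<psi> k)}"
    unfolding infinite_nat_iff_unbounded by (rule spec)
  then obtain q where q: "q > M" "prime q" "\<forall>\<psi>. real_char N \<psi> \<longrightarrow> \<psi> q = \<psi> k"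
    unfolding mem_Collect_eq by (elim exE conjE)
  have "principal_char N q = principal_char N k" by (rule q(3)[rule_format, OF real_char_principal])
  then have qN: "coprime q N" using cop by (auto simp: principal_char_def split: if_splits)
  have char_eq: "f q = f k" if "real_char N (\<lambda>n. if coprime n N then f n else 0)" for f :: "nat \<Rightarrow> real"
    using q(3)[rule_format, OF that] qN cop by simp
  have "Legendre (- int (q * r)) (int p) = 1" if p: "prime p" "p > 2" "p dvd N" for p
  proof -
    have "Legendre (int q) (int p) = Legendre (int k) (int p)"
      using char_eq[OF real_char_Legendre[OF p]] by simp
    moreover have "- int (q * r) = (- int r) * int q" "- int (k * r) = (- int r) * int k" by simp_all
    ultimately have "Legendre (- int (q * r)) (int p) = Legendre (- int (k * r)) (int p)"
      by (simp only: Legendre_mult[OF p(1,2)])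
    also have "\<dots> = Legendre 1 (int p)"
    proof (rule Legendre_cong)
      have "int p dvd int (r * k + 1)" using k p(3) by (meson dvd_trans int_dvd_int_iff)
      then have "int p dvd - int (r * k + 1)" by (simp only: dvd_minus_iff)
      moreover have "- int (r * k + 1) = - int (k * r) - 1" by simp
      ultimately show "[- int (k * r) = 1] (mod int p)" by (simp only: cong_iff_dvd_diff)
    qed
    also have "\<dots> = 1" using p by (intro Legendre_one) simp
    finally show ?thesis .
  qed
  moreover have "(q * r) mod 8 = 7"
  proof -
    let ?f = "\<lambda>n::nat. if n mod 4 = 1 then 1 else (-1::real)"
    let ?g = "\<lambda>n::nat. if n mod 8 = 1 \<or> n mod 8 = 7 then 1 else (-1::real)"
    have f: "?f q = ?f k"
      by (rule char_eq, rule real_char_mod_8[where s = "-1" and t = 1]) (use N in \<open>simp_all add: mod_mod_cancel\<close>)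
    have g: "?g q = ?g k"
      by (rule char_eq, rule real_char_mod_8[where s = "-1" and t = "-1"]) (use N in simp_all)
    have oddq: "odd q" and oddk: "odd k"
    proof -
      have "even N" using N(2) by (auto simp: dvd_def)
      then show "odd q" "odd k"
        using coprime_common_divisor_nat[OF qN, of 2] coprime_common_divisor_nat[OF cop, of 2] by auto
    qed
    have q4: "q mod 4 = 1 \<longleftrightarrow> k mod 4 = 1" using f by (auto split: if_splits)
    have q8: "(q mod 8 = 1 \<or> q mod 8 = 7) \<longleftrightarrow> (k mod 8 = 1 \<or> k mod 8 = 7)" using g by (auto split: if_splits)
    have "q mod 8 = k mod 8"
    proof -
      have odd_mod: "n mod 8 = 1 \<or> n mod 8 = 3 \<or> n mod 8 = 5 \<or> n mod 8 = 7" if "odd n" for n :: nat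
        using that by presburger
      have "n mod 4 = (n mod 8) mod 4" for n :: nat by (simp add: mod_mod_cancel)
      then have "(q mod 8) mod 4 = 1 \<longleftrightarrow> (k mod 8) mod 4 = 1" using q4 by simp
      then show ?thesis using odd_mod[OF oddq] odd_mod[OF oddk] q8 by auto
    qed
    then have "(q * r) mod 8 = (k * r) mod 8" by (rule mod_mult_cong) simp
    then have qk: "(q * r) mod 8 = (r * k) mod 8" by (simp only: mult.commute)
    have "8 dvd r * k + 1" using N(2) k by (rule dvd_trans)
    moreover have "n mod 8 = 7" if "8 dvd n + 1" for n :: nat using that by presburger
    ultimately have "(r * k) mod 8 = 7" by blast
    then show ?thesis using qk by simp
  qed
  ultimately show thesis using that[OF q(2,1)] by simp
qed

section \<open>Squares of pure quaternions\<close>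

text \<open>
  With \<open>c = - r * q\<close> the hypotheses say that \<open>b * c\<close> is a norm from the field of \<open>sqrt a\<close> and \<open>c\<close> a norm
  from the field of \<open>sqrt (a * d)\<close>.
\<close>

lemma pure_quat_square_of_norms:
  fixes a b d q r x y z u v :: rat
  assumes nz: "a \<noteq> 0" "b \<noteq> 0" "z \<noteq> 0" "v \<noteq> 0" "r \<noteq> 0"
    and e1: "- (b * q * z\<^sup>2) = r * (x\<^sup>2 - a * y\<^sup>2)" and e2: "- (r * q) = u\<^sup>2 - a * d * v\<^sup>2"
  shows "\<exists>x y z. d = a * x\<^sup>2 + b * y\<^sup>2 - a * b * z\<^sup>2"
proof (intro exI)
  \<comment> \<open>The factor \<open>- 1 / a\<close> is the norm of \<open>sqrt a / a\<close>;
    multiplying the norm \<open>x\<^sup>2 - a * y\<^sup>2\<close> by it swaps \<open>x\<close> and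
    \<open>y\<close>. The scale \<open>w\<close> makes this part contribute exactly
    \<open>r * q / (a * v\<^sup>2)\<close>, which \<open>e2\<close> completes to
    \<open>d\<close>.\<close>
  define w where "w = r / (b * z * v)"
  have "b * (y * w)\<^sup>2 - a * b * (x / a * w)\<^sup>2 = - (b * w\<^sup>2) * (x\<^sup>2 - a * y\<^sup>2) / a"
    using nz by (simp add: field_simps power2_eq_square)
  also have "\<dots> = - (b * w\<^sup>2) * (- (b * q * z\<^sup>2) / r) / a" using nz unfolding e1 by simp
  also have "\<dots> = (b * z * w)\<^sup>2 * q / (r * a)" by (simp add: power2_eq_square mult_ac)
  also have "b * z * w = r / v" using nz by (simp add: w_def)
  also have "(r / v)\<^sup>2 * q / (r * a) = r * q / (a * v\<^sup>2)" using nz by (simp add: power2_eq_square field_simps)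
  also have "\<dots> = (a * d * v\<^sup>2 - u\<^sup>2) / (a * v\<^sup>2)" using e2 by (simp add: minus_equation_iff)
  also have "\<dots> = d - a * (u / (a * v))\<^sup>2" using nz by (simp add: power2_eq_square field_simps)
  finally show "d = a * (u / (a * v))\<^sup>2 + b * (y * w)\<^sup>2 - a * b * (x / a * w)\<^sup>2" by linarith
qed

lemma squarefree_mult_imp_coprime:
  fixes m n :: int
  assumes "squarefree (m * n)"
  shows "coprime m n"
proof (rule coprimeI)
  fix d assume "d dvd m" "d dvd n"
  then have "d\<^sup>2 dvd m * n" by (simp add: power2_eq_square mult_dvd_mono)
  then show "is_unit d" using assms unfolding squarefree_def by blast
qed

lemma prime_not_dvd_less: "m \<noteq> 0 \<Longrightarrow> \<bar>m\<bar> < int q \<Longrightarrow> \<not> int q dvd m" for m :: int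
  using dvd_imp_le_int[of m "int q"] by auto

text \<open>Symbols that occur twice in a product of Legendre symbols are collected in
  \<open>k\<close>; whatever they are, they cannot let the remaining symbol be -1.\<close>

lemma mult_square_eq_1_int:
  fixes u k :: int
  assumes "u * (k * k) = 1"
  shows "u \<noteq> -1"
proof
  assume "u = -1"
  then have "k * k = -1" using assms by simp
  then show False using zero_le_square[of k] by linarith
qed

lemma pure_quat_square_of_local_int:
  fixes A B D :: int and r :: nat
  assumes r: "prime r" "r > 2"
    and neg: "A < 0" "B < 0" "D < 0" and sqf: "squarefree A" "squarefree B" and rA: "\<not> int r dvd A"
    and iso: "\<And>p. prime p \<Longrightarrow> p \<noteq> r \<Longrightarrow> quat_isotropic p (of_int A) (of_int B)"
    and aniso: "\<not> conic_isotropic r (of_int A) (of_int B)"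
    and D: "\<not> QuadRes (int r) D"
  shows "\<exists>x y z :: rat. of_int D = of_int A * x\<^sup>2 + of_int B * y\<^sup>2 - of_int A * of_int B * z\<^sup>2"
proof -
  have oddr: "odd r" using r prime_odd_nat by simp
  have LA: "Legendre A (int r) = -1" and rB: "int r dvd B"
    using not_conic_isotropic_imp[OF r(1) oddr aniso rA] QuadRes_iff_Legendre by auto
  have LD: "Legendre D (int r) = -1" using D QuadRes_iff_Legendre by blast
  have rD: "\<not> int r dvd D" using LD Legendre_eq_0_iff[of D "int r"] by auto
  \<comment> \<open>The factor 8 controls \<open>q\<close> modulo 8. The factors from
    \<open>A\<close> and \<open>D\<close> cover all odd primes at which reciprocity or one of the
    two ternary equations needs \<open>- r * q\<close> to be a square.\<close>
  define N where "N = 8 * nat \<bar>A\<bar> * nat \<bar>D\<bar>"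
  have dvdN: "p dvd N" if "int p dvd A * D" for p
  proof -
    have "int p dvd 8 * (\<bar>A\<bar> * \<bar>D\<bar>)" using that by (simp add: abs_mult[symmetric])
    also have "8 * (\<bar>A\<bar> * \<bar>D\<bar>) = int N" by (simp add: N_def)
    finally show ?thesis by (simp only: int_dvd_int_iff)
  qed
  have N: "N > 0" "8 dvd N" using neg by (auto simp: N_def)
  have "coprime r N"
  proof -
    have "\<not> r dvd N"
    proof
      assume "r dvd N"
      then have "int r dvd int N" by simp
      then have "int r dvd 2 ^ 3 * (A * D)" using neg by (simp add: N_def mult.assoc abs_mult[symmetric] abs_of_pos mult_neg_neg)
      moreover have "prime (int r)" using r by simp
      moreover have "\<not> int r dvd 2 ^ 3" using r prime_dvd_power[of "int r" 2 3] zdvd_imp_le[of "int r" 2] by auto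
      ultimately show False using rA rD by (simp add: prime_dvd_mult_iff)
    qed
    then show ?thesis using r(1) prime_imp_coprime by blast
  qed
  \<comment> \<open>Size alone keeps \<open>q\<close> different from \<open>r\<close> and prime to
    \<open>A\<close>, \<open>B\<close> and \<open>D\<close>.\<close>
  then obtain q where q: "prime q" "q > max r (max (nat \<bar>A\<bar>) (max (nat \<bar>B\<bar>) (nat \<bar>D\<bar>)))" and qr8: "(q * r) mod 8 = 7"
    and split: "\<And>p. prime p \<Longrightarrow> p > 2 \<Longrightarrow> p dvd N \<Longrightarrow> Legendre (- int (q * r)) (int p) = 1"
    using exists_auxiliary_prime[OF N] by blast
  have q2: "q > 2" "q \<noteq> r" using q(2) r by auto
  have qA: "\<not> int q dvd A" and qB: "\<not> int q dvd B" and qD: "\<not> int q dvd D"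
  proof -
    have "\<bar>A\<bar> < int q" "\<bar>B\<bar> < int q" "\<bar>D\<bar> < int q" using q(2) by (simp_all, linarith+)
    moreover have "A \<noteq> 0" "B \<noteq> 0" "D \<noteq> 0" using neg by simp_all
    ultimately show "\<not> int q dvd A" "\<not> int q dvd B" "\<not> int q dvd D"
      by - (rule prime_not_dvd_less; assumption)+
  qed
  have LAq: "Legendre A (int q) = 1"
  proof (rule Legendre_transfer_negative[OF q(1) q2(1) r q2(2) qr8 neg(1) _ LA])
    fix p assume "prime p" "p > 2" "int p dvd A"
    then show "Legendre (- int (q * r)) (int p) = 1" using split dvdN by (meson dvd_mult2)
  qed
  have LDq: "Legendre D (int q) = 1"
  proof (rule Legendre_transfer_negative[OF q(1) q2(1) r q2(2) qr8 neg(3) _ LD])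
    fix p assume "prime p" "p > 2" "int p dvd D"
    then show "Legendre (- int (q * r)) (int p) = 1" using split dvdN by (meson dvd_mult)
  qed
  have pq: "prime (int q)" and pr: "prime (int r)" using q r by simp_all

  \<comment> \<open>With \<open>A = - (g * \<alpha>)\<close> and
    \<open>B = - (g * r * \<beta>)\<close>, the equation that makes \<open>B * c\<close> a norm from
    the field of \<open>sqrt A\<close> becomes, after cancelling \<open>g\<close> and
    \<open>r\<close>, \<open>g * x\<^sup>2 + \<alpha> * y\<^sup>2 = \<beta> * q * z\<^sup>2\<close>.
    Taking out the gcd makes the coefficients pairwise coprime.\<close>
  define g where "g = gcd A B"
  have g: "g > 0" using neg by (simp add: g_def)
  obtain a0 where a0: "A = g * a0" using gcd_dvd1[of A B] by (auto simp: g_def dvd_def)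
  obtain b0 where b0: "B = g * b0" using gcd_dvd2[of A B] by (auto simp: g_def dvd_def)
  have rg: "\<not> int r dvd g" using rA a0 by auto
  then have "int r dvd b0" using rB b0 pr by (simp add: prime_dvd_mult_iff)
  then obtain b1 where b1: "b0 = int r * b1" by (auto simp: dvd_def)
  define \<alpha> \<beta> where "\<alpha> = - a0" and "\<beta> = - b1"
  have A: "A = - (g * \<alpha>)" and B: "B = - (g * (int r * \<beta>))" by (simp_all add: a0 b0 b1 \<alpha>_def \<beta>_def)
  have \<alpha>: "\<alpha> > 0" using neg(1) g A by (simp add: zero_less_mult_iff)
  have \<beta>: "\<beta> > 0" using neg(2) g r(1) prime_gt_0_nat[OF r(1)] B by (simp add: zero_less_mult_iff)
  have "squarefree (g * \<alpha>)" using sqf(1) A by simp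
  then have sg: "squarefree g" "squarefree \<alpha>" and cga: "coprime g \<alpha>"
    using squarefree_multD squarefree_mult_imp_coprime by blast+
  have "squarefree (g * (int r * \<beta>))" using sqf(2) B by simp
  then have sB: "squarefree (int r * \<beta>)" and cgrb: "coprime g (int r * \<beta>)"
    using squarefree_multD squarefree_mult_imp_coprime by blast+
  then have sb: "squarefree \<beta>" and crb: "coprime (int r) \<beta>"
    using squarefree_multD squarefree_mult_imp_coprime by blast+
  have "coprime a0 b0"
  proof -
    have "gcd (A div g) (B div g) = 1" unfolding g_def using neg div_gcd_coprime[of A B] by (simp add: coprime_iff_gcd_eq_1)
    then show ?thesis using a0 b0 g by (simp add: coprime_iff_gcd_eq_1)
  qed
  then have carb: "coprime \<alpha> (int r * \<beta>)" by (simp add: b1 \<alpha>_def \<beta>_def)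
  have qg: "\<not> int q dvd g" and qa: "\<not> int q dvd \<alpha>" and qb: "\<not> int q dvd \<beta>" using qA qB A B by auto
  have cq: "coprime (int q) g" "coprime (int q) \<alpha>" "coprime (int q) \<beta>"
    using pq qg qa qb prime_imp_coprime by blast+
  have rb: "\<not> int r dvd \<beta>"
    using crb pr by (metis coprime_absorb_left not_prime_unit)

  have split': "Legendre (-1) (int p) * (Legendre (int q) (int p) * Legendre (int r) (int p)) = 1"
    if "prime p" "p > 2" "int p dvd A * D" for p
  proof -
    have "Legendre ((-1) * (int q * int r)) (int p) = 1" using split[OF that(1,2) dvdN[OF that(3)]] by simp
    then show ?thesis by (simp only: Legendre_mult[OF that(1,2)])
  qed
  \<comment> \<open>Here \<open>p\<close> divides both entries: isotropy makes
    \<open>- (A / p) * (B / p)\<close> a residue, the choice of \<open>q\<close> makes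
    \<open>- r * q\<close> one, and their product is \<open>\<alpha> * \<beta> * q\<close> up to
    squares.\<close>
  have res1: "QuadRes g (\<alpha> * (\<beta> * int q))"
  proof (rule QuadRes_squarefree_modulus[OF g sg(1)])
    fix P :: int assume P: "prime P" "odd P" "P dvd g"
    obtain p where p: "prime p" "P = int p" using P(1) by (rule prime_int_cases)
    have p2: "p > 2" using p P prime_ge_2_nat[OF p(1)] by (cases "p = 2") auto
    note L = Legendre_mult[OF p(1) p2]
    obtain g' where g': "g = int p * g'" using P p by (auto simp: dvd_def)
    have npg: "\<not> int p dvd g'"
    proof
      assume "int p dvd g'"
      then have "(int p)\<^sup>2 dvd g" by (simp add: g' power2_eq_square)
      then show False using sg(1) P(1) p(2) unfolding squarefree_def by (metis not_prime_unit)
    qed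
    have npa: "\<not> int p dvd \<alpha>" and npb: "\<not> int p dvd int r * \<beta>"
      using P p cga cgrb by (meson coprime_common_divisor not_prime_unit)+
    have pr': "p \<noteq> r" using npb by auto
    have "QuadRes (int p) (- ((- (g' * \<alpha>)) * (- (g' * (int r * \<beta>)))))"
    proof (rule quat_isotropic_imp_QuadRes_both[OF p(1)])
      have "A = int p * (- (g' * \<alpha>))" "B = int p * (- (g' * (int r * \<beta>)))" unfolding A B g' by simp_all
      then show "quat_isotropic p (of_int (int p * (- (g' * \<alpha>)))) (of_int (int p * (- (g' * (int r * \<beta>)))))"
        using iso[OF p(1) pr'] by simp
      show "\<not> int p dvd - (g' * \<alpha>)" "\<not> int p dvd - (g' * (int r * \<beta>))"
        using npg npa npb P(1) p(2) by (auto simp: prime_dvd_mult_iff)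
    qed
    moreover have "- ((- (g' * \<alpha>)) * (- (g' * (int r * \<beta>)))) = (-1) * (g' * (\<alpha> * (g' * (int r * \<beta>))))" by simp
    moreover have "\<not> int p dvd (-1) * (g' * (\<alpha> * (g' * (int r * \<beta>))))"
      using npg npa npb P(1) p(2) by (auto simp: prime_dvd_mult_iff)
    ultimately have "Legendre ((-1) * (g' * (\<alpha> * (g' * (int r * \<beta>))))) (int p) = 1" by (simp only: Legendre_eq_1_iff simp_thms)
    then have 1: "Legendre (-1) (int p) * (Legendre g' (int p) * (Legendre \<alpha> (int p) * (Legendre g' (int p) * (Legendre r (int p) * Legendre \<beta> (int p))))) = 1"
      by (simp only: L)
    have 2: "Legendre (-1) (int p) * (Legendre (int q) (int p) * Legendre (int r) (int p)) = 1"
      using split'[OF p(1) p2] P p A by (simp add: dvd_mult2)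
    let ?k = "Legendre (-1) (int p) * (Legendre g' (int p) * Legendre r (int p))"
    have "Legendre (\<alpha> * (\<beta> * int q)) (int p) * (?k * ?k) =
        (Legendre (-1) (int p) * (Legendre g' (int p) * (Legendre \<alpha> (int p) * (Legendre g' (int p) * (Legendre r (int p) * Legendre \<beta> (int p)))))) *
        (Legendre (-1) (int p) * (Legendre (int q) (int p) * Legendre (int r) (int p)))"
      unfolding L by (simp only: mult_ac)
    then have "Legendre (\<alpha> * (\<beta> * int q)) (int p) * (?k * ?k) = 1" by (simp only: 1 2 mult_1_right)
    then have "Legendre (\<alpha> * (\<beta> * int q)) (int p) \<noteq> -1" by (rule mult_square_eq_1_int)
    then show "QuadRes P (\<alpha> * (\<beta> * int q))" unfolding p(2) QuadRes_iff_Legendre .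
  qed
  \<comment> \<open>Here \<open>p\<close> divides \<open>A\<close> alone, so isotropy makes
    \<open>B\<close> a residue, and \<open>B * (- r * q)\<close> is \<open>g * \<beta> * q\<close>
    up to squares.\<close>
  have res2: "QuadRes \<alpha> (g * (\<beta> * int q))"
  proof (rule QuadRes_squarefree_modulus[OF \<alpha> sg(2)])
    fix P :: int assume P: "prime P" "odd P" "P dvd \<alpha>"
    obtain p where p: "prime p" "P = int p" using P(1) by (rule prime_int_cases)
    have p2: "p > 2" using p P prime_ge_2_nat[OF p(1)] by (cases "p = 2") auto
    note L = Legendre_mult[OF p(1) p2]
    have npg: "\<not> int p dvd g" and npb: "\<not> int p dvd int r * \<beta>"
      using P p cga carb by (meson coprime_common_divisor not_prime_unit)+
    have pr': "p \<noteq> r" using npb by auto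
    have pA: "int p dvd A" using P p A by simp
    have pB: "\<not> int p dvd B" unfolding B using npg npb P p by (simp add: prime_dvd_mult_iff)
    have "QuadRes (int p) B" by (rule quat_isotropic_imp_QuadRes[OF p(1) iso[OF p(1) pr'] pA sqf(1) pB])
    then have "Legendre B (int p) = 1" using pB by (simp only: Legendre_eq_1_iff simp_thms)
    moreover have "B = (-1) * (g * (int r * \<beta>))" by (simp add: B)
    ultimately have 1: "Legendre (-1) (int p) * (Legendre g (int p) * (Legendre r (int p) * Legendre \<beta> (int p))) = 1"
      by (simp only: L)
    have 2: "Legendre (-1) (int p) * (Legendre (int q) (int p) * Legendre (int r) (int p)) = 1"
      using split'[OF p(1) p2] pA by (simp add: dvd_mult2)
    let ?k = "Legendre (-1) (int p) * Legendre r (int p)"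
    have "Legendre (g * (\<beta> * int q)) (int p) * (?k * ?k) =
        (Legendre (-1) (int p) * (Legendre g (int p) * (Legendre r (int p) * Legendre \<beta> (int p)))) *
        (Legendre (-1) (int p) * (Legendre (int q) (int p) * Legendre (int r) (int p)))"
      unfolding L by (simp only: mult_ac)
    then have "Legendre (g * (\<beta> * int q)) (int p) * (?k * ?k) = 1" by (simp only: 1 2 mult_1_right)
    then have "Legendre (g * (\<beta> * int q)) (int p) \<noteq> -1" by (rule mult_square_eq_1_int)
    then show "QuadRes P (g * (\<beta> * int q))" unfolding p(2) QuadRes_iff_Legendre .
  qed
  have sbq: "squarefree (\<beta> * int q)"
    using sb cq(3) squarefree_prime[of "int q"] pq by (intro squarefree_mult_coprime) (simp_all add: coprime_commute)
  have bq: "\<beta> * int q > 0" using \<beta> prime_gt_0_nat[OF q(1)] by simp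
  \<comment> \<open>The number in question is \<open>A\<close>. At primes of \<open>\<beta>\<close>,
    which divide \<open>B\<close> alone, isotropy makes it a residue; at \<open>q\<close> this is
    what reciprocity provided.\<close>
  have res3: "QuadRes (\<beta> * int q) (- (g * \<alpha>))"
  proof (rule QuadRes_squarefree_modulus[OF bq sbq])
    fix P :: int assume P: "prime P" "odd P" "P dvd \<beta> * int q"
    obtain p where p: "prime p" "P = int p" using P(1) by (rule prime_int_cases)
    show "QuadRes P (- (g * \<alpha>))"
    proof (cases "p = q")
      case True
      then show ?thesis using LAq by (simp add: p(2) A[symmetric] Legendre_eq_1_iff)
    next
      case False
      then have "\<not> int p dvd int q" using primes_dvd_imp_eq[OF p(1) q(1)] by auto
      then have pb: "int p dvd \<beta>" using P p by (simp add: prime_dvd_mult_iff)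
      have pr': "p \<noteq> r" using pb rb by auto
      have npg: "\<not> int p dvd g" and npa: "\<not> int p dvd \<alpha>"
        using P(1) p pb cgrb carb by (meson coprime_common_divisor not_prime_unit dvd_mult)+
      have pA: "\<not> int p dvd A" unfolding A using npg npa P p by (simp add: prime_dvd_mult_iff)
      have pB: "int p dvd B" unfolding B using pb by simp
      have "QuadRes (int p) A"
        by (rule quat_isotropic_imp_QuadRes[OF p(1) quat_isotropic_commute[OF p(1) iso[OF p(1) pr']] pB sqf(2) pA])
      then show ?thesis by (simp add: p(2) A[symmetric])
    qed
  qed
  obtain x1 y1 z1 where e1: "g * x1\<^sup>2 + \<alpha> * y1\<^sup>2 = \<beta> * int q * z1\<^sup>2" and nz1: "\<not> (x1 = 0 \<and> y1 = 0 \<and> z1 = 0)"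
  proof (rule legendre_ternary[OF g \<alpha> bq cga _ _ res1 res2 res3])
    show "coprime g (\<beta> * int q)" "coprime \<alpha> (\<beta> * int q)"
      using cgrb carb cq by (simp_all add: coprime_commute)
  qed
  have z1: "z1 \<noteq> 0"
  proof
    assume "z1 = 0"
    then have "g * x1\<^sup>2 + \<alpha> * y1\<^sup>2 = 0" using e1 by simp
    moreover have "g * x1\<^sup>2 \<ge> 0" "\<alpha> * y1\<^sup>2 \<ge> 0" using g \<alpha> by simp_all
    ultimately have "g * x1\<^sup>2 = 0" "\<alpha> * y1\<^sup>2 = 0" by linarith+
    then show False using g \<alpha> nz1 \<open>z1 = 0\<close> by simp
  qed

  \<comment> \<open>The second equation makes \<open>c\<close> a norm from the field of
    \<open>sqrt (A * D)\<close>, so only the square class \<open>w\<close> matters. It is positive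
    because both factors are negative, and a residue modulo \<open>r\<close> because both are
    nonresidues.\<close>
  define w s where "w = squarefree_part (A * D)" and "s = square_part (A * D)"
  have AD: "A * D = w * s\<^sup>2" unfolding w_def s_def by (rule squarefree_decompose)
  have ADpos: "A * D > 0" using neg by (simp add: mult_neg_neg)
  have s0: "s \<noteq> 0" using AD ADpos by auto
  have w0: "w > 0" using AD ADpos s0 by (simp add: zero_less_mult_iff)
  have sw: "squarefree w" by (simp add: w_def)
  have rw: "Legendre w (int r) = 1"
  proof -
    have "Legendre (A * D) (int r) = 1" by (simp add: Legendre_mult[OF r] LA LD)
    then have "Legendre w (int r) * (Legendre s (int r) * Legendre s (int r)) = 1"
      unfolding AD power2_eq_square by (simp only: Legendre_mult[OF r])
    then show ?thesis using Legendre_values[of s "int r"] by auto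
  qed
  have qw: "Legendre w (int q) = 1"
  proof -
    have "Legendre (A * D) (int q) = 1" by (simp add: Legendre_mult[OF q(1) q2(1)] LAq LDq)
    then have "Legendre w (int q) * (Legendre s (int q) * Legendre s (int q)) = 1"
      unfolding AD power2_eq_square by (simp only: Legendre_mult[OF q(1) q2(1)])
    then show ?thesis using Legendre_values[of s "int q"] by auto
  qed
  have "\<not> int r dvd int q" using primes_dvd_imp_eq[OF r(1) q(1)] q2 by auto
  then have crq: "coprime (int r) (int q)" using pr prime_imp_coprime by blast
  have srq: "squarefree (int r * int q)"
    using crq pr pq by (intro squarefree_mult_coprime squarefree_prime) auto
  have rq: "int r * int q > 0" using r q prime_gt_0_nat by simp
  have "QuadRes 1 (int r * int q * w)" by (auto simp: QuadRes_iff)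
  moreover have "QuadRes (int r * int q) (1 * w)"
  proof (rule QuadRes_squarefree_modulus[OF rq srq])
    fix P :: int assume P: "prime P" "odd P" "P dvd int r * int q"
    then have "P dvd int r \<or> P dvd int q" by (simp add: prime_dvd_mult_iff)
    then have "P = int r \<or> P = int q" using primes_dvd_imp_eq[OF P(1)] pr pq by auto
    then show "QuadRes P (1 * w)" using rw qw by (auto simp: Legendre_eq_1_iff)
  qed
  moreover have "QuadRes w (- (1 * (int r * int q)))"
  proof (rule QuadRes_squarefree_modulus[OF w0 sw])
    fix P :: int assume P: "prime P" "odd P" "P dvd w"
    obtain p where p: "prime p" "P = int p" using P(1) by (rule prime_int_cases)
    have p2: "p > 2" using p P prime_ge_2_nat[OF p(1)] by (cases "p = 2") auto
    have "int p dvd A * D" using P p by (simp add: AD)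
    then have "Legendre (- int (q * r)) (int p) = 1" using split[OF p(1) p2] dvdN by blast
    then show "QuadRes P (- (1 * (int r * int q)))" by (simp add: p(2) Legendre_eq_1_iff mult.commute)
  qed
  moreover have "coprime (int r * int q) w"
  proof -
    have "\<not> int r dvd w" "\<not> int q dvd w" using rw qw by (simp_all add: Legendre_eq_1_iff)
    then have "coprime (int r) w" "coprime (int q) w" using pr pq prime_imp_coprime by blast+
    then show ?thesis by simp
  qed
  ultimately obtain x2 y2 z2 where e2: "1 * x2\<^sup>2 + int r * int q * y2\<^sup>2 = w * z2\<^sup>2" and nz2: "\<not> (x2 = 0 \<and> y2 = 0 \<and> z2 = 0)"
    using legendre_ternary[of 1 "int r * int q" w] rq w0 by auto
  have z2: "z2 \<noteq> 0"
  proof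
    assume "z2 = 0"
    then have "x2\<^sup>2 + int r * int q * y2\<^sup>2 = 0" using e2 by simp
    moreover have "x2\<^sup>2 \<ge> 0" "int r * int q * y2\<^sup>2 \<ge> 0" using rq by simp_all
    ultimately have x2: "x2\<^sup>2 = 0" and "int r * int q * y2\<^sup>2 = 0" by linarith+
    moreover have "int r * int q \<noteq> 0" using rq by linarith
    ultimately have "y2\<^sup>2 = 0" using mult_eq_0_iff by blast
    then show False using x2 nz2 \<open>z2 = 0\<close> by simp
  qed
  have AD': "of_int A * of_int D = (of_int w * (of_int s)\<^sup>2 :: rat)"
    unfolding of_int_mult[symmetric] of_int_power[symmetric] AD ..
  have A0: "(of_int A :: rat) \<noteq> 0" and B0: "(of_int B :: rat) \<noteq> 0" using neg by auto
  show ?thesis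
  \<comment> \<open>If \<open>y2 = 0\<close>, then \<open>w\<close> and with it \<open>A * D\<close>
    is a rational square, and a multiple of \<open>i\<close> alone has square \<open>D\<close>.
    Otherwise division by \<open>y2\<close> gives the norm equation.\<close>
  proof (cases "y2 = 0")
    case True
    then have "x2\<^sup>2 = w * z2\<^sup>2" using e2 by simp
    then have "(of_int x2)\<^sup>2 = (of_int w * (of_int z2)\<^sup>2 :: rat)" by (simp only: of_int_mult[symmetric] of_int_power[symmetric])
    then have w: "(of_int w :: rat) = (of_int x2 / of_int z2)\<^sup>2" using z2 by (simp add: power_divide field_simps)
    have "(of_int D :: rat) = of_int A * of_int D / of_int A" using A0 by simp
    also have "\<dots> = of_int A * (of_int x2 / of_int z2 * of_int s / of_int A)\<^sup>2"
      unfolding AD' w using A0 by (simp add: power_divide power_mult_distrib power2_eq_square mult_ac)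
    finally show ?thesis by (intro exI[of _ "of_int x2 / of_int z2 * of_int s / of_int A"] exI[of _ 0]) simp
  next
    case False
    define u v :: rat where "u = of_int x2 / of_int y2" and "v = of_int z2 / (of_int s * of_int y2)"
    have v0: "v \<noteq> 0" using z2 s0 False by (simp add: v_def)
    have "of_int (1 * x2\<^sup>2 + int r * int q * y2\<^sup>2) = (of_int (w * z2\<^sup>2) :: rat)" using e2 by (simp only:)
    then have "- (of_nat r * of_nat q) = u\<^sup>2 - of_int w * (of_int z2 / of_int y2)\<^sup>2"
      using False by (simp add: u_def power_divide field_simps)
    also have "of_int w * (of_int z2 / of_int y2)\<^sup>2 = of_int A * of_int D * v\<^sup>2"
      unfolding AD' v_def using s0 by (simp add: power_divide power_mult_distrib)
    finally have f2: "- (of_nat r * of_nat q) = u\<^sup>2 - of_int A * of_int D * v\<^sup>2" .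
    have "- (B * int q * z1\<^sup>2) = int r * ((g * x1)\<^sup>2 - A * y1\<^sup>2)"
    proof -
      have "- (B * int q * z1\<^sup>2) = int r * (g * (\<beta> * int q * z1\<^sup>2))" by (simp add: B)
      also have "\<dots> = int r * (g * (g * x1\<^sup>2 + \<alpha> * y1\<^sup>2))" unfolding e1 ..
      also have "\<dots> = int r * ((g * x1)\<^sup>2 - A * y1\<^sup>2)" by (simp add: A power2_eq_square algebra_simps)
      finally show ?thesis .
    qed
    then have "of_int (- (B * int q * z1\<^sup>2)) = (of_int (int r * ((g * x1)\<^sup>2 - A * y1\<^sup>2)) :: rat)" by (simp only:)
    then have f1: "- (of_int B * of_nat q * (of_int z1)\<^sup>2) = of_nat r * ((of_int g * of_int x1)\<^sup>2 - of_int A * (of_int y1)\<^sup>2 :: rat)"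
      by simp
    show ?thesis
      by (rule pure_quat_square_of_norms[OF A0 B0 _ v0 _ f1 f2]) (use z1 r in auto)
  qed
qed

section \<open>Reduction to squarefree entries, one of them prime to \<open>r\<close>\<close>

definition pure_quat_square :: "rat \<Rightarrow> rat \<Rightarrow> rat \<Rightarrow> bool" where
  "pure_quat_square a b d \<longleftrightarrow> (\<exists>x y z. d = a * x\<^sup>2 + b * y\<^sup>2 - a * b * z\<^sup>2)"

lemma pure_quat_square_scale:
  assumes "pure_quat_square a b d" "s \<noteq> 0" "t \<noteq> 0"
  shows "pure_quat_square (a * s\<^sup>2) (b * t\<^sup>2) d"
proof -
  obtain x y z where "d = a * x\<^sup>2 + b * y\<^sup>2 - a * b * z\<^sup>2" using assms(1) by (auto simp: pure_quat_square_def)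
  then have "d = a * s\<^sup>2 * (x / s)\<^sup>2 + b * t\<^sup>2 * (y / t)\<^sup>2 - a * s\<^sup>2 * (b * t\<^sup>2) * (z / (s * t))\<^sup>2"
    using assms(2,3) by (simp add: power_divide power_mult_distrib)
  then show ?thesis unfolding pure_quat_square_def by blast
qed

lemma pure_quat_square_commute: "pure_quat_square a b d \<Longrightarrow> pure_quat_square b a d"
  unfolding pure_quat_square_def by (metis add.commute mult.commute)

lemma pure_quat_square_neg_mult:
  assumes "pure_quat_square a (- (a * b)) d"
  shows "pure_quat_square a b d"
proof -
  obtain x y z where "d = a * x\<^sup>2 + - (a * b) * y\<^sup>2 - a * (- (a * b)) * z\<^sup>2"
    using assms by (auto simp: pure_quat_square_def)
  then have "d = a * x\<^sup>2 + b * (a * z)\<^sup>2 - a * b * y\<^sup>2" by (simp add: power2_eq_square algebra_simps)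
  then show ?thesis unfolding pure_quat_square_def by blast
qed

lemma rat_squarefree_class:
  fixes a :: rat
  assumes "a \<noteq> 0"
  obtains A s where "squarefree (A :: int)" "s \<noteq> 0" "a = of_int A * s\<^sup>2"
proof -
  obtain n d where nd: "a = of_int n / of_int d" "d > 0" by (rule rat_int_fraction)
  have n: "n * d \<noteq> 0" using assms nd by auto
  let ?A = "squarefree_part (n * d)" and ?s = "square_part (n * d)"
  have "of_int (n * d) = (of_int (?A * ?s\<^sup>2) :: rat)" using squarefree_decompose[of "n * d"] by (simp only:)
  moreover have "a = of_int (n * d) / (of_int d)\<^sup>2" using nd by (simp add: power2_eq_square)
  ultimately have "a = of_int ?A * (of_int ?s / of_int d)\<^sup>2" by (simp add: power_divide)
  moreover have "of_int ?s / of_int d \<noteq> (0 :: rat)" using n nd by simp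
  moreover have "squarefree ?A" by simp
  ultimately show thesis using that by blast
qed

lemma pure_quat_square_of_local:
  fixes a b :: rat and D :: int and r :: nat
  assumes r: "prime r" "r > 2" and neg: "a < 0" "b < 0" "D < 0"
    and iso: "\<And>p. prime p \<Longrightarrow> p \<noteq> r \<Longrightarrow> quat_isotropic p a b"
    and aniso: "\<not> conic_isotropic r a b" and D: "\<not> QuadRes (int r) D"
  shows "pure_quat_square a b (of_int D)"
proof -
  have main: "pure_quat_square (of_int A) (of_int B) (of_int D)"
    if "A < 0" "B < 0" "squarefree A" "squarefree B" "\<not> int r dvd A"
      "\<And>p. prime p \<Longrightarrow> p \<noteq> r \<Longrightarrow> quat_isotropic p (of_int A) (of_int B)"
      "\<not> conic_isotropic r (of_int A) (of_int B)" for A B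
    unfolding pure_quat_square_def using pure_quat_square_of_local_int[OF r that(1,2) neg(3) that(3-7) D] .
  obtain A s where A: "squarefree A" "s \<noteq> 0" "a = of_int A * s\<^sup>2" using rat_squarefree_class[of a] neg by auto
  obtain B t where B: "squarefree B" "t \<noteq> 0" "b = of_int B * t\<^sup>2" using rat_squarefree_class[of b] neg by auto
  have A0: "A < 0" using neg(1) A by (simp add: mult_less_0_iff)
  have B0: "B < 0" using neg(2) B by (simp add: mult_less_0_iff)
  have isoAB: "quat_isotropic p (of_int A) (of_int B)" if "prime p" "p \<noteq> r" for p
    using quat_isotropic_scale[OF that(1) _ A(2) B(2)] iso[OF that] A(3) B(3) by simp
  have anisoAB: "\<not> conic_isotropic r (of_int A) (of_int B)"
    using conic_isotropic_scale[OF r(1) _ A(2) B(2)] aniso A(3) B(3) by auto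
  consider "\<not> int r dvd A" | "\<not> int r dvd B" | "int r dvd A" "int r dvd B" by blast
  then have "pure_quat_square (of_int A) (of_int B) (of_int D)"
  proof cases
    case 1
    show ?thesis by (rule main[OF A0 B0 A(1) B(1) 1 isoAB anisoAB])
  next
    case 2
    have "pure_quat_square (of_int B) (of_int A) (of_int D)"
    proof (rule main[OF B0 A0 B(1) A(1) 2])
      show "quat_isotropic p (of_int B) (of_int A)" if "prime p" "p \<noteq> r" for p
        by (rule quat_isotropic_commute[OF that(1) isoAB[OF that]])
      show "\<not> conic_isotropic r (of_int B) (of_int A)" using conic_isotropic_commute[OF r(1)] anisoAB by blast
    qed
    then show ?thesis by (rule pure_quat_square_commute)
  next
    \<comment> \<open>As \<open>- (A * B) = - (A1 * B1) * r\<^sup>2\<close>, the square class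
      \<open>E\<close> of \<open>- (A1 * B1)\<close> is prime to \<open>r\<close> and still
      negative. Up to isomorphism the algebra is \<open>(A, - A * B)\<close>, that is
      \<open>(E, A)\<close>.\<close>
    case 3
    then obtain A1 B1 where A1: "A = int r * A1" and B1: "B = int r * B1" by (auto simp: dvd_def)
    have r0: "int r > 0" using r by simp
    have "A1 < 0" "B1 < 0" using A0 B0 A1 B1 r0 by (simp_all add: mult_less_0_iff)
    then have neg1: "- (A1 * B1) < 0" by (simp add: mult_neg_neg)
    define E c where "E = squarefree_part (- (A1 * B1))" and "c = square_part (- (A1 * B1))"
    have E: "- (A1 * B1) = E * c\<^sup>2" unfolding E_def c_def by (rule squarefree_decompose)
    have c0: "c \<noteq> 0" using neg1 E by auto
    have E0: "E < 0" using neg1 c0 unfolding E by (simp add: mult_less_0_iff)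
    have "\<not> int r dvd A1" "\<not> int r dvd B1"
    proof -
      have "\<not> int r dvd n" if "squarefree (int r * n)" for n
      proof
        assume "int r dvd n"
        then have "(int r)\<^sup>2 dvd int r * n" by (simp add: power2_eq_square)
        then have "is_unit (int r)" using that unfolding squarefree_def by blast
        then show False using r by simp
      qed
      then show "\<not> int r dvd A1" "\<not> int r dvd B1" using A(1) B(1) A1 B1 by blast+
    qed
    moreover have "prime (int r)" using r by simp
    ultimately have "\<not> int r dvd - (A1 * B1)" by (simp add: prime_dvd_mult_iff)
    then have rE: "\<not> int r dvd E" unfolding E by auto
    let ?\<sigma> = "of_int (c * int r) :: rat"
    have \<sigma>: "?\<sigma> \<noteq> 0" using c0 r0 by simp
    have "- (A * B) = E * (c * int r)\<^sup>2"
      using arg_cong[OF E, of "\<lambda>n. n * (int r)\<^sup>2"] by (simp add: A1 B1 power2_eq_square mult_ac)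
    then have "of_int (- (A * B)) = (of_int (E * (c * int r)\<^sup>2) :: rat)" by (simp only:)
    then have EAB: "- (of_int A * of_int B) = of_int E * ?\<sigma>\<^sup>2" by simp
    have A1': "(of_int A :: rat) = of_int A * 1\<^sup>2" by simp
    have "pure_quat_square (of_int E) (of_int A) (of_int D)"
    proof (rule main[OF E0 A0 _ A(1) rE])
      show "squarefree E" by (simp add: E_def)
      fix p :: nat assume p: "prime p" "p \<noteq> r"
      have "quat_isotropic p (of_int A) (- (of_int A * of_int B))"
        using quat_isotropic_neg_mult[OF p(1) isoAB[OF p]] A0 by simp
      then have "quat_isotropic p (of_int A * 1\<^sup>2) (of_int E * ?\<sigma>\<^sup>2)" unfolding EAB by simp
      then have "quat_isotropic p (of_int A) (of_int E)"
        by (rule quat_isotropic_scale[OF p(1)]) (use \<sigma> in auto)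
      then show "quat_isotropic p (of_int E) (of_int A)" by (rule quat_isotropic_commute[OF p(1)])
    next
      show "\<not> conic_isotropic r (of_int E) (of_int A)"
      proof
        assume "conic_isotropic r (of_int E) (of_int A)"
        then have "conic_isotropic r (of_int A) (of_int E)" by (rule conic_isotropic_commute[OF r(1)])
        then have "conic_isotropic r (of_int A * 1\<^sup>2) (of_int E * ?\<sigma>\<^sup>2)"
          by (rule conic_isotropic_scale[OF r(1)]) (use \<sigma> in auto)
        then have "conic_isotropic r (of_int A) (- (of_int A * of_int B))" unfolding EAB by simp
        then have "conic_isotropic r (of_int A) (of_int B)"
          by (rule conic_isotropic_neg_mult[OF r(1)]) (use A0 in simp)
        then show False using anisoAB by blast
      qed
    qed
    then have "pure_quat_square (of_int A) (of_int E) (of_int D)" by (rule pure_quat_square_commute)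
    then have "pure_quat_square (of_int A * 1\<^sup>2) (of_int E * ?\<sigma>\<^sup>2) (of_int D)"
      by (rule pure_quat_square_scale) (use \<sigma> in auto)
    then have "pure_quat_square (of_int A) (- (of_int A * of_int B)) (of_int D)" unfolding EAB by simp
    then show ?thesis by (rule pure_quat_square_neg_mult)
  qed
  then show ?thesis unfolding A(3) B(3) by (rule pure_quat_square_scale[OF _ A(2) B(2)])
qed

section \<open>Integers of prescribed norm\<close>

lemma type_algebra_simps:
  "carrier ring_of_type_algebra = UNIV"
  "x \<otimes>\<^bsub>ring_of_type_algebra\<^esub> y = x * y"
  "x \<oplus>\<^bsub>ring_of_type_algebra\<^esub> y = x + y"
  "\<one>\<^bsub>ring_of_type_algebra\<^esub> = 1"
  "\<zero>\<^bsub>ring_of_type_algebra\<^esub> = 0"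
  by (simp_all add: ring_of_type_algebra_def)

lemma type_algebra_minus:
  fixes x y :: "'a :: field"
  shows "x \<ominus>\<^bsub>ring_of_type_algebra\<^esub> y = x - y"
proof -
  interpret R: ring "ring_of_type_algebra :: 'a ring" by (rule ring_from_type_algebra)
  have "\<ominus>\<^bsub>ring_of_type_algebra\<^esub> y = - y"
    by (rule R.minus_equality) (simp_all add: type_algebra_simps)
  then show ?thesis by (simp add: a_minus_def type_algebra_simps)
qed

text \<open>A nonnegative entry is the square of a real number, which gives a zero of the ternary
  form with the corresponding variable equal to 1.\<close>

lemma ramified_infinite_imp_negative:
  assumes "ramified_at a b Infinite_place" "a \<noteq> 0" "b \<noteq> 0"
  shows "a < 0" "b < 0"
proof -
  let ?R = "ring_of_type_algebra :: real ring"
  interpret R: cring ?R by (rule cring_from_type_algebra)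
  have div: "is_division_algebra (quat_algebra ?R (of_rat a) (of_rat b))" using assms(1) by simp
  note an = R.division_quat_anisotropic[OF div, simplified type_algebra_simps, OF UNIV_I UNIV_I UNIV_I UNIV_I UNIV_I]
  show "a < 0"
  proof (rule ccontr)
    assume "\<not> a < 0"
    then have "of_rat a \<ge> (0::real)" by simp
    then have "sqrt (of_rat a) * sqrt (of_rat a) = of_rat a * (1 * 1) + of_rat b * (0 * 0)" by simp
    from an(2)[OF this] show False by simp
  qed
  show "b < 0"
  proof (rule ccontr)
    assume "\<not> b < 0"
    then have "of_rat b \<ge> (0::real)" by simp
    then have "sqrt (of_rat b) * sqrt (of_rat b) = of_rat a * (0 * 0) + of_rat b * (1 * 1)" by simp
    from an(3)[OF this] show False by simp
  qed
qed

text \<open>If \<open>y\<close> is the pure quaternion with square \<open>t\<^sup>2 - 4 * m\<close>,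
  then \<open>(t + y) / 2\<close> is a root of \<open>X\<^sup>2 - t * X + m\<close>. As
  \<open>y\<close> is nonzero it is not a scalar, so no nonzero polynomial of smaller degree
  annihilates it.\<close>

lemma exists_integer_of_norm:
  fixes a b :: rat and t m :: int
  assumes sq: "pure_quat_square a b (of_int (t\<^sup>2 - 4 * m))" and ne: "t\<^sup>2 - 4 * m \<noteq> 0"
  obtains x where "x \<in> carrier (rat_quat_algebra a b)" "is_integer a b x" "reduced_norm a b x = of_int m"
proof -
  let ?A = "rat_quat_algebra a b" and ?S = "quat_scalar (ring_of_type_algebra :: rat ring)"
  interpret R: cring "ring_of_type_algebra :: rat ring" by (rule cring_from_type_algebra)
  interpret A: ring ?A by (rule R.quat_ring) (simp_all add: type_algebra_simps)
  have car: "u \<in> carrier ?A" for u by (simp add: quat_algebra_def type_algebra_simps)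
  obtain y1 y2 y3 where y: "of_int (t\<^sup>2 - 4 * m) = a * y1\<^sup>2 + b * y2\<^sup>2 - a * b * y3\<^sup>2"
    using sq by (auto simp: pure_quat_square_def)
  have nz: "y1 \<noteq> 0 \<or> y2 \<noteq> 0 \<or> y3 \<noteq> 0"
  proof (rule ccontr)
    assume "\<not> ?thesis"
    then have "of_int (t\<^sup>2 - 4 * m) = (0 :: rat)" using y by simp
    then show False using ne by (simp only: of_int_eq_0_iff)
  qed
  define x where "x = Quat (of_int t / 2) (y1 / 2) (y2 / 2) (y3 / 2)"
  have scal: "?S c \<otimes>\<^bsub>?A\<^esub> Quat u0 u1 u2 u3 = Quat (c * u0) (c * u1) (c * u2) (c * u3)" for c u0 u1 u2 u3
    using R.quat_scalar_mult(1)[of a b c u0 u1 u2 u3] by (simp add: type_algebra_simps)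
  have one: "\<one>\<^bsub>?A\<^esub> = Quat 1 0 0 0" and zero: "\<zero>\<^bsub>?A\<^esub> = Quat 0 0 0 0"
    by (simp_all add: quat_algebra_simps quat_scalar_def type_algebra_simps)
  have add: "Quat u0 u1 u2 u3 \<oplus>\<^bsub>?A\<^esub> Quat v0 v1 v2 v3 = Quat (u0 + v0) (u1 + v1) (u2 + v2) (u3 + v3)"
    for u0 u1 u2 u3 v0 v1 v2 v3
    by (simp add: quat_algebra_simps quat_add_def type_algebra_simps)
  have y': "a * y1\<^sup>2 + b * y2\<^sup>2 - a * b * y3\<^sup>2 = of_int t * of_int t - 4 * of_int m"
    unfolding y[symmetric] by (simp add: power2_eq_square)
  have norm: "reduced_norm a b x = of_int m"
    using y' by (simp add: reduced_norm_def quat_algebra_simps quat_mult_def quat_conj_def x_def type_algebra_simps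
        type_algebra_minus power2_eq_square field_simps)
  have sq_x: "x \<otimes>\<^bsub>?A\<^esub> x = Quat (of_int t * of_int t / 2 - of_int m) (of_int t * y1 / 2) (of_int t * y2 / 2) (of_int t * y3 / 2)"
    using y' by (simp add: quat_algebra_simps quat_mult_def x_def type_algebra_simps type_algebra_minus
        power2_eq_square field_simps)
  have pow: "x [^]\<^bsub>?A\<^esub> (0::nat) = Quat 1 0 0 0" "x [^]\<^bsub>?A\<^esub> Suc 0 = x" "x [^]\<^bsub>?A\<^esub> Suc (Suc 0) = x \<otimes>\<^bsub>?A\<^esub> x"
    using car[of x] by (simp add: one, simp_all)
  define f where "f = [:of_int m, - of_int t, 1 :: rat:]"
  have deg: "Polynomial.degree f = Suc (Suc 0)" by (simp add: f_def)
  have "is_minimal_poly a b x f"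
    unfolding is_minimal_poly_def
  proof (intro conjI allI impI)
    show "Polynomial.lead_coeff f = 1" by (simp add: f_def)
    show "quat_poly_eval a b f x = \<zero>\<^bsub>?A\<^esub>"
      unfolding quat_poly_eval_def deg
      by (simp add: A.finsum_Suc car Pi_I pow sq_x)
         (simp add: f_def scal zero x_def, simp add: quat_scalar_def type_algebra_simps add)
  next
    fix g assume g: "g \<noteq> 0 \<and> quat_poly_eval a b g x = \<zero>\<^bsub>?A\<^esub>"
    show "Polynomial.degree f \<le> Polynomial.degree g"
    proof (rule ccontr)
      assume "\<not> ?thesis"
      then consider "Polynomial.degree g = 0" | "Polynomial.degree g = Suc 0" unfolding deg by linarith
      then show False
      proof cases
        case 1
        then have "?S (Polynomial.coeff g 0) \<otimes>\<^bsub>?A\<^esub> x [^]\<^bsub>?A\<^esub> (0::nat) = \<zero>\<^bsub>?A\<^esub>"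
          using g unfolding quat_poly_eval_def by (simp add: car Pi_I)
        then have "Polynomial.coeff g 0 = 0" unfolding pow scal zero by simp
        then show False using g 1 by (metis leading_coeff_0_iff)
      next
        case 2
        have "?S (Polynomial.coeff g (Suc 0)) \<otimes>\<^bsub>?A\<^esub> x [^]\<^bsub>?A\<^esub> Suc 0 \<oplus>\<^bsub>?A\<^esub>
            ?S (Polynomial.coeff g 0) \<otimes>\<^bsub>?A\<^esub> x [^]\<^bsub>?A\<^esub> (0::nat) = \<zero>\<^bsub>?A\<^esub>"
          using g unfolding quat_poly_eval_def 2 by (simp add: A.finsum_Suc car Pi_I del: A.nat_pow_Suc A.nat_pow_0)
        then have "Polynomial.coeff g (Suc 0) = 0"
          using nz unfolding pow unfolding x_def scal zero add by auto
        then show False using 2 g by (metis leading_coeff_0_iff)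
      qed
    qed
  qed
  moreover have "Polynomial.coeff f n \<in> \<int>" for n
    by (auto simp: f_def coeff_pCons split: nat.splits)
  ultimately have "is_integer a b x" unfolding is_integer_def by blast
  then show thesis using that car norm by blast
qed

theorem theorem5p10:
  fixes r m :: nat and a b :: rat
  assumes "prime r" and "r > 2"
    and "a \<noteq> 0" and "b \<noteq> 0"
    and "ramified_places a b = {Finite_place r, Infinite_place}"
    and "m > 0" and "coprime m r"
    and "real m > C r"
  shows "\<not> outlier a b m"
proof -
  have odd: "odd r" using assms(1,2) prime_odd_nat by simp
  have pr: "prime (int r)" using assms(1) by simp
  have "Infinite_place \<in> ramified_places a b" "Finite_place r \<in> ramified_places a b" using assms(5) by auto
  then have inf: "ramified_at a b Infinite_place" and fin: "ramified_at a b (Finite_place r)"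
    by (auto simp: ramified_places_def simp del: ramified_at.simps)
  have neg: "a < 0" "b < 0" using ramified_infinite_imp_negative[OF inf assms(3,4)] by blast+
  have iso: "quat_isotropic p a b" if "prime p" "p \<noteq> r" for p
  proof (rule not_ramified_imp_quat_isotropic[OF that(1)], rule notI)
    assume "ramified_at a b (Finite_place p)"
    then have "Finite_place p \<in> ramified_places a b" using that(1) by (auto simp: ramified_places_def places_def simp del: ramified_at.simps)
    then show False using assms(5) that(2) by simp
  qed
  have aniso: "\<not> conic_isotropic r a b" by (rule ramified_imp_not_conic_isotropic[OF assms(1) fin])
  \<comment> \<open>If \<open>r\<close> divided \<open>m\<close>, every
    \<open>t\<^sup>2 - 4 * m\<close> would be a square modulo \<open>r\<close>, and no
    \<open>t\<close> would give a nonresidue.\<close>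
  have "\<not> int r dvd 4 * int m"
  proof
    assume "int r dvd 4 * int m"
    moreover have "\<not> int r dvd int m"
      using assms(1,7) coprime_common_divisor_nat[of m r r] by auto
    ultimately have "int r dvd 2 * 2" using pr by (simp add: prime_dvd_mult_iff)
    then have "int r dvd 2" using pr prime_dvd_mult_iff by blast
    then show False using zdvd_imp_le[of "int r" 2] assms(2) by simp
  qed
  then obtain t where t: "\<bar>t\<bar> \<le> (int r - 1) div 2" "\<not> QuadRes (int r) (t\<^sup>2 - 4 * int m)"
    using exists_square_minus_nonresidue[OF assms(1) odd] by blast
  \<comment> \<open>The 16 in the bound is 4 times 4: one factor from
    \<open>2 * \<bar>t\<bar> < r\<close>, the other from the discriminant
    \<open>t\<^sup>2 - 4 * m\<close>.\<close>
  have D: "t\<^sup>2 - 4 * int m < 0"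
  proof -
    have "2 * \<bar>t\<bar> < int r" using t(1) assms(2) by linarith
    then have "(2 * \<bar>t\<bar>)\<^sup>2 < (int r)\<^sup>2" by (intro power_strict_mono) auto
    then have "4 * t\<^sup>2 < (int r)\<^sup>2" by (simp add: power_mult_distrib)
    moreover have "(int r)\<^sup>2 < 16 * int m"
    proof -
      have "(real r)\<^sup>2 < 16 * real m" using assms(8) by (simp add: C_def)
      then have "real_of_int ((int r)\<^sup>2) < real_of_int (16 * int m)" by simp
      then show ?thesis by (simp only: of_int_less_iff)
    qed
    ultimately show ?thesis by linarith
  qed
  have "pure_quat_square a b (of_int (t\<^sup>2 - 4 * int m))"
    by (rule pure_quat_square_of_local[OF assms(1,2) neg D iso aniso t(2)])
  moreover have "t\<^sup>2 - 4 * int m \<noteq> 0" using D by linarith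
  ultimately obtain x where "x \<in> carrier (rat_quat_algebra a b)" "is_integer a b x" "reduced_norm a b x = of_int (int m)"
    by (rule exists_integer_of_norm)
  then show ?thesis by (auto simp: outlier_def)
qed

end
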